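(* For any realization $(x_1,\dots,x_n)$ of $(X_1,\dots,X_n)$, any integer $m\ge1$ and any $0<a<1$, $$\mathbb E\Big(\mathbb L\big((\hat g_1^n)_{\hat k}\big)-\mathbb L\big((\hat g_1^n)_{\tilde k}\big)\Big)\le\frac{4t_{mix}\big(8(1+\frac1{\gamma_{ps}})+20\big)\ln\big(eN\big(2\exp(\frac{\ln2}{t_{mix}})+1\big)\big)}{a(1-a)m}+\frac{4t_{mix}\big(8(1+\frac1{\gamma_{ps}})+20\big)\ln\big(eN\big(2\exp(\frac{\ln2}{t_{mix}})+1\big)\big)}{a(1+a)m}+\frac{2a}{1-a^2}\mathbb L\big((\hat g_1^n)_{\tilde k}\big).$$ Equivalently, if $g^*$ denotes the best prediction function, $$\mathbb E\Big(\mathbb L\big((\hat g_1^n)_{\hat k}\big)-\mathbb L(g^* )\Big)\le\Big(1+\frac{2a}{1-a^2}\Big)\Big(\mathbb L\big((\hat g_1^n)_{\tilde k}\big)-\mathbb L(g^* )\Big)+\frac{4t_{mix}\big(8(1+\frac1{\gamma_{ps}})+20\big)\ln\big(eN\big(2\exp(\frac{\ln2}{t_{mix}})+1\big)\big)}{a(1-a)m}+\frac{4t_{mix}\big(8(1+\frac1{\gamma_{ps}})+20\big)\ln\big(eN\big(2\exp(\frac{\ln2}{t_{mix}})+1\big)\big)}{a(1+a)m}+\frac{2a}{1-a^2}\mathbb L(g^* ).$$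
   Context: Process. Let $\mathcal Y$ be a Polish space and $(Y_t)_{t\in\mathbb Z}$ a $\mathcal Y$-valued Markov chain of order $k_0$ that is time homogeneous, stationary and uniformly ergodic. Fix an integer $p\ge k_0$ and put $X_t=(Y_t,Y_{t-1},\dots,Y_{t-p})^T$, with values in $\mathcal X=\mathcal Y^{p+1}$. Then $(X_t)_{t\in\mathbb Z}$ is a time homogeneous, stationary, uniformly ergodic Markov chain of order $1$; $K$ denotes its transition kernel and $Q$ its stationary law. With $d_{TV}(P,P')=\sup_A|P(A)-P'(A)|$, uniform ergodicity means that there are $C>0$ and $0<\rho<1$ with $\sup_{x\in\mathcal X}d_{TV}(K^n(x,\cdot),Q)\le C\rho^n$ for all $n$. The mixing time is $t_{mix}=\min\{t\ge 1:\ \sup_{x\in\mathcal X}d_{TV}(K^t(x,\cdot),Q)\le 1/4\}$. Pseudo spectral gap. View Markov kernels with invariant law $Q$ as bounded operators on $L^2(Q)$; $K^*$ is the adjoint of $K$ on $L^2(Q)$ (the time reversal of $K$). For a self-adjoint Markov operator $M$ on $L^2(Q)$ let $S_2(M)=\{\lambda\in\mathbb C\setminus\{0\}: (\lambda I-M)^{-1}$ does not exist as a bounded linear operator on $L^2(Q)\}$; its spectral gap is $\gamma(M)=1-\sup\{\lambda\in S_2(M):\lambda\ne1\}$ (with $\sup\emptyset=0$) if the eigenvalue $1$ has multiplicity one, and $\gamma(M)=0$ otherwise. The pseudo spectral gap is $\gamma_{ps}=\max_{k\ge1}\gamma((K^* )^kK^k)/k$. Losses. A prediction function is a measurable $g:\mathcal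 Y^p\to\mathcal Y$; $\mathcal F$ is the set of all of them. A loss function is a measurable $L:\mathcal Y^2\to[0,1]$; write $L(g(X_t)):=L(g(Y_{t-1},\dots,Y_{t-p}),Y_t)$. The expected loss is $\mathbb L(g)=\mathbb E_Q(L(g(X)))$ with $X\sim Q$, and the best prediction function is $g^*\in\arg\min_{g\in\mathcal F}\mathbb L(g)$. The out-of-sample empirical loss on the validation set $(X_{n+1},\dots,X_{n+m})$ is $\hat L_m(g)=\frac1m\sum_{j=n+1}^{n+m}L(g(X_j))$. Estimators and selection. Let $\tilde L$ be a loss function (possibly different from $L$), $N$ a positive integer and $\mathcal G_1,\dots,\mathcal G_N\subset\mathcal F$. For a realization $x_1,\dots,x_n$ of the learning set $X_1,\dots,X_n$, $(\hat g_1^n)_k\in\arg\min_{g\in\mathcal G_k}\sum_{t=1}^n\tilde L(g(x_t))$, $k=1,\dots,N$. Put $\tilde k\in\arg\min_{1\le k\le N}\mathbb L((\hat g_1^n)_k)$ and $\hat k\in\arg\min_{1\le k\le N}\hat L_m((\hat g_1^n)_k)$ ($\hat k$ depends on the validation set and is random). $\mathbb E$ is taken conditionally on $X_1=x_1,\dots,X_n=x_n$; thus the functions $(\hat g_1^n)_k$ are fixed, and $(X_{n+j})_{j\ge1}$ is the chain with kernel $K$ started from $X_n=x_n$. *)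

theory Defs
  imports "HOL-Probability.Probability"
begin

section \<open>Markov kernels\<close>

definition tv_dist :: "'a measure \<Rightarrow> 'a measure \<Rightarrow> real" where
  "tv_dist P P' = (SUP A\<in>sets P. \<bar>measure P A - measure P' A\<bar>)"

primrec kernel_pow :: "'a measure \<Rightarrow> ('a \<Rightarrow> 'a measure) \<Rightarrow> nat \<Rightarrow> 'a \<Rightarrow> 'a measure" where
  "kernel_pow S K 0 x = return S x"
| "kernel_pow S K (Suc n) x = kernel_pow S K n x \<bind> K"

definition uniformly_ergodic :: "'a measure \<Rightarrow> ('a \<Rightarrow> 'a measure) \<Rightarrow> 'a measure \<Rightarrow> bool" where
  "uniformly_ergodic S K Q \<longleftrightarrow> (\<exists>C>0. \<exists>\<rho>. 0 < \<rho> \<and> \<rho> < 1 \<and>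
     (\<forall>n. (SUP x\<in>space S. tv_dist (kernel_pow S K n x) Q) \<le> C * \<rho> ^ n))"

definition mixing_time :: "'a measure \<Rightarrow> ('a \<Rightarrow> 'a measure) \<Rightarrow> 'a measure \<Rightarrow> nat" where
  "mixing_time S K Q =
     (LEAST t. 1 \<le> t \<and> (SUP x\<in>space S. tv_dist (kernel_pow S K t x) Q) \<le> 1 / 4)"

text \<open>Joint law of the states at the times \<open>n, \<dots>, n + m\<close> of the chain with kernel \<open>K\<close>
  that is in state \<open>x\<close> at time \<open>n\<close>.\<close>

primrec path_law ::
    "'a measure \<Rightarrow> ('a \<Rightarrow> 'a measure) \<Rightarrow> nat \<Rightarrow> 'a \<Rightarrow> nat \<Rightarrow> (nat \<Rightarrow> 'a) measure" where
  "path_law S K n x 0 = return (PiM {n..n} (\<lambda>_. S)) (\<lambda>i\<in>{n..n}. x)"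
| "path_law S K n x (Suc m) = path_law S K n x m \<bind>
     (\<lambda>w. distr (K (w (n + m))) (PiM {n..n + Suc m} (\<lambda>_. S)) (\<lambda>z. w(n + Suc m := z)))"


section \<open>Operators on the complex Hilbert space of square integrable functions\<close>

text \<open>Elements of $L^2(Q)$ are represented by functions and operators by maps between
  representatives. All identities between elements of $L^2(Q)$ are therefore identities
  \<open>Q\<close>-almost everywhere. The norm bound in \<open>l2_operator\<close> together with
  linearity makes such a map independent of the representative.\<close>

definition l2_space :: "'a measure \<Rightarrow> ('a \<Rightarrow> complex) set" where
  "l2_space Q = {f \<in> borel_measurable Q. integrable Q (\<lambda>x. (cmod (f x))\<^sup>2)}"

definition l2_inner :: "'a measure \<Rightarrow> ('a \<Rightarrow> complex) \<Rightarrow> ('a \<Rightarrow> complex) \<Rightarrow> complex" where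
  "l2_inner Q f g = (\<integral>x. f x * cnj (g x) \<partial>Q)"

definition l2_norm :: "'a measure \<Rightarrow> ('a \<Rightarrow> complex) \<Rightarrow> real" where
  "l2_norm Q f = sqrt (\<integral>x. (cmod (f x))\<^sup>2 \<partial>Q)"

definition l2_operator :: "'a measure \<Rightarrow> (('a \<Rightarrow> complex) \<Rightarrow> 'a \<Rightarrow> complex) \<Rightarrow> bool" where
  "l2_operator Q T \<longleftrightarrow>
     (\<forall>f\<in>l2_space Q. T f \<in> l2_space Q) \<and>
     (\<forall>f\<in>l2_space Q. \<forall>g\<in>l2_space Q. AE x in Q. T (\<lambda>x. f x + g x) x = T f x + T g x) \<and>
     (\<forall>c. \<forall>f\<in>l2_space Q. AE x in Q. T (\<lambda>x. c * f x) x = c * T f x) \<and>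
     (\<exists>B. \<forall>f\<in>l2_space Q. l2_norm Q (T f) \<le> B * l2_norm Q f)"

definition kernel_op :: "('a \<Rightarrow> 'a measure) \<Rightarrow> ('a \<Rightarrow> complex) \<Rightarrow> 'a \<Rightarrow> complex" where
  "kernel_op K f x = (\<integral>y. f y \<partial>K x)"

text \<open>The adjoint is unique up to \<open>Q\<close>-almost everywhere equality of its values; the
  choice made here does not affect any of the notions below.\<close>

definition l2_adjoint ::
    "'a measure \<Rightarrow> (('a \<Rightarrow> complex) \<Rightarrow> 'a \<Rightarrow> complex) \<Rightarrow> ('a \<Rightarrow> complex) \<Rightarrow> 'a \<Rightarrow> complex" where
  "l2_adjoint Q T = (SOME T'. l2_operator Q T' \<and>
     (\<forall>f\<in>l2_space Q. \<forall>g\<in>l2_space Q. l2_inner Q (T' f) g = l2_inner Q f (T g)))"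

definition l2_spectrum :: "'a measure \<Rightarrow> (('a \<Rightarrow> complex) \<Rightarrow> 'a \<Rightarrow> complex) \<Rightarrow> complex set" where
  "l2_spectrum Q T = {c. c \<noteq> 0 \<and> \<not> (\<exists>R. l2_operator Q R \<and>
     (\<forall>f\<in>l2_space Q. (AE x in Q. R (\<lambda>x. c * f x - T f x) x = f x) \<and>
                      (AE x in Q. c * R f x - T (R f) x = f x)))}"

definition eigenvalue_one_simple ::
    "'a measure \<Rightarrow> (('a \<Rightarrow> complex) \<Rightarrow> 'a \<Rightarrow> complex) \<Rightarrow> bool" where
  "eigenvalue_one_simple Q T \<longleftrightarrow>
     (\<exists>f\<in>l2_space Q. \<not> (AE x in Q. f x = 0) \<and> (AE x in Q. T f x = f x) \<and>
       (\<forall>g\<in>l2_space Q. (AE x in Q. T g x = g x) \<longrightarrow> (\<exists>c. AE x in Q. g x = c * f x)))"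

text \<open>Only used for self-adjoint operators, whose spectrum is real.\<close>

definition spectral_gap :: "'a measure \<Rightarrow> (('a \<Rightarrow> complex) \<Rightarrow> 'a \<Rightarrow> complex) \<Rightarrow> real" where
  "spectral_gap Q T =
     (if eigenvalue_one_simple Q T
      then let A = {r::real. complex_of_real r \<in> l2_spectrum Q T \<and> r \<noteq> 1}
           in 1 - (if A = {} then 0 else Sup A)
      else 0)"

text \<open>The gaps lie in $[0, 1]$, so the supremum over \<open>k\<close> is a maximum.\<close>

definition pseudo_spectral_gap :: "'a measure \<Rightarrow> ('a \<Rightarrow> 'a measure) \<Rightarrow> real" where
  "pseudo_spectral_gap Q K =
     (SUP k\<in>{1::nat..}.
        spectral_gap Q ((l2_adjoint Q (kernel_op K) ^^ k) \<circ> (kernel_op K ^^ k)) / real k)"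


section \<open>Markov chains of higher order\<close>

definition window_space :: "nat \<Rightarrow> (nat \<Rightarrow> 'y::polish_space) measure" where
  "window_space q = PiM {..<q} (\<lambda>_. borel)"

text \<open>The vector $(y_t, y_{t-1}, \dots, y_{t-q+1})$.\<close>

definition window :: "nat \<Rightarrow> (int \<Rightarrow> 'y) \<Rightarrow> int \<Rightarrow> nat \<Rightarrow> 'y" where
  "window q y t = (\<lambda>i\<in>{..<q}. y (t - int i))"

definition past_algebra :: "'w measure \<Rightarrow> (int \<Rightarrow> 'w \<Rightarrow> 'y::polish_space) \<Rightarrow> int \<Rightarrow> 'w measure" where
  "past_algebra M Y t =
     vimage_algebra (space M) (\<lambda>w. \<lambda>s\<in>{..<t}. Y s w) (PiM {..<t} (\<lambda>_. borel))"

text \<open>The conditional law of $Y_t$ given $(Y_s)_{s<t}$ is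
  $\kappa((Y_{t-1}, \dots, Y_{t-k}), \cdot)$, with a kernel that does not depend on \<open>t\<close>.\<close>

definition homogeneous_markov ::
    "'w measure \<Rightarrow> (int \<Rightarrow> 'w \<Rightarrow> 'y::polish_space) \<Rightarrow> nat \<Rightarrow> ((nat \<Rightarrow> 'y) \<Rightarrow> 'y measure) \<Rightarrow> bool" where
  "homogeneous_markov M Y k \<kappa> \<longleftrightarrow>
     prob_space M \<and> (\<forall>t. Y t \<in> borel_measurable M) \<and>
     \<kappa> \<in> window_space k \<rightarrow>\<^sub>M prob_algebra borel \<and>
     (\<forall>t. \<forall>A\<in>sets borel. AE w in M.
        real_cond_exp M (past_algebra M Y t) (\<lambda>v. indicator A (Y t v)) w =
        measure (\<kappa> (window k (\<lambda>s. Y s w) (t - 1))) A)"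

definition stationary_process :: "'w measure \<Rightarrow> (int \<Rightarrow> 'w \<Rightarrow> 'y::polish_space) \<Rightarrow> bool" where
  "stationary_process M Y \<longleftrightarrow> (\<forall>h.
     distr M (PiM UNIV (\<lambda>_. borel)) (\<lambda>w t. Y (t + h) w) =
     distr M (PiM UNIV (\<lambda>_. borel)) (\<lambda>w t. Y t w))"

text \<open>Transition kernel of $X_t = (Y_t, \dots, Y_{t-p})$ when \<open>Y\<close> has order \<open>k \<le> p\<close>
  and kernel \<open>\<kappa>\<close>: draw the new value from \<open>\<kappa>\<close> and shift.\<close>

definition window_kernel ::
    "nat \<Rightarrow> nat \<Rightarrow> ((nat \<Rightarrow> 'y) \<Rightarrow> 'y::polish_space measure) \<Rightarrow> (nat \<Rightarrow> 'y) \<Rightarrow> (nat \<Rightarrow> 'y) measure" where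
  "window_kernel p k \<kappa> x =
     distr (\<kappa> (restrict x {..<k})) (window_space (Suc p))
       (\<lambda>y. \<lambda>i\<in>{..<Suc p}. case i of 0 \<Rightarrow> y | Suc j \<Rightarrow> x j)"

definition stationary_law :: "'w measure \<Rightarrow> (int \<Rightarrow> 'w \<Rightarrow> 'y::polish_space) \<Rightarrow> nat \<Rightarrow> (nat \<Rightarrow> 'y) measure" where
  "stationary_law M Y p = distr M (window_space (Suc p)) (\<lambda>w. window (Suc p) (\<lambda>s. Y s w) 0)"


section \<open>Prediction and losses\<close>

definition prediction_functions :: "nat \<Rightarrow> ((nat \<Rightarrow> 'y::polish_space) \<Rightarrow> 'y) set" where
  "prediction_functions p = window_space p \<rightarrow>\<^sub>M borel"

definition loss_function :: "('y::polish_space \<times> 'y \<Rightarrow> real) \<Rightarrow> bool" where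
  "loss_function L \<longleftrightarrow> L \<in> borel_measurable (borel \<Otimes>\<^sub>M borel) \<and> range L \<subseteq> {0..1}"

text \<open>For $x = (y_t, y_{t-1}, \dots, y_{t-p})$ the loss is
  $L(g(y_{t-1}, \dots, y_{t-p}), y_t)$.\<close>

definition loss ::
    "nat \<Rightarrow> ('y \<times> 'y \<Rightarrow> real) \<Rightarrow> ((nat \<Rightarrow> 'y) \<Rightarrow> 'y) \<Rightarrow> (nat \<Rightarrow> 'y) \<Rightarrow> real" where
  "loss p L g x = L (g (\<lambda>i\<in>{..<p}. x (Suc i)), x 0)"

definition expected_loss ::
    "nat \<Rightarrow> ('y \<times> 'y \<Rightarrow> real) \<Rightarrow> (nat \<Rightarrow> 'y) measure \<Rightarrow> ((nat \<Rightarrow> 'y) \<Rightarrow> 'y) \<Rightarrow> real" where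
  "expected_loss p L Q g = (\<integral>x. loss p L g x \<partial>Q)"

definition validation_loss ::
    "nat \<Rightarrow> ('y \<times> 'y \<Rightarrow> real) \<Rightarrow> nat \<Rightarrow> nat \<Rightarrow> (nat \<Rightarrow> nat \<Rightarrow> 'y) \<Rightarrow> ((nat \<Rightarrow> 'y) \<Rightarrow> 'y) \<Rightarrow> real" where
  "validation_loss p L n m v g = (1 / real m) * (\<Sum>j=n+1..n+m. loss p L g (v j))"

definition training_loss ::
    "nat \<Rightarrow> ('y \<times> 'y \<Rightarrow> real) \<Rightarrow> nat \<Rightarrow> (nat \<Rightarrow> nat \<Rightarrow> 'y) \<Rightarrow> ((nat \<Rightarrow> 'y) \<Rightarrow> 'y) \<Rightarrow> real" where
  "training_loss p L n x g = (\<Sum>t=1..n. loss p L g (x t))"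

end

theory Submission
  imports Defs
begin

text \<open>The loss is controlled by the mixing time alone; of the pseudo spectral gap \<open>\<gamma>\<close> only
  \<open>\<gamma> \<ge> 0\<close> matters. For a loss \<open>f\<close> with values in the unit interval and \<open>\<mu> = Q f\<close>, the Poisson equation
  \<open>K h = h - (f - \<mu>)\<close> has a solution with \<open>0 \<le> h \<le> H = 2 t\<^sub>m\<^sub>i\<^sub>x\<close>, because \<open>K\<^sup>t\<close> halves oscillations at
  \<open>t = t\<^sub>m\<^sub>i\<^sub>x\<close>. Then \<open>u = 1 + (b/H) h\<close> satisfies \<open>K u = u - (b/H) (f - \<mu>)\<close>, hence
  \<open>K u \<le> u exp (- (b/H) (f/(1+b) - \<mu>))\<close> with \<open>1 \<le> u \<le> 1 + b\<close>, and iterating along the path bounds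
  an exponential moment of \<open>\<Sum>j. f(X\<^sub>j)/(1+b) - \<mu>\<close> by \<open>1 + b\<close>. The function \<open>H - h\<close> gives the other tail.
  Since these bounds compare \<open>f\<close> with \<open>\<mu>\<close> multiplicatively, a union bound over the \<open>N\<close> candidates
  gives the oracle inequality without any variance estimate.

  That \<open>\<gamma> \<ge> 0\<close> amounts to the real spectra of the contractions \<open>(K\<^sup>*)\<^sup>k K\<^sup>k\<close> lying in \<open>[-1, 1]\<close>: outside,
  the Neumann series is a resolvent.\<close>

section \<open>Oscillation and total variation\<close>

text \<open>The realization of the learning set is arbitrary, so the path starts from one fixed
  state, about which statements holding only Q-almost everywhere say nothing. Hence kernels act on
  bounded measurable functions at every state, the Poisson equation holds everywhere, and since u
  lies between 1 and 1 + b at every state, the moment bound does not depend on the starting state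
  and no burn-in term appears. For the pseudo spectral gap the obstacle is that it is defined by a
  choice and a supremum. \<open>l2_adjoint\<close> is a \<open>SOME\<close> term and gives
  information only once an adjoint is known to exist; \<open>SUP\<close> is meaningful only for a
  bounded family. The existence of the adjoint rests on the invariance of Q under K, which is not
  among the hypotheses but follows from stationarity and the conditional law of Y given its
  past.\<close>

lemma tv_dist_bdd:
  assumes "prob_space P" "prob_space P'"
  shows "bdd_above ((\<lambda>A. \<bar>measure P A - measure P' A\<bar>) ` A)"
proof -
  have "\<bar>measure P A - measure P' A\<bar> \<le> 1" for A
    using prob_space.prob_le_1[OF assms(1), of A] prob_space.prob_le_1[OF assms(2), of A]
      measure_nonneg[of P A] measure_nonneg[of P' A] by linarith
  then show ?thesis by (intro bdd_aboveI[of _ 1]) auto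
qed

lemma tv_dist_upper:
  assumes "prob_space P" "prob_space P'" "A \<in> sets P"
  shows "\<bar>measure P A - measure P' A\<bar> \<le> tv_dist P P'"
  unfolding tv_dist_def by (rule cSUP_upper[OF assms(3) tv_dist_bdd[OF assms(1,2)]])

lemma tv_dist_le_1:
  assumes "prob_space P" "prob_space P'"
  shows "tv_dist P P' \<le> 1"
  unfolding tv_dist_def
proof (rule cSUP_least)
  fix A assume "A \<in> sets P"
  show "\<bar>measure P A - measure P' A\<bar> \<le> 1"
    using prob_space.prob_le_1[OF assms(1), of A] prob_space.prob_le_1[OF assms(2), of A]
      measure_nonneg[of P A] measure_nonneg[of P' A] by linarith
qed auto

text \<open>Used with t = n f(x): the number of level sets containing x is the integer part of n
  f(x), so their average recovers f(x) from below up to 1/n.\<close>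

lemma sum_indicator_levels:
  fixes t :: real
  assumes "0 \<le> t" "t \<le> real n"
  shows "(\<Sum>j=1..n. if real j \<le> t then 1 else 0 :: real) = of_int \<lfloor>t\<rfloor>"
proof -
  have "{j\<in>{1..n}. real j \<le> t} = {1..nat \<lfloor>t\<rfloor>}"
    using assms by (auto simp: le_nat_floor le_floor_iff) linarith+
  then have "card {j\<in>{1..n}. real j \<le> t} = nat \<lfloor>t\<rfloor>" by simp
  moreover have "(\<Sum>j=1..n. if real j \<le> t then 1 else 0 :: real) = real (card {j\<in>{1..n}. real j \<le> t})"
    by (subst sum.inter_filter[symmetric]) auto
  ultimately show ?thesis using assms by simp
qed

lemma abs_le_max_abs: "l \<le> z \<Longrightarrow> z \<le> u \<Longrightarrow> \<bar>z\<bar> \<le> max \<bar>l\<bar> \<bar>u::real\<bar>"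
  by linarith

text \<open>Up to an error of \<open>1/n\<close>, a function with values in the unit interval is the average of the
  indicators of its level sets \<open>{f \<ge> j/n}\<close>.\<close>

lemma integral_diff_le_tv_dist_unit:
  fixes f :: "'a \<Rightarrow> real"
  assumes P: "prob_space P" and P': "prob_space P'" and sets: "sets P' = sets P"
    and f[measurable]: "f \<in> borel_measurable P" and f01: "f \<in> space P \<rightarrow> {0..1}"
  shows "(\<integral>x. f x \<partial>P) - (\<integral>x. f x \<partial>P') \<le> tv_dist P P'"
proof -
  interpret P: prob_space P by fact
  interpret P': prob_space P' by fact
  have sp: "space P' = space P" using sets by (rule sets_eq_imp_space_eq)
  have f'[measurable]: "f \<in> borel_measurable P'" using f sets by (simp cong: measurable_cong_sets)
  have b: "f x \<le> 1" "0 \<le> f x" if "x \<in> space P" for x using f01 that by auto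
  have intf: "integrable P f" "integrable P' f"
    by (auto intro!: P.integrable_const_bound[of _ 1] P'.integrable_const_bound[of _ 1] AE_I2 simp: b sp)
  have le: "(\<integral>x. f x \<partial>P) - (\<integral>x. f x \<partial>P') \<le> tv_dist P P' + 1 / real n" if n: "n > 0" for n :: nat
  proof -
    define A where "A j = {x\<in>space P. real j \<le> real n * f x}" for j :: nat
    have A[measurable]: "A j \<in> sets P" "A j \<in> sets P'" for j unfolding A_def sets by measurable
    define g where "g x = (1 / real n) * (\<Sum>j=1..n. indicator (A j) x :: real)" for x
    have g_eq: "g x = of_int \<lfloor>real n * f x\<rfloor> / real n" if x: "x \<in> space P" for x
    proof -
      have "(\<Sum>j=1..n. indicator (A j) x :: real) = (\<Sum>j=1..n. if real j \<le> real n * f x then 1 else 0)"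
        by (intro sum.cong) (auto simp: A_def x indicator_def)
      also have "\<dots> = of_int \<lfloor>real n * f x\<rfloor>"
        by (rule sum_indicator_levels) (use b[OF x] n in \<open>auto simp: mult_left_le\<close>)
      finally show ?thesis unfolding g_def by simp
    qed
    have gf: "g x \<le> f x" "f x \<le> g x + 1 / real n" if x: "x \<in> space P" for x
    proof -
      have "of_int \<lfloor>real n * f x\<rfloor> \<le> real n * f x" "real n * f x \<le> of_int \<lfloor>real n * f x\<rfloor> + 1"
        by linarith+
      then show "g x \<le> f x" "f x \<le> g x + 1 / real n"
        unfolding g_eq[OF x] using n by (auto simp: field_simps)
    qed
    have int_ind: "integrable P (indicator (A j) :: _ \<Rightarrow> real)" "integrable P' (indicator (A j) :: _ \<Rightarrow> real)" for j
      using P.emeasure_finite P'.emeasure_finite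
      by (intro integrable_real_indicator; simp add: less_top[symmetric])+
    have intg: "integrable P g" "integrable P' g"
      unfolding g_def by (intro Bochner_Integration.integrable_mult_right Bochner_Integration.integrable_sum int_ind)+
    have "(\<integral>x. f x \<partial>P) \<le> (\<integral>x. g x + 1 / real n \<partial>P)"
      using intf intg gf by (intro integral_mono) auto
    also have "\<dots> = (\<integral>x. g x \<partial>P) + 1 / real n"
      using intg by (simp add: P.prob_space)
    finally have 1: "(\<integral>x. f x \<partial>P) \<le> (\<integral>x. g x \<partial>P) + 1 / real n" .
    have 2: "(\<integral>x. g x \<partial>P') \<le> (\<integral>x. f x \<partial>P')"
      using intf intg gf sp by (intro integral_mono) auto
    have "(\<integral>x. g x \<partial>P) - (\<integral>x. g x \<partial>P') = (1 / real n) * (\<Sum>j=1..n. measure P (A j) - measure P' (A j))"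
      unfolding g_def using int_ind by (simp add: sum_subtractf right_diff_distrib)
    also have "\<dots> \<le> (1 / real n) * (\<Sum>j=1..n. tv_dist P P')"
      by (intro mult_left_mono sum_mono abs_le_D1[OF tv_dist_upper[OF P P']]) auto
    also have "\<dots> = tv_dist P P'" using n by simp
    finally show ?thesis using 1 2 by linarith
  qed
  show ?thesis
  proof (rule field_le_epsilon)
    fix e :: real assume "e > 0"
    then obtain n where "1 / real (Suc n) < e" using nat_approx_posE by blast
    then show "(\<integral>x. f x \<partial>P) - (\<integral>x. f x \<partial>P') \<le> tv_dist P P' + e" using le[of "Suc n"] by force
  qed
qed

text \<open>Both (f - l)/c and its reflection (l + c - f)/c take values in the unit interval, which
  gives the two signs. The factor is the oscillation c and not 2 sup |f|; with total variation 1/4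
  this yields the factor 1/2 at the mixing time.\<close>

lemma integral_diff_le_tv_dist:
  fixes f :: "'a \<Rightarrow> real"
  assumes P: "prob_space P" and P': "prob_space P'" and sets: "sets P' = sets P"
    and f[measurable]: "f \<in> borel_measurable P" and lu: "f \<in> space P \<rightarrow> {l..l+c}"
  shows "\<bar>(\<integral>x. f x \<partial>P) - (\<integral>x. f x \<partial>P')\<bar> \<le> c * tv_dist P P'"
proof -
  interpret P: prob_space P by fact
  interpret P': prob_space P' by fact
  have sp: "space P' = space P" using sets by (rule sets_eq_imp_space_eq)
  have f'[measurable]: "f \<in> borel_measurable P'" using f sets by (simp cong: measurable_cong_sets)
  have b: "f x \<le> l + c" "l \<le> f x" if "x \<in> space P" for x using lu that by auto
  have intf: "integrable P f" "integrable P' f"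
    using b unfolding sp[symmetric]
    by (intro P.integrable_const_bound[of _ "max \<bar>l\<bar> \<bar>l+c\<bar>"]
        P'.integrable_const_bound[of _ "max \<bar>l\<bar> \<bar>l+c\<bar>"] AE_I2; simp add: abs_le_max_abs sp)+
  have c: "0 \<le> c"
  proof -
    obtain x where "x \<in> space P" using P.not_empty by blast
    then show ?thesis using b[of x] by linarith
  qed
  show ?thesis
  \<comment> \<open>The rescaling divides by c; for c = 0 the function is constant and both means
    agree.\<close>
  proof (cases "c = 0")
    case True
    then have "f x = l" if "x \<in> space P" for x using b that by force
    then have "(\<integral>x. f x \<partial>P) = (\<integral>x. l \<partial>P)" "(\<integral>x. f x \<partial>P') = (\<integral>x. l \<partial>P')"
      by (intro Bochner_Integration.integral_cong refl; simp add: sp)+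
    then show ?thesis using True by (simp add: P.prob_space P'.prob_space)
  next
    case False
    with c have c: "c > 0" by simp
    have 1: "(\<integral>x. (f x - l) / c \<partial>P) - (\<integral>x. (f x - l) / c \<partial>P') \<le> tv_dist P P'"
      by (rule integral_diff_le_tv_dist_unit[OF P P' sets])
         (use b c in \<open>auto simp: field_simps\<close>)
    have 2: "(\<integral>x. (l + c - f x) / c \<partial>P) - (\<integral>x. (l + c - f x) / c \<partial>P') \<le> tv_dist P P'"
      by (rule integral_diff_le_tv_dist_unit[OF P P' sets])
         (use b c in \<open>auto simp: field_simps\<close>)
    have e: "(\<integral>x. (f x - l) / c \<partial>P) = ((\<integral>x. f x \<partial>P) - l) / c"
      "(\<integral>x. (f x - l) / c \<partial>P') = ((\<integral>x. f x \<partial>P') - l) / c"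
      "(\<integral>x. (l + c - f x) / c \<partial>P) = (l + c - (\<integral>x. f x \<partial>P)) / c"
      "(\<integral>x. (l + c - f x) / c \<partial>P') = (l + c - (\<integral>x. f x \<partial>P')) / c"
      using intf by (simp_all add: P.prob_space P'.prob_space)
    have "(\<integral>x. f x \<partial>P) - (\<integral>x. f x \<partial>P') \<le> c * tv_dist P P'"
      using 1 c unfolding e diff_divide_distrib[symmetric] by (simp add: field_simps)
    moreover have "(\<integral>x. f x \<partial>P') - (\<integral>x. f x \<partial>P) \<le> c * tv_dist P P'"
      using 2 c unfolding e diff_divide_distrib[symmetric] by (simp add: pos_divide_le_eq mult.commute)
    ultimately show ?thesis by (simp add: abs_le_iff)
  qed
qed

text \<open>On each block of t consecutive indices the summand is constant, so the sum is at most t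
  (1 + 1/2 + 1/4 + ...). This is the origin of the constant H = 2 t_mix.\<close>

lemma sum_half_power_div_le:
  assumes "t > 0"
  shows "(\<Sum>i<n. (1/2::real) ^ (i div t)) \<le> 2 * real t"
proof -
  \<comment> \<open>Passing to n t nonnegative terms makes the range a union of n full
    blocks.\<close>
  have "(\<Sum>i<n. (1/2::real) ^ (i div t)) \<le> (\<Sum>i<n * t. (1/2) ^ (i div t))"
    using assms by (intro sum_mono2) auto
  also have "\<dots> = (\<Sum>q<n. \<Sum>i=q*t..<q*t+t. (1/2) ^ (i div t))"
    by (rule sum.nat_group[symmetric])
  also have "\<dots> = (\<Sum>q<n. real t * (1/2) ^ q)"
  proof (rule sum.cong)
    fix q assume "q \<in> {..<n}"
    have "(\<Sum>i=q*t..<q*t+t. (1/2::real) ^ (i div t)) = (\<Sum>i=q*t..<q*t+t. (1/2) ^ q)"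
    proof (rule sum.cong)
      fix i assume "i \<in> {q * t..<q * t + t}"
      then have "i div t = q" by (intro div_nat_eqI) (auto simp: algebra_simps)
      then show "(1/2::real) ^ (i div t) = (1/2) ^ q" by simp
    qed simp
    then show "(\<Sum>i=q*t..<q*t+t. (1/2::real) ^ (i div t)) = real t * (1/2) ^ q" by simp
  qed simp
  also have "\<dots> = real t * (2 * (1 - (1/2) ^ n))"
    unfolding sum_distrib_left[symmetric] by (subst sum_gp_strict) simp
  also have "\<dots> \<le> real t * 2" by (intro mult_left_mono) auto
  finally show ?thesis by simp
qed

section \<open>The Poisson equation of a uniformly ergodic kernel\<close>

text \<open>The operator f -> K f on real functions, kept apart from \<open>kernel_op\<close>: it is
  studied at every state, whereas \<open>kernel_op\<close> acts on complex L^2 representatives,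
  where only almost everywhere values count.\<close>

definition kernel_mean :: "('a \<Rightarrow> 'a measure) \<Rightarrow> ('a \<Rightarrow> real) \<Rightarrow> 'a \<Rightarrow> real" where
  "kernel_mean K f x = (\<integral>y. f y \<partial>K x)"

section \<open>Kernels acting on bounded functions\<close>

locale markov_kernel =
  fixes S :: "'a measure" and K :: "'a \<Rightarrow> 'a measure"
  assumes kernel[measurable]: "K \<in> S \<rightarrow>\<^sub>M prob_algebra S"
begin

lemma kernel_subprob[measurable]: "K \<in> S \<rightarrow>\<^sub>M subprob_algebra S"
  by (rule measurable_prob_algebraD[OF kernel])

lemma kernel_at:
  assumes "x \<in> space S"
  shows "prob_space (K x)" "sets (K x) = sets S" "space (K x) = space S"
proof -
  have "K x \<in> space (prob_algebra S)" by (rule measurable_space[OF kernel assms])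
  then show "prob_space (K x)" "sets (K x) = sets S" by (auto simp: space_prob_algebra)
  then show "space (K x) = space S" by (intro sets_eq_imp_space_eq)
qed

lemma kernel_pow_measurable: "kernel_pow S K n \<in> S \<rightarrow>\<^sub>M prob_algebra S"
proof (induction n)
  case 0
  have "kernel_pow S K 0 = return S" by (rule ext) simp
  then show ?case by simp
next
  case (Suc n)
  have "kernel_pow S K (Suc n) = (\<lambda>x. kernel_pow S K n x \<bind> K)" by (rule ext) simp
  then show ?case using measurable_bind_prob_space[OF Suc kernel] by simp
qed

lemma kernel_pow_at:
  assumes "x \<in> space S"
  shows "prob_space (kernel_pow S K n x)" "sets (kernel_pow S K n x) = sets S"
    "space (kernel_pow S K n x) = space S"
proof -
  interpret Kn: markov_kernel S "kernel_pow S K n" by standard (rule kernel_pow_measurable)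
  show "prob_space (kernel_pow S K n x)" "sets (kernel_pow S K n x) = sets S"
    "space (kernel_pow S K n x) = space S"
    using Kn.kernel_at assms by auto
qed

lemma kernel_mean_measurable[measurable]:
  assumes [measurable]: "f \<in> borel_measurable S"
  shows "kernel_mean K f \<in> borel_measurable S"
  unfolding kernel_mean_def[abs_def]
  by (rule measurable_compose[OF kernel_subprob integral_measurable_subprob_algebra]) simp

lemma integrable_kernel:
  assumes [measurable]: "f \<in> borel_measurable S" and f: "f \<in> space S \<rightarrow> {l..u::real}" and x: "x \<in> space S"
  shows "integrable (K x) f"
proof -
  interpret prob_space "K x" by (rule kernel_at[OF x])
  show ?thesis
  proof (rule integrable_const_bound[of _ "max \<bar>l\<bar> \<bar>u\<bar>"])
    show "AE x in K x. norm (f x) \<le> max \<bar>l\<bar> \<bar>u\<bar>"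
      using f unfolding real_norm_def
      by (intro AE_I2 abs_le_max_abs) (auto simp: kernel_at[OF x])
    show "f \<in> borel_measurable (K x)"
      using assms(1) measurable_cong_sets[OF kernel_at(2)[OF x] refl] by blast
  qed
qed

lemma kernel_mean_bounds:
  assumes [measurable]: "f \<in> borel_measurable S" and f: "f \<in> space S \<rightarrow> {l..u::real}"
  shows "kernel_mean K f \<in> space S \<rightarrow> {l..u}"
proof
  fix x assume x: "x \<in> space S"
  interpret prob_space "K x" by (rule kernel_at[OF x])
  have i: "integrable (K x) f" by (rule integrable_kernel[OF _ f x]) simp
  show "kernel_mean K f x \<in> {l..u}"
    unfolding kernel_mean_def using f
    by (auto intro!: integral_ge_const integral_le_const i AE_I2 simp: kernel_at[OF x])
qed

lemma kernel_mean_funpow: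
  assumes "f \<in> borel_measurable S" "f \<in> space S \<rightarrow> {l..u::real}"
  shows "(kernel_mean K ^^ n) f \<in> borel_measurable S" "(kernel_mean K ^^ n) f \<in> space S \<rightarrow> {l..u}"
proof -
  have "(kernel_mean K ^^ n) f \<in> borel_measurable S \<and> (kernel_mean K ^^ n) f \<in> space S \<rightarrow> {l..u}"
  proof (induction n)
    case (Suc n)
    then show ?case
      using kernel_mean_bounds[of "(kernel_mean K ^^ n) f"] kernel_mean_measurable[of "(kernel_mean K ^^ n) f"]
      by simp
  qed (use assms in auto)
  then show "(kernel_mean K ^^ n) f \<in> borel_measurable S" "(kernel_mean K ^^ n) f \<in> space S \<rightarrow> {l..u}"
    by auto
qed

text \<open>\<open>kernel_pow\<close> adds the new transition at the end, so integrating it out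
  replaces f by K f under the n-step law. The induction therefore generalises over f, and
  \<open>funpow_swap1\<close> moves the extra K to the front.\<close>

lemma integral_kernel_pow:
  assumes "f \<in> borel_measurable S" "f \<in> space S \<rightarrow> {l..u::real}" and x: "x \<in> space S"
  shows "(\<integral>y. f y \<partial>kernel_pow S K n x) = (kernel_mean K ^^ n) f x"
  using assms(1,2)
proof (induction n arbitrary: f)
  case 0
  then show ?case using x by (simp add: integral_return)
next
  case (Suc n)
  note [measurable] = Suc.prems(1)
  interpret prob_space "kernel_pow S K n x" by (rule kernel_pow_at[OF x])
  have [measurable_cong]: "sets (kernel_pow S K n x) = sets S" by (rule kernel_pow_at[OF x])
  have "(\<integral>y. f y \<partial>kernel_pow S K (Suc n) x) = (\<integral>y. f y \<partial>(kernel_pow S K n x \<bind> K))" by simp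
  also have "\<dots> = (\<integral>z. (\<integral>y. f y \<partial>K z) \<partial>kernel_pow S K n x)"
  proof (rule integral_bind[where K = S and B' = 1 and B = "max \<bar>l\<bar> \<bar>u\<bar>"])
    show "\<bar>f y\<bar> \<le> max \<bar>l\<bar> \<bar>u\<bar>" if "y \<in> space S" for y
      using Suc.prems(2) that by (intro abs_le_max_abs) auto
    show "AE z in kernel_pow S K n x. emeasure (K z) (space (K z)) \<le> ennreal 1"
      by (intro AE_I2) (simp add: kernel_pow_at[OF x] prob_space.emeasure_space_1[OF kernel_at(1)])
    show "finite_measure (kernel_pow S K n x)" by unfold_locales
  qed measurable
  also have "\<dots> = (\<integral>z. kernel_mean K f z \<partial>kernel_pow S K n x)" by (simp add: kernel_mean_def)
  also have "\<dots> = (kernel_mean K ^^ n) (kernel_mean K f) x"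
    by (rule Suc.IH[OF kernel_mean_measurable kernel_mean_bounds]) (use Suc.prems in simp_all)
  finally show ?case by (simp add: funpow_swap1)
qed

end


section \<open>Halving of oscillations at the mixing time\<close>

locale ergodic_kernel = markov_kernel S K for S :: "'a measure" and K +
  fixes Q :: "'a measure"
  assumes prob_Q: "prob_space Q" and sets_Q: "sets Q = sets S"
    and ergodic: "uniformly_ergodic S K Q"
begin

lemma space_Q: "space Q = space S"
  using sets_Q by (rule sets_eq_imp_space_eq)

lemma tv_dist_kernel_pow_le_SUP:
  assumes x: "x \<in> space S"
  shows "tv_dist (kernel_pow S K n x) Q \<le> (SUP x\<in>space S. tv_dist (kernel_pow S K n x) Q)"
  by (rule cSUP_upper[OF x bdd_aboveI[of _ 1]]) (auto intro!: tv_dist_le_1 kernel_pow_at prob_Q)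

lemma ergodic_rate:
  obtains C \<rho> where "C > 0" "0 < \<rho>" "\<rho> < 1"
    "\<And>n x. x \<in> space S \<Longrightarrow> tv_dist (kernel_pow S K n x) Q \<le> C * \<rho> ^ n"
    "\<And>n. (SUP x\<in>space S. tv_dist (kernel_pow S K n x) Q) \<le> C * \<rho> ^ n"
proof -
  obtain C \<rho> where *: "C > 0" "0 < \<rho>" "\<rho> < 1"
    "\<And>n. (SUP x\<in>space S. tv_dist (kernel_pow S K n x) Q) \<le> C * \<rho> ^ n"
    using ergodic unfolding uniformly_ergodic_def by blast
  then show ?thesis using order_trans[OF tv_dist_kernel_pow_le_SUP *(4)] that by blast
qed

text \<open>\<open>LEAST\<close> carries information only if some time qualifies. Since C \<rho>^n
  tends to 0 there is one, and taking a successor makes it at least 1.\<close>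

lemma mixing_time_pos: "1 \<le> mixing_time S K Q"
  and tv_dist_mixing_time: "x \<in> space S \<Longrightarrow> tv_dist (kernel_pow S K (mixing_time S K Q) x) Q \<le> 1 / 4"
proof -
  let ?P = "\<lambda>t::nat. 1 \<le> t \<and> (SUP x\<in>space S. tv_dist (kernel_pow S K t x) Q) \<le> 1 / 4"
  obtain C \<rho> where *: "C > 0" "0 < \<rho>" "\<rho> < 1"
    "\<And>n. (SUP x\<in>space S. tv_dist (kernel_pow S K n x) Q) \<le> C * \<rho> ^ n"
    using ergodic_rate by metis
  have "(\<lambda>n. C * \<rho> ^ n) \<longlonglongrightarrow> C * 0"
    using *(2,3) by (intro tendsto_intros LIMSEQ_realpow_zero) auto
  then have "\<forall>\<^sub>F n in sequentially. C * \<rho> ^ n < 1 / 4" by (rule order_tendstoD) simp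
  then obtain n where n: "\<And>k. k \<ge> n \<Longrightarrow> C * \<rho> ^ k < 1 / 4" unfolding eventually_sequentially by blast
  have "?P (Suc n)" using *(4)[of "Suc n"] n[of "Suc n"] by simp
  then have P: "?P (mixing_time S K Q)" unfolding mixing_time_def by (rule LeastI)
  show "1 \<le> mixing_time S K Q" using P by blast
  show "tv_dist (kernel_pow S K (mixing_time S K Q) x) Q \<le> 1 / 4" if "x \<in> space S"
    using tv_dist_kernel_pow_le_SUP[OF that] P order_trans by blast
qed

text \<open>Oscillation bounds propagate as bounds on differences, while the comparison with Q needs
  values in an interval [l, l + c]. The infimum of g serves as l.\<close>

lemma bounded_oscillation_range:
  fixes g :: "'a \<Rightarrow> real"
  assumes "\<And>x y. x \<in> space S \<Longrightarrow> y \<in> space S \<Longrightarrow> g x - g y \<le> c"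
  obtains l where "g \<in> space S \<rightarrow> {l..l+c}"
proof -
  obtain x0 where x0: "x0 \<in> space S" using prob_space.not_empty[OF prob_Q] space_Q by auto
  have bdd: "bdd_below (g ` space S)"
    using assms[OF x0] by (intro bdd_belowI[of _ "g x0 - c"]) force
  have "g \<in> space S \<rightarrow> {Inf (g ` space S)..Inf (g ` space S) + c}"
  proof
    fix x assume x: "x \<in> space S"
    have "g x - c \<le> Inf (g ` space S)"
      using assms[OF x] x0 by (intro cINF_greatest) (auto simp: algebra_simps)
    then show "g x \<in> {Inf (g ` space S)..Inf (g ` space S) + c}"
      using cINF_lower[OF bdd x] by simp
  qed
  then show ?thesis using that by blast
qed

text \<open>An average of values in an interval stays in it. After t_mix steps each value is within
  c/4 of the mean under Q, because the total variation distance is at most 1/4, so two values differ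
  by at most c/2.\<close>

lemma kernel_mean_oscillation:
  assumes g: "g \<in> borel_measurable S"
    and c: "\<And>x y. x \<in> space S \<Longrightarrow> y \<in> space S \<Longrightarrow> g x - g y \<le> c"
    and x: "x \<in> space S" and y: "y \<in> space S"
  shows "kernel_mean K g x - kernel_mean K g y \<le> c"
    and "(kernel_mean K ^^ mixing_time S K Q) g x - (kernel_mean K ^^ mixing_time S K Q) g y \<le> c / 2"
proof -
  obtain l where l: "g \<in> space S \<rightarrow> {l..l+c}" by (rule bounded_oscillation_range[OF c])
  have "kernel_mean K g \<in> space S \<rightarrow> {l..l+c}" by (rule kernel_mean_bounds[OF g l])
  then have "kernel_mean K g x \<in> {l..l+c}" "kernel_mean K g y \<in> {l..l+c}" using x y by auto
  then show "kernel_mean K g x - kernel_mean K g y \<le> c" by auto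
  let ?t = "mixing_time S K Q"
  have 0: "0 \<le> c" using c[OF x x] by simp
  have *: "\<bar>(kernel_mean K ^^ ?t) g z - (\<integral>x. g x \<partial>Q)\<bar> \<le> c / 4" if z: "z \<in> space S" for z
  proof -
    have "\<bar>(kernel_mean K ^^ ?t) g z - (\<integral>x. g x \<partial>Q)\<bar> \<le> c * tv_dist (kernel_pow S K ?t z) Q"
      unfolding integral_kernel_pow[OF g l z, symmetric]
    proof (rule integral_diff_le_tv_dist)
      show "g \<in> borel_measurable (kernel_pow S K ?t z)"
        using g measurable_cong_sets[OF kernel_pow_at(2)[OF z] refl] by blast
    qed (use kernel_pow_at[OF z] prob_Q sets_Q l in auto)
    also have "\<dots> \<le> c * (1 / 4)" using tv_dist_mixing_time[OF z] 0 by (rule mult_left_mono)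
    finally show ?thesis by simp
  qed
  show "(kernel_mean K ^^ ?t) g x - (kernel_mean K ^^ ?t) g y \<le> c / 2"
    using abs_le_D1[OF *[OF x]] abs_le_D2[OF *[OF y]] by linarith
qed

text \<open>Write i = r + q t with t = t_mix: each of the q blocks halves the oscillation, and the r
  remaining steps do not increase it.\<close>

lemma kernel_mean_funpow_oscillation:
  assumes g: "g \<in> borel_measurable S" and b: "g \<in> space S \<rightarrow> {0..1}"
    and x: "x \<in> space S" and y: "y \<in> space S"
  shows "(kernel_mean K ^^ i) g x - (kernel_mean K ^^ i) g y \<le> (1/2) ^ (i div mixing_time S K Q)"
proof -
  let ?t = "mixing_time S K Q"
  have t: "?t > 0" using mixing_time_pos by simp
  have meas: "(kernel_mean K ^^ i) g \<in> borel_measurable S" for i by (rule kernel_mean_funpow[OF g b])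
  have block: "(kernel_mean K ^^ (q * ?t)) g x - (kernel_mean K ^^ (q * ?t)) g y \<le> (1/2) ^ q"
    if "x \<in> space S" "y \<in> space S" for q x y
    using that
  proof (induction q arbitrary: x y)
    case 0
    then have "g x \<in> {0..1}" "g y \<in> {0..1}" using b by auto
    then show ?case by auto
  next
    case (Suc q)
    show ?case
      using kernel_mean_oscillation(2)[OF meas Suc.IH Suc.prems] by (simp add: funpow_add)
  qed
  have inner: "(kernel_mean K ^^ (r + q * ?t)) g x - (kernel_mean K ^^ (r + q * ?t)) g y \<le> (1/2) ^ q"
    if "x \<in> space S" "y \<in> space S" for q r x y
    using that
  proof (induction r arbitrary: x y)
    case 0
    then show ?case using block by simp
  next
    case (Suc r)
    show ?case
      using kernel_mean_oscillation(1)[OF meas Suc.IH Suc.prems] by simp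
  qed
  have "i = i mod ?t + (i div ?t) * ?t" by simp
  then show ?thesis using inner[OF x y, of "i mod ?t" "i div ?t"] by metis
qed

text \<open>The solution is \<open>h = \<Sum>i. K\<^sup>i f - Q f\<close>, shifted to be nonnegative.\<close>

lemma poisson_equation:
  assumes f: "f \<in> borel_measurable S" and b: "f \<in> space S \<rightarrow> {0..1}"
  obtains h where "h \<in> borel_measurable S" "h \<in> space S \<rightarrow> {0..2 * real (mixing_time S K Q)}"
    "\<And>x. x \<in> space S \<Longrightarrow> kernel_mean K h x = h x - (f x - (\<integral>x. f x \<partial>Q))"
proof -
  let ?t = "mixing_time S K Q"
  let ?A = "\<lambda>i. (kernel_mean K ^^ i) f"
  define \<mu> where "\<mu> = (\<integral>x. f x \<partial>Q)"
  obtain C \<rho> where C: "C > 0" "0 < \<rho>" "\<rho> < 1"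
    "\<And>n x. x \<in> space S \<Longrightarrow> tv_dist (kernel_pow S K n x) Q \<le> C * \<rho> ^ n"
    using ergodic_rate by metis
  have meas[measurable]: "?A i \<in> borel_measurable S" for i by (rule kernel_mean_funpow[OF f b])
  have bnd: "?A i \<in> space S \<rightarrow> {0..1}" for i by (rule kernel_mean_funpow[OF f b])
  have rate: "\<bar>?A i x - \<mu>\<bar> \<le> C * \<rho> ^ i" if x: "x \<in> space S" for i x
  proof -
    have "\<bar>?A i x - \<mu>\<bar> \<le> 1 * tv_dist (kernel_pow S K i x) Q"
      unfolding integral_kernel_pow[OF f b x, symmetric] \<mu>_def
    proof (rule integral_diff_le_tv_dist)
      show "f \<in> borel_measurable (kernel_pow S K i x)"
        using f measurable_cong_sets[OF kernel_pow_at(2)[OF x] refl] by blast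
      show "f \<in> space (kernel_pow S K i x) \<rightarrow> {0..0 + 1}" using b kernel_pow_at[OF x] by auto
    qed (use kernel_pow_at[OF x] prob_Q sets_Q in auto)
    then show ?thesis using C(4)[OF x, of i] by linarith
  qed
  have sgeo: "summable (\<lambda>i. C * \<rho> ^ i)" using C by (intro summable_mult summable_geometric) auto
  have summ: "summable (\<lambda>i. ?A i x - \<mu>)" "summable (\<lambda>i. norm (?A i x - \<mu>))" if x: "x \<in> space S" for x
    using summable_comparison_test'[OF sgeo, of 0 "\<lambda>i. ?A i x - \<mu>"]
      summable_comparison_test'[OF sgeo, of 0 "\<lambda>i. norm (?A i x - \<mu>)"] rate[OF x] by auto
  define h0 where "h0 x = (\<Sum>i. ?A i x - \<mu>)" for x
  have h0_meas[measurable]: "h0 \<in> borel_measurable S" unfolding h0_def by measurable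
  \<comment> \<open>The rate C \<rho>^i gives convergence, but a bound derived from it would contain
    C and \<rho>. The size of \<open>h0\<close> is estimated through oscillations instead, which
    bring in only the mixing time.\<close>
  have osc: "h0 x - h0 y \<le> 2 * real ?t" if x: "x \<in> space S" and y: "y \<in> space S" for x y
  proof -
    have s: "summable (\<lambda>i. ?A i x - ?A i y)"
      using summable_diff[OF summ(1)[OF x] summ(1)[OF y]] by simp
    have "h0 x - h0 y = (\<Sum>i. ?A i x - ?A i y)"
      unfolding h0_def using suminf_diff[OF summ(1)[OF x] summ(1)[OF y]] by simp
    also have "\<dots> \<le> 2 * real ?t"
    proof (rule suminf_le_const[OF s])
      fix n
      have "(\<Sum>i<n. ?A i x - ?A i y) \<le> (\<Sum>i<n. (1/2) ^ (i div ?t))"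
        by (intro sum_mono kernel_mean_funpow_oscillation[OF f b x y])
      also have "\<dots> \<le> 2 * real ?t" using mixing_time_pos by (intro sum_half_power_div_le) simp
      finally show "(\<Sum>i<n. ?A i x - ?A i y) \<le> 2 * real ?t" .
    qed
    finally show ?thesis .
  qed
  obtain l where l: "h0 \<in> space S \<rightarrow> {l..l + 2 * real ?t}" by (rule bounded_oscillation_range[OF osc])
  \<comment> \<open>K maps each iterate of f to the next one, so integrating the series termwise
    loses exactly its first term f - \<mu>.\<close>
  have K_h0: "kernel_mean K h0 x = h0 x - (f x - \<mu>)" if x: "x \<in> space S" for x
  proof -
    interpret Kx: prob_space "K x" by (rule kernel_at[OF x])
    have int: "integrable (K x) (\<lambda>y. ?A i y - \<mu>)" for i
      using integrable_kernel[OF meas bnd x, of i] by simp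
    have le: "(\<integral>y. norm (?A i y - \<mu>) \<partial>K x) \<le> C * \<rho> ^ i" for i
      using int rate by (intro Kx.integral_le_const AE_I2) (auto simp: kernel_at[OF x])
    have s: "summable (\<lambda>i. \<integral>y. norm (?A i y - \<mu>) \<partial>K x)"
      by (rule summable_comparison_test'[OF sgeo, of 0]) (use le in auto)
    have "kernel_mean K h0 x = (\<Sum>i. \<integral>y. ?A i y - \<mu> \<partial>K x)"
      unfolding kernel_mean_def[of K h0] unfolding h0_def using int s summ(2)
      by (intro integral_suminf AE_I2) (auto simp: kernel_at[OF x])
    also have "\<dots> = (\<Sum>i. ?A (Suc i) x - \<mu>)"
      using integrable_kernel[OF meas bnd x]
      by (intro suminf_cong) (simp add: kernel_mean_def Kx.prob_space)
    also have "\<dots> = h0 x - (f x - \<mu>)"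
      unfolding h0_def using suminf_split_head[OF summ(1)[OF x]] by simp
    finally show ?thesis .
  qed
  show ?thesis
  \<comment> \<open>Constants are fixed by K, so subtracting l preserves the equation and moves the
    range to [0, 2 t_mix].\<close>
  proof (rule that[of "\<lambda>x. h0 x - l"])
    fix x assume x: "x \<in> space S"
    interpret Kx: prob_space "K x" by (rule kernel_at[OF x])
    have "kernel_mean K (\<lambda>x. h0 x - l) x = kernel_mean K h0 x - l"
      unfolding kernel_mean_def using integrable_kernel[OF h0_meas l x] by (simp add: Kx.prob_space)
    then show "kernel_mean K (\<lambda>x. h0 x - l) x = h0 x - l - (f x - (\<integral>x. f x \<partial>Q))"
      using K_h0[OF x] by (simp add: \<mu>_def)
  qed (use l in \<open>force simp: Pi_iff algebra_simps\<close>)+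
qed

end

section \<open>Exponential moments along a path\<close>

context markov_kernel
begin

lemma path_step_measurable:
  "(\<lambda>w. distr (K (w (n + m))) (PiM {n..n + Suc m} (\<lambda>_. S)) (\<lambda>z. w(n + Suc m := z)))
     \<in> PiM {n..n + m} (\<lambda>_. S) \<rightarrow>\<^sub>M prob_algebra (PiM {n..n + Suc m} (\<lambda>_. S))"
proof (rule measurable_distr_prob_space2[where M = S])
  show "(\<lambda>w. K (w (n + m))) \<in> PiM {n..n + m} (\<lambda>_. S) \<rightarrow>\<^sub>M prob_algebra S" by measurable
  have "insert (n + Suc m) {n..n + m} = {n..n + Suc m}" by auto
  then show "(\<lambda>(w, z). w(n + Suc m := z)) \<in> PiM {n..n + m} (\<lambda>_. S) \<Otimes>\<^sub>M S \<rightarrow>\<^sub>M PiM {n..n + Suc m} (\<lambda>_. S)"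
    using measurable_add_dim[of "n + Suc m" "{n..n + m}" "\<lambda>_. S"] by simp
qed

lemma path_law_in_prob_algebra:
  assumes x: "x \<in> space S"
  shows "path_law S K n x m \<in> space (prob_algebra (PiM {n..n + m} (\<lambda>_. S)))"
proof (induction m)
  case 0
  have "(\<lambda>i\<in>{n..n}. x) \<in> space (PiM {n..n} (\<lambda>_. S))" using x by (auto simp: space_PiM)
  then show ?case by (auto simp: space_prob_algebra intro!: prob_space_return)
next
  case (Suc m)
  then have s: "sets (path_law S K n x m) = sets (PiM {n..n + m} (\<lambda>_. S))" "prob_space (path_law S K n x m)"
    by (auto simp: space_prob_algebra)
  note k = path_step_measurable[of n m]
  show ?case
    unfolding path_law.simps space_prob_algebra
  proof (safe)
    show "prob_space (path_law S K n x m \<bind> (\<lambda>w. distr (K (w (n + m))) (PiM {n..n + Suc m} (\<lambda>_. S)) (\<lambda>z. w(n + Suc m := z))))"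
      using prob_space_bind'[OF Suc k] .
  qed (use sets_bind'[OF Suc k] in auto)
qed

lemma prob_space_path_law: "x \<in> space S \<Longrightarrow> prob_space (path_law S K n x m)"
  and sets_path_law: "x \<in> space S \<Longrightarrow> sets (path_law S K n x m) = sets (PiM {n..n + m} (\<lambda>_. S))"
  using path_law_in_prob_algebra by (auto simp: space_prob_algebra)

text \<open>This is the Markov property at time n + m: the last transition is integrated out given
  the path so far.\<close>

lemma nn_integral_path_law_Suc:
  assumes x: "x \<in> space S" and g[measurable]: "g \<in> borel_measurable (PiM {n..n + Suc m} (\<lambda>_. S))"
  shows "(\<integral>\<^sup>+w. g w \<partial>path_law S K n x (Suc m)) =
    (\<integral>\<^sup>+w. (\<integral>\<^sup>+z. g (w(n + Suc m := z)) \<partial>K (w (n + m))) \<partial>path_law S K n x m)"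
proof -
  have sp: "space (path_law S K n x m) = space (PiM {n..n + m} (\<lambda>_. S))"
    using sets_path_law[OF x] by (rule sets_eq_imp_space_eq)
  have k: "(\<lambda>w. distr (K (w (n + m))) (PiM {n..n + Suc m} (\<lambda>_. S)) (\<lambda>z. w(n + Suc m := z)))
     \<in> path_law S K n x m \<rightarrow>\<^sub>M subprob_algebra (PiM {n..n + Suc m} (\<lambda>_. S))"
    using measurable_prob_algebraD[OF path_step_measurable[of n m]]
      measurable_cong_sets[OF sets_path_law[OF x] refl] by blast
  show ?thesis
    unfolding path_law.simps nn_integral_bind[OF g k]
  proof (rule nn_integral_cong)
    fix w assume "w \<in> space (path_law S K n x m)"
    then have w: "w \<in> space (PiM {n..n + m} (\<lambda>_. S))" using sp by simp
    then have wS: "w (n + m) \<in> space S" by (auto simp: space_PiM)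
    have "insert (n + Suc m) {n..n + m} = {n..n + Suc m}" by auto
    then have "(\<lambda>z. w(n + Suc m := z)) \<in> S \<rightarrow>\<^sub>M PiM {n..n + Suc m} (\<lambda>_. S)"
      using measurable_compose[OF measurable_Pair1'[OF w, of S] measurable_add_dim[of "n + Suc m" "{n..n + m}" "\<lambda>_. S"]] by simp
    then have "(\<lambda>z. w(n + Suc m := z)) \<in> K (w (n + m)) \<rightarrow>\<^sub>M PiM {n..n + Suc m} (\<lambda>_. S)"
      using measurable_cong_sets[OF kernel_at(2)[OF wS] refl] by blast
    then show "(\<integral>\<^sup>+w. g w \<partial>distr (K (w (n + m))) (PiM {n..n + Suc m} (\<lambda>_. S)) (\<lambda>z. w(n + Suc m := z)))
      = (\<integral>\<^sup>+z. g (w(n + Suc m := z)) \<partial>K (w (n + m)))"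
      by (rule nn_integral_distr) (subst measurable_distr_eq1, rule g)
  qed
qed

text \<open>Since \<open>G K u \<le> u\<close>, the expectation of \<open>G(X\<^sub>n\<^sub>+\<^sub>1) \<cdots> G(X\<^sub>n\<^sub>+\<^sub>m) K u(X\<^sub>n\<^sub>+\<^sub>m)\<close> does not
  increase with \<open>m\<close>.\<close>

lemma path_law_prod_le:
  fixes u G :: "'a \<Rightarrow> ennreal"
  assumes x: "x \<in> space S" and [measurable]: "u \<in> borel_measurable S" "G \<in> borel_measurable S"
    and u: "\<And>z. z \<in> space S \<Longrightarrow> 1 \<le> u z" "\<And>z. z \<in> space S \<Longrightarrow> u z \<le> c"
    and G: "\<And>z. z \<in> space S \<Longrightarrow> G z * (\<integral>\<^sup>+y. u y \<partial>K z) \<le> u z"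
  shows "(\<integral>\<^sup>+w. (\<Prod>j=n+1..n+m. G (w j)) \<partial>path_law S K n x m) \<le> c"
proof -
  \<comment> \<open>The product includes the current time, so the compensating factor is the mean of
    u one step ahead. Its upper bound c starts the induction, and its lower bound 1 allows dropping
    it at the end.\<close>
  define Ku where "Ku z = (\<integral>\<^sup>+y. u y \<partial>K z)" for z
  have [measurable]: "Ku \<in> borel_measurable S"
    unfolding Ku_def by (rule measurable_compose[OF kernel_subprob nn_integral_measurable_subprob_algebra]) simp
  have Ku: "1 \<le> Ku z" "Ku z \<le> c" if z: "z \<in> space S" for z
  proof -
    interpret prob_space "K z" by (rule kernel_at[OF z])
    have "(\<integral>\<^sup>+y. 1 \<partial>K z) \<le> Ku z" "Ku z \<le> (\<integral>\<^sup>+y. c \<partial>K z)"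
      unfolding Ku_def using u by (intro nn_integral_mono; simp add: kernel_at[OF z])+
    then show "1 \<le> Ku z" "Ku z \<le> c" by (simp_all add: emeasure_space_1)
  qed
  have le: "(\<integral>\<^sup>+w. (\<Prod>j=n+1..n+m. G (w j)) * Ku (w (n + m)) \<partial>path_law S K n x m) \<le> c"
  proof (induction m)
    case 0
    have "(\<lambda>i\<in>{n..n}. x) \<in> space (PiM {n..n} (\<lambda>_. S))" using x by (auto simp: space_PiM)
    then show ?case using Ku(2)[OF x] by (simp add: nn_integral_return)
  next
    case (Suc m)
    have "(\<integral>\<^sup>+w. (\<Prod>j=n+1..n+Suc m. G (w j)) * Ku (w (n + Suc m)) \<partial>path_law S K n x (Suc m))
      = (\<integral>\<^sup>+w. (\<integral>\<^sup>+z. (\<Prod>j=n+1..n+Suc m. G ((w(n + Suc m := z)) j)) * Ku ((w(n + Suc m := z)) (n + Suc m)) \<partial>K (w (n + m)))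
          \<partial>path_law S K n x m)"
      by (rule nn_integral_path_law_Suc[OF x]) measurable
    also have "\<dots> \<le> (\<integral>\<^sup>+w. (\<Prod>j=n+1..n+m. G (w j)) * Ku (w (n + m)) \<partial>path_law S K n x m)"
    proof (rule nn_integral_mono)
      fix w assume "w \<in> space (path_law S K n x m)"
      then have "w \<in> space (PiM {n..n + m} (\<lambda>_. S))" using sets_eq_imp_space_eq[OF sets_path_law[OF x]] by simp
      then have wS: "w (n + m) \<in> space S" by (auto simp: space_PiM)
      have eq: "(\<Prod>j=n+1..n+Suc m. G ((w(n + Suc m := z)) j)) = (\<Prod>j=n+1..n+m. G (w j)) * G z" for z
      proof -
        have "(\<Prod>j=n+1..n+Suc m. G ((w(n + Suc m := z)) j))
          = (\<Prod>j=n+1..n+m. G ((w(n + Suc m := z)) j)) * G ((w(n + Suc m := z)) (n + Suc m))"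
          using prod.nat_ivl_Suc'[of "n + 1" "n + m" "\<lambda>j. G ((w(n + Suc m := z)) j)"] by (simp add: mult.commute)
        also have "(\<Prod>j=n+1..n+m. G ((w(n + Suc m := z)) j)) = (\<Prod>j=n+1..n+m. G (w j))"
          by (intro prod.cong) auto
        finally show ?thesis by simp
      qed
      have "(\<integral>\<^sup>+z. (\<Prod>j=n+1..n+Suc m. G ((w(n + Suc m := z)) j)) * Ku ((w(n + Suc m := z)) (n + Suc m)) \<partial>K (w (n + m)))
        = (\<integral>\<^sup>+z. (\<Prod>j=n+1..n+m. G (w j)) * (G z * Ku z) \<partial>K (w (n + m)))"
        unfolding eq by (simp add: mult.assoc)
      also have "\<dots> \<le> (\<integral>\<^sup>+z. (\<Prod>j=n+1..n+m. G (w j)) * u z \<partial>K (w (n + m)))"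
        using G unfolding Ku_def[symmetric]
        by (intro nn_integral_mono mult_left_mono) (auto simp: kernel_at[OF wS])
      also have "\<dots> = (\<Prod>j=n+1..n+m. G (w j)) * Ku (w (n + m))"
        unfolding Ku_def
      proof (rule nn_integral_cmult)
        show "u \<in> borel_measurable (K (w (n + m)))"
          using \<open>u \<in> borel_measurable S\<close> measurable_cong_sets[OF kernel_at(2)[OF wS] refl] by blast
      qed
      finally show "(\<integral>\<^sup>+z. (\<Prod>j=n+1..n+Suc m. G ((w(n + Suc m := z)) j)) * Ku ((w(n + Suc m := z)) (n + Suc m)) \<partial>K (w (n + m)))
        \<le> (\<Prod>j=n+1..n+m. G (w j)) * Ku (w (n + m))" .
    qed
    also have "\<dots> \<le> c" by (rule Suc.IH)
    finally show ?case .
  qed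
  have "(\<integral>\<^sup>+w. (\<Prod>j=n+1..n+m. G (w j)) \<partial>path_law S K n x m)
    \<le> (\<integral>\<^sup>+w. (\<Prod>j=n+1..n+m. G (w j)) * Ku (w (n + m)) \<partial>path_law S K n x m)"
  proof (rule nn_integral_mono)
    fix w assume "w \<in> space (path_law S K n x m)"
    then have "w \<in> space (PiM {n..n + m} (\<lambda>_. S))" using sets_eq_imp_space_eq[OF sets_path_law[OF x]] by simp
    then have "w (n + m) \<in> space S" by (auto simp: space_PiM)
    from mult_left_mono[OF Ku(1)[OF this], of "\<Prod>j=n+1..n+m. G (w j)"]
    show "(\<Prod>j=n+1..n+m. G (w j)) \<le> (\<Prod>j=n+1..n+m. G (w j)) * Ku (w (n + m))" by simp
  qed
  then show ?thesis using le by (rule order_trans)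
qed

end

context ergodic_kernel
begin

text \<open>With \<open>u = 1 + \<lambda> h\<close> and \<open>K h = h - \<phi>\<close> one has
  \<open>K u = u (1 - \<lambda> \<phi> / u) \<le> u exp (- \<lambda> \<phi> / u)\<close>.\<close>

lemma path_law_exp_sum_le:
  fixes h \<phi> g :: "'a \<Rightarrow> real"
  assumes x: "x \<in> space S"
    and [measurable]: "h \<in> borel_measurable S" "g \<in> borel_measurable S"
    and h: "h \<in> space S \<rightarrow> {0..H}" and H: "H > 0" and b: "b > 0"
    and Kh: "\<And>z. z \<in> space S \<Longrightarrow> kernel_mean K h z = h z - \<phi> z"
    and g: "\<And>z. z \<in> space S \<Longrightarrow> g z \<le> (b / H) * \<phi> z / (1 + (b / H) * h z)"
  shows "(\<integral>\<^sup>+w. ennreal (exp (\<Sum>j=n+1..n+m. g (w j))) \<partial>path_law S K n x m) \<le> ennreal (1 + b)"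
proof -
  define u where "u z = 1 + (b / H) * h z" for z
  have [measurable]: "u \<in> borel_measurable S" unfolding u_def by measurable
  have u: "1 \<le> u z" "u z \<le> 1 + b" if z: "z \<in> space S" for z
  proof -
    have "0 \<le> h z" "h z \<le> H" using h z by auto
    then show "1 \<le> u z" "u z \<le> 1 + b" unfolding u_def using H b by (auto simp: field_simps)
  qed
  have Ku: "(\<integral>\<^sup>+y. ennreal (u y) \<partial>K z) = ennreal (u z - (b / H) * \<phi> z)" if z: "z \<in> space S" for z
  proof -
    interpret prob_space "K z" by (rule kernel_at[OF z])
    have ih: "integrable (K z) h" by (rule integrable_kernel[OF _ h z]) simp
    have "0 \<le> u y" if "y \<in> space (K z)" for y using u(1)[of y] that kernel_at[OF z] by auto
    then have "(\<integral>\<^sup>+y. ennreal (u y) \<partial>K z) = ennreal (\<integral>y. u y \<partial>K z)"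
      using ih by (intro nn_integral_eq_integral AE_I2) (auto simp: u_def)
    also have "(\<integral>y. u y \<partial>K z) = u z - (b / H) * \<phi> z"
      unfolding u_def using ih Kh[OF z] by (simp add: prob_space kernel_mean_def right_diff_distrib diff_divide_distrib)
    finally show ?thesis .
  qed
  have "(\<integral>\<^sup>+w. (\<Prod>j=n+1..n+m. ennreal (exp (g (w j)))) \<partial>path_law S K n x m) \<le> ennreal (1 + b)"
  proof (rule path_law_prod_le[OF x, where u = "\<lambda>z. ennreal (u z)"])
    fix z assume z: "z \<in> space S"
    show "1 \<le> ennreal (u z)" using u(1)[OF z] by simp
    show "ennreal (u z) \<le> ennreal (1 + b)" using u(2)[OF z] by (rule ennreal_leI)
    have upos: "u z > 0" using u(1)[OF z] by linarith
    have "u z - (b / H) * \<phi> z = u z * (1 + (- ((b / H) * \<phi> z / u z)))"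
      using upos by (simp add: right_diff_distrib)
    also have "\<dots> \<le> u z * exp (- ((b / H) * \<phi> z / u z))"
      using upos by (intro mult_left_mono exp_ge_add_one_self) simp
    also have "\<dots> \<le> u z * exp (- g z)"
      using upos g[OF z] unfolding u_def[symmetric] by (intro mult_left_mono) auto
    finally have "exp (g z) * (u z - (b / H) * \<phi> z) \<le> u z"
      by (simp add: exp_minus field_simps)
    then have "ennreal (exp (g z) * (u z - (b / H) * \<phi> z)) \<le> ennreal (u z)" by (rule ennreal_leI)
    then show "ennreal (exp (g z)) * (\<integral>\<^sup>+y. ennreal (u y) \<partial>K z) \<le> ennreal (u z)"
      unfolding Ku[OF z] by (simp add: ennreal_mult')
  qed measurable
  moreover have "(\<Prod>j=n+1..n+m. ennreal (exp (g (w j)))) = ennreal (exp (\<Sum>j=n+1..n+m. g (w j)))" for w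
    by (subst prod_ennreal) (auto simp: exp_sum)
  ultimately show ?thesis by simp
qed

lemma path_law_exp_upper:
  assumes x: "x \<in> space S" and f[measurable]: "f \<in> borel_measurable S" and f01: "f \<in> space S \<rightarrow> {0..1}" and b: "b > 0"
  defines "H \<equiv> 2 * real (mixing_time S K Q)" and "\<mu> \<equiv> \<integral>x. f x \<partial>Q"
  shows "(\<integral>\<^sup>+w. ennreal (exp (\<Sum>j=n+1..n+m. (b / H) * (f (w j) / (1 + b) - \<mu>))) \<partial>path_law S K n x m) \<le> ennreal (1 + b)"
proof -
  obtain h where h[measurable]: "h \<in> borel_measurable S" and hH: "h \<in> space S \<rightarrow> {0..H}"
    and Kh: "\<And>x. x \<in> space S \<Longrightarrow> kernel_mean K h x = h x - (f x - \<mu>)"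
    using poisson_equation[OF f f01] unfolding H_def \<mu>_def by metis
  have H: "H > 0" unfolding H_def using mixing_time_pos by simp
  have \<mu>: "0 \<le> \<mu>" unfolding \<mu>_def using f01 space_Q by (intro integral_nonneg_AE AE_I2) auto
  show ?thesis
  proof (rule path_law_exp_sum_le[OF x h _ hH H b Kh])
    fix z assume z: "z \<in> space S"
    define v where "v = 1 + b / H * h z"
    have hz: "0 \<le> h z" "h z \<le> H" and fz: "0 \<le> f z" using hH f01 z by auto
    have v: "1 \<le> v" "v \<le> 1 + b" unfolding v_def using hz H b by (auto simp: field_simps)
    \<comment> \<open>The exponent must not involve h. Since 1 <= v <= 1 + b and both f and \<mu>
      are nonnegative, f is divided by the largest possible v and \<mu> by the smallest.\<close>
    have "f z / (1 + b) \<le> f z / v" using v fz b by (intro divide_left_mono) auto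
    moreover have "\<mu> / v \<le> \<mu>" using v \<mu> mult_right_mono[of 1 v \<mu>] by (simp add: field_simps)
    ultimately have "f z / (1 + b) - \<mu> \<le> (f z - \<mu>) / v" by (simp add: diff_divide_distrib)
    then have "(b / H) * (f z / (1 + b) - \<mu>) \<le> (b / H) * ((f z - \<mu>) / v)"
      using b H by (intro mult_left_mono) auto
    then show "(b / H) * (f z / (1 + b) - \<mu>) \<le> (b / H) * (f z - \<mu>) / (1 + b / H * h z)"
      unfolding v_def by simp
  qed simp
qed

text \<open>K fixes constants, so H - h solves the Poisson equation for \<mu> - f and has the same
  range. The roles of f and \<mu> are exchanged, and the factor 1/(1 + b) now falls on
  \<mu>.\<close>

lemma path_law_exp_lower:
  assumes x: "x \<in> space S" and f[measurable]: "f \<in> borel_measurable S" and f01: "f \<in> space S \<rightarrow> {0..1}" and b: "b > 0"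
  defines "H \<equiv> 2 * real (mixing_time S K Q)" and "\<mu> \<equiv> \<integral>x. f x \<partial>Q"
  shows "(\<integral>\<^sup>+w. ennreal (exp (\<Sum>j=n+1..n+m. (b / H) * (\<mu> / (1 + b) - f (w j)))) \<partial>path_law S K n x m) \<le> ennreal (1 + b)"
proof -
  obtain h where h[measurable]: "h \<in> borel_measurable S" and hH: "h \<in> space S \<rightarrow> {0..H}"
    and Kh: "\<And>x. x \<in> space S \<Longrightarrow> kernel_mean K h x = h x - (f x - \<mu>)"
    using poisson_equation[OF f f01] unfolding H_def \<mu>_def by metis
  have H: "H > 0" unfolding H_def using mixing_time_pos by simp
  have \<mu>: "0 \<le> \<mu>" unfolding \<mu>_def using f01 space_Q by (intro integral_nonneg_AE AE_I2) auto
  have hH': "(\<lambda>z. H - h z) \<in> space S \<rightarrow> {0..H}" using hH by (force simp: Pi_iff)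
  have Kh': "kernel_mean K (\<lambda>z. H - h z) z = (H - h z) - (\<mu> - f z)" if z: "z \<in> space S" for z
  proof -
    interpret prob_space "K z" by (rule kernel_at[OF z])
    have "kernel_mean K (\<lambda>z. H - h z) z = H - kernel_mean K h z"
      unfolding kernel_mean_def using integrable_kernel[OF h hH z] by (simp add: prob_space)
    then show ?thesis using Kh[OF z] by simp
  qed
  show ?thesis
  proof (rule path_law_exp_sum_le[OF x _ _ hH' H b Kh'])
    fix z assume z: "z \<in> space S"
    define v where "v = 1 + b / H * (H - h z)"
    have hz: "0 \<le> h z" "h z \<le> H" and fz: "0 \<le> f z" using hH f01 z by auto
    have v: "1 \<le> v" "v \<le> 1 + b" unfolding v_def using hz H b by (auto simp: field_simps)
    have "\<mu> / (1 + b) \<le> \<mu> / v" using v \<mu> b by (intro divide_left_mono) auto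
    moreover have "f z / v \<le> f z" using v fz mult_right_mono[of 1 v "f z"] by (simp add: field_simps)
    ultimately have "\<mu> / (1 + b) - f z \<le> (\<mu> - f z) / v" by (simp add: diff_divide_distrib)
    then have "(b / H) * (\<mu> / (1 + b) - f z) \<le> (b / H) * ((\<mu> - f z) / v)"
      using b H by (intro mult_left_mono) auto
    then show "(b / H) * (\<mu> / (1 + b) - f z) \<le> (b / H) * (\<mu> - f z) / (1 + b / H * (H - h z))"
      unfolding v_def by simp
  qed simp_all
qed

end

section \<open>From exponential moments to the selected candidate\<close>

lemma (in prob_space) expectation_le_ln:
  fixes Z :: "'a \<Rightarrow> real"
  assumes Z: "integrable M Z" and le: "(\<integral>\<^sup>+x. ennreal (exp (Z x)) \<partial>M) \<le> ennreal c" and c: "c > 0"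
  shows "expectation Z \<le> ln c"
proof -
  have [measurable]: "Z \<in> borel_measurable M" using Z by simp
  have int: "integrable M (\<lambda>x. exp (Z x))"
    using le by (intro integrableI_bounded) (auto simp: le_less_trans[OF le])
  have "ennreal (expectation (\<lambda>x. exp (Z x))) \<le> ennreal c"
    using nn_integral_eq_integral[OF int] le by simp
  then have e: "expectation (\<lambda>x. exp (Z x)) \<le> c" using c by (simp add: ennreal_le_iff)
  have "expectation Z \<le> expectation (\<lambda>x. ln c - 1 + exp (Z x) / c)"
  proof (rule integral_mono[OF Z])
    fix x
    \<comment> \<open>Jensen's inequality for the logarithm through a single tangent: exp lies above
      its tangent at ln c, and after integration exp Z / c - 1 contributes at most 0.\<close>
    have "1 + (Z x - ln c) \<le> exp (Z x - ln c)" by (rule exp_ge_add_one_self)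
    then show "Z x \<le> ln c - 1 + exp (Z x) / c" using c by (simp add: exp_diff)
  qed (use int in simp)
  also have "\<dots> = ln c - 1 + expectation (\<lambda>x. exp (Z x)) / c" using int by (simp add: prob_space)
  also have "\<dots> \<le> ln c" using e c by simp
  finally show ?thesis .
qed

context ergodic_kernel
begin

text \<open>The lower tail is applied at the randomly selected index and the upper tail at the fixed
  competitor; each costs one factor 1 + b, whence the square. Only the random index pays the factor
  N inside the logarithm.\<close>

lemma selection_risk_bound:
  fixes f :: "nat \<Rightarrow> 'a \<Rightarrow> real" and n m N kt :: nat
  assumes x: "x \<in> space S"
    and f[measurable]: "\<And>k. f k \<in> borel_measurable S" and f01: "\<And>k. f k \<in> space S \<rightarrow> {0..1}"
    and m: "m > 0" and b: "b > 0"
    and kt: "kt \<in> {1..N}"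
    and khat_meas: "khat \<in> PiM {n+1..n+m} (\<lambda>_. S) \<rightarrow>\<^sub>M count_space UNIV"
    and khat: "\<And>v. v \<in> space (PiM {n+1..n+m} (\<lambda>_. S)) \<Longrightarrow> khat v \<in> {1..N}"
      "\<And>v. v \<in> space (PiM {n+1..n+m} (\<lambda>_. S)) \<Longrightarrow>
        (\<Sum>j=n+1..n+m. f (khat v) (v j)) \<le> (\<Sum>j=n+1..n+m. f kt (v j))"
  defines "H \<equiv> 2 * real (mixing_time S K Q)" and "\<mu> \<equiv> \<lambda>k. \<integral>x. f k x \<partial>Q"
  shows "(\<integral>w. \<mu> (khat (restrict w {n+1..n+m})) \<partial>path_law S K n x m)
    \<le> (1 + b)\<^sup>2 * \<mu> kt + (1 + b) * H / (b * real m) * (ln (real N * (1 + b)) + (1 + b) * ln (1 + b))"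
    and "integrable (path_law S K n x m) (\<lambda>w. \<mu> (khat (restrict w {n+1..n+m})))"
proof -
  interpret P: prob_space "path_law S K n x m" by (rule prob_space_path_law[OF x])
  interpret Q: prob_space Q by (rule prob_Q)
  note sets_P[measurable_cong] = sets_path_law[OF x, of n m]
  note space_P = sets_eq_imp_space_eq[OF sets_P]
  define J where "J = {n+1..n+m}"
  \<comment> \<open>\<open>path_law\<close> also records the state at time n; the selection sees
    only the later coordinates.\<close>
  define \<kappa> where "\<kappa> w = khat (restrict w J)" for w
  have restr: "(\<lambda>w. restrict w J) \<in> PiM {n..n+m} (\<lambda>_. S) \<rightarrow>\<^sub>M PiM J (\<lambda>_. S)"
    unfolding J_def by (rule measurable_restrict_subset) auto
  have \<kappa>_meas[measurable]: "\<kappa> \<in> PiM {n..n+m} (\<lambda>_. S) \<rightarrow>\<^sub>M count_space UNIV"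
    unfolding \<kappa>_def using measurable_compose[OF restr] khat_meas unfolding J_def by blast
  have H: "H > 0" unfolding H_def using mixing_time_pos by simp
  have \<mu>: "0 \<le> \<mu> k" "\<mu> k \<le> 1" for k
  proof -
    have b: "0 \<le> f k z" "f k z \<le> 1" if "z \<in> space Q" for z using f01[of k] that space_Q by auto
    have "f k \<in> borel_measurable Q" using f measurable_cong_sets[OF sets_Q refl] by blast
    then have "integrable Q (f k)"
      using b by (intro Q.integrable_const_bound[of _ 1] AE_I2) auto
    then show "0 \<le> \<mu> k" "\<mu> k \<le> 1"
      unfolding \<mu>_def using b by (auto intro!: integral_nonneg_AE AE_I2 Q.integral_le_const)
  qed
  define s where "s k w = (\<Sum>j\<in>J. f k (w j))" for k w
  have s_meas[measurable]: "s k \<in> borel_measurable (PiM {n..n+m} (\<lambda>_. S))" for k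
  proof -
    have "(\<lambda>w. w j) \<in> PiM {n..n+m} (\<lambda>_. S) \<rightarrow>\<^sub>M S" if "j \<in> J" for j
      using that unfolding J_def by (intro measurable_component_singleton) auto
    then show ?thesis unfolding s_def by (intro borel_measurable_sum measurable_compose[OF _ f]) auto
  qed
  have s\<kappa>_meas[measurable]: "(\<lambda>w. s (\<kappa> w) w) \<in> borel_measurable (PiM {n..n+m} (\<lambda>_. S))"
    by (rule measurable_compose_countable[where f = s]) measurable
  have \<mu>\<kappa>_meas[measurable]: "(\<lambda>w. \<mu> (\<kappa> w)) \<in> borel_measurable (PiM {n..n+m} (\<lambda>_. S))"
    by measurable
  have s_bounds: "0 \<le> s k w" "s k w \<le> real m" if w: "w \<in> space (PiM {n..n+m} (\<lambda>_. S))" for k w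
  proof -
    have wj: "0 \<le> f k (w j)" "f k (w j) \<le> 1" if "j \<in> J" for j
    proof -
      have "w j \<in> space S" using w that unfolding J_def by (auto simp: space_PiM)
      then show "0 \<le> f k (w j)" "f k (w j) \<le> 1" using f01[of k] by auto
    qed
    show "0 \<le> s k w" unfolding s_def using wj by (intro sum_nonneg) auto
    have "s k w \<le> (\<Sum>j\<in>J. 1)" unfolding s_def using wj by (intro sum_mono) auto
    then show "s k w \<le> real m" by (simp add: J_def)
  qed
  have int_\<mu>: "integrable (path_law S K n x m) (\<lambda>w. \<mu> (\<kappa> w))"
    by (rule P.integrable_const_bound[of _ 1]) (use \<mu> in auto)
  have int_s: "integrable (path_law S K n x m) (s k)" for k
    by (rule P.integrable_const_bound[of _ "real m"]) (use s_bounds space_P in \<open>auto intro!: AE_I2\<close>)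
  have int_s\<kappa>: "integrable (path_law S K n x m) (\<lambda>w. s (\<kappa> w) w)"
    by (rule P.integrable_const_bound[of _ "real m"]) (use s_bounds space_P in \<open>auto intro!: AE_I2\<close>)
  have N: "real N > 0" using kt by auto
  \<comment> \<open>Z1 is the lower tail exponent at the selected index, Z2 the upper tail exponent
    at \<open>kt\<close>. In Z1 + (1 + b) Z2 the weight 1 + b undoes the division of
    \<open>s kt w\<close>, so that the empirical losses enter only through their difference.\<close>
  define Z1 where "Z1 w = (b / H) * (real m * \<mu> (\<kappa> w) / (1 + b) - s (\<kappa> w) w)" for w
  define Z2 where "Z2 w = (b / H) * (s kt w / (1 + b) - real m * \<mu> kt)" for w
  have int_Z: "integrable (path_law S K n x m) Z1" "integrable (path_law S K n x m) Z2"
    unfolding Z1_def Z2_def using int_\<mu> int_s int_s\<kappa> by simp_all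
  have sum_eq: "(\<Sum>j=n+1..n+m. (b / H) * (\<mu> k / (1 + b) - f k (w j))) = (b / H) * (real m * \<mu> k / (1 + b) - s k w)"
    "(\<Sum>j=n+1..n+m. (b / H) * (f k (w j) / (1 + b) - \<mu> k)) = (b / H) * (s k w / (1 + b) - real m * \<mu> k)" for k w
    unfolding s_def J_def by (simp_all add: sum_distrib_left[symmetric] sum_subtractf sum_divide_distrib[symmetric])
  have low: "(\<integral>\<^sup>+w. ennreal (exp ((b / H) * (real m * \<mu> k / (1 + b) - s k w))) \<partial>path_law S K n x m) \<le> ennreal (1 + b)" for k
    using path_law_exp_lower[OF x f f01 b, of n m k] unfolding sum_eq(1)[symmetric] unfolding H_def \<mu>_def .
  have up: "(\<integral>\<^sup>+w. ennreal (exp (Z2 w)) \<partial>path_law S K n x m) \<le> ennreal (1 + b)"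
    using path_law_exp_upper[OF x f f01 b, of n m kt] unfolding Z2_def sum_eq(2)[symmetric] unfolding H_def \<mu>_def .
  have E2: "P.expectation Z2 \<le> ln (1 + b)" by (rule P.expectation_le_ln[OF int_Z(2) up]) (use b in simp)
  have \<kappa>N: "\<kappa> w \<in> {1..N}" and \<kappa>_le: "s (\<kappa> w) w \<le> s kt w" if w: "w \<in> space (path_law S K n x m)" for w
  proof -
    have "restrict w J \<in> space (PiM J (\<lambda>_. S))" using measurable_space[OF restr] w space_P by auto
    note * = khat[OF this[unfolded J_def]]
    show "\<kappa> w \<in> {1..N}" using *(1) unfolding \<kappa>_def J_def .
    show "s (\<kappa> w) w \<le> s kt w" using *(2) unfolding \<kappa>_def s_def J_def by simp
  qed
  \<comment> \<open>The union bound at the level of exponential moments: the term at the random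
    index is one of N nonnegative terms, each of expectation at most 1 + b.\<close>
  have "(\<integral>\<^sup>+w. ennreal (exp (Z1 w)) \<partial>path_law S K n x m)
    \<le> (\<integral>\<^sup>+w. (\<Sum>k=1..N. ennreal (exp ((b / H) * (real m * \<mu> k / (1 + b) - s k w)))) \<partial>path_law S K n x m)"
  proof (rule nn_integral_mono)
    fix w assume "w \<in> space (path_law S K n x m)"
    from \<kappa>N[OF this] show "ennreal (exp (Z1 w)) \<le> (\<Sum>k=1..N. ennreal (exp ((b / H) * (real m * \<mu> k / (1 + b) - s k w))))"
      unfolding Z1_def by (intro member_le_sum[where f = "\<lambda>k. ennreal (exp ((b / H) * (real m * \<mu> k / (1 + b) - s k w)))"]) auto
  qed
  also have "\<dots> = (\<Sum>k=1..N. \<integral>\<^sup>+w. ennreal (exp ((b / H) * (real m * \<mu> k / (1 + b) - s k w))) \<partial>path_law S K n x m)"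
    by (rule nn_integral_sum) measurable
  also have "\<dots> \<le> (\<Sum>k=1..N. ennreal (1 + b))" by (intro sum_mono low)
  also have "\<dots> = ennreal (real N * (1 + b))" using b by (simp add: ennreal_mult' ennreal_of_nat_eq_real_of_nat)
  finally have E1: "P.expectation Z1 \<le> ln (real N * (1 + b))"
    by (rule P.expectation_le_ln[OF int_Z(1)]) (use b N in simp)
  have "P.expectation (\<lambda>w. \<mu> (\<kappa> w)) \<le> P.expectation (\<lambda>w. (1 + b)\<^sup>2 * \<mu> kt + (1 + b) * H / (b * real m) * (Z1 w + (1 + b) * Z2 w))"
  proof (rule integral_mono[OF int_\<mu>])
    fix w assume w: "w \<in> space (path_law S K n x m)"
    have "(1 + b) * H / (b * real m) * (Z1 w + (1 + b) * Z2 w)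
      = (1 + b) / real m * ((real m * \<mu> (\<kappa> w) / (1 + b) - s (\<kappa> w) w) + (1 + b) * (s kt w / (1 + b) - real m * \<mu> kt))"
      (is "?c * _ = _ * ?E")
    proof -
      have "Z1 w + (1 + b) * Z2 w = (b / H) * ?E" unfolding Z1_def Z2_def
        by (simp only: distrib_left mult.left_commute)
      then show ?thesis using b H by simp
    qed
    \<comment> \<open>The last, empirical term is nonnegative, since the selected index does no
      worse than \<open>kt\<close> on the validation set; dropping it gives the bound.\<close>
    also have "\<dots> = \<mu> (\<kappa> w) - (1 + b)\<^sup>2 * \<mu> kt + (1 + b) / real m * (s kt w - s (\<kappa> w) w)"
    proof -
      have "c / r * ((r * p / c - q) + c * (t / c - r * e)) = p - c\<^sup>2 * e + c / r * (t - q)"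
        if "c \<noteq> 0" "r \<noteq> 0" for c r p q t e :: real
        using that by (simp add: field_simps power2_eq_square)
      then show ?thesis using b m by simp
    qed
    finally show "\<mu> (\<kappa> w) \<le> (1 + b)\<^sup>2 * \<mu> kt + (1 + b) * H / (b * real m) * (Z1 w + (1 + b) * Z2 w)"
      using \<kappa>_le[OF w] b by simp
  qed (use int_Z in simp)
  also have "\<dots> = (1 + b)\<^sup>2 * \<mu> kt + (1 + b) * H / (b * real m) * (P.expectation Z1 + (1 + b) * P.expectation Z2)"
    using int_Z by (simp add: P.prob_space)
  also have "\<dots> \<le> (1 + b)\<^sup>2 * \<mu> kt + (1 + b) * H / (b * real m) * (ln (real N * (1 + b)) + (1 + b) * ln (1 + b))"
    using E1 E2 b H by (intro add_left_mono mult_left_mono add_mono) auto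
  finally show "(\<integral>w. \<mu> (khat (restrict w {n+1..n+m})) \<partial>path_law S K n x m)
    \<le> (1 + b)\<^sup>2 * \<mu> kt + (1 + b) * H / (b * real m) * (ln (real N * (1 + b)) + (1 + b) * ln (1 + b))"
    unfolding \<kappa>_def J_def .
  show "integrable (path_law S K n x m) (\<lambda>w. \<mu> (khat (restrict w {n+1..n+m})))"
    using int_\<mu> unfolding \<kappa>_def J_def .
qed

end

section \<open>Operators on square integrable functions\<close>

lemma l2_space_measurable: "f \<in> l2_space Q \<Longrightarrow> f \<in> borel_measurable Q"
  unfolding l2_space_def by simp

lemma l2_space_integrable: "f \<in> l2_space Q \<Longrightarrow> integrable Q (\<lambda>x. (cmod (f x))\<^sup>2)"
  unfolding l2_space_def by simp

lemma l2_spaceI_nn_integral: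
  assumes "f \<in> borel_measurable Q" "(\<integral>\<^sup>+x. ennreal ((cmod (f x))\<^sup>2) \<partial>Q) < \<infinity>"
  shows "f \<in> l2_space Q"
  unfolding l2_space_def using assms by (auto intro!: integrableI_bounded)

lemma l2_norm_nonneg: "0 \<le> l2_norm Q f"
  unfolding l2_norm_def by simp

lemma l2_norm_power2: "(l2_norm Q f)\<^sup>2 = (\<integral>x. (cmod (f x))\<^sup>2 \<partial>Q)"
  unfolding l2_norm_def by simp

lemma nn_integral_l2_norm:
  assumes "f \<in> l2_space Q"
  shows "(\<integral>\<^sup>+x. ennreal ((cmod (f x))\<^sup>2) \<partial>Q) = ennreal ((l2_norm Q f)\<^sup>2)"
  unfolding l2_norm_power2 by (intro nn_integral_eq_integral l2_space_integrable assms) auto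

lemma l2_norm_leI:
  assumes "f \<in> borel_measurable Q" "(\<integral>\<^sup>+x. ennreal ((cmod (f x))\<^sup>2) \<partial>Q) \<le> ennreal (B\<^sup>2)" "0 \<le> B"
  shows "f \<in> l2_space Q" "l2_norm Q f \<le> B"
proof -
  show f: "f \<in> l2_space Q"
    by (rule l2_spaceI_nn_integral[OF assms(1)]) (use assms(2) le_less_trans in fastforce)
  have "(l2_norm Q f)\<^sup>2 \<le> B\<^sup>2"
    using assms(2) unfolding nn_integral_l2_norm[OF f] by (simp add: ennreal_le_iff)
  then show "l2_norm Q f \<le> B" using assms(3) by (rule power2_le_imp_le)
qed

lemma l2_norm_cong_AE:
  assumes "f \<in> borel_measurable Q" "g \<in> borel_measurable Q" "AE x in Q. f x = g x"
  shows "l2_norm Q f = l2_norm Q g"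
proof -
  have "(\<integral>x. (cmod (f x))\<^sup>2 \<partial>Q) = (\<integral>x. (cmod (g x))\<^sup>2 \<partial>Q)"
    using assms by (intro integral_cong_AE) auto
  then show ?thesis unfolding l2_norm_def by simp
qed

lemma l2_norm_eq_0_iff:
  assumes "f \<in> l2_space Q"
  shows "l2_norm Q f = 0 \<longleftrightarrow> (AE x in Q. f x = 0)"
proof -
  have "l2_norm Q f = 0 \<longleftrightarrow> (\<integral>x. (cmod (f x))\<^sup>2 \<partial>Q) = 0" unfolding l2_norm_def by simp
  also have "\<dots> \<longleftrightarrow> (AE x in Q. (cmod (f x))\<^sup>2 = 0)"
    by (rule integral_nonneg_eq_0_iff_AE[OF l2_space_integrable[OF assms]]) simp
  finally show ?thesis by simp
qed

lemma l2_space_mult: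
  assumes "f \<in> l2_space Q"
  shows "(\<lambda>x. c * f x) \<in> l2_space Q"
  using assms unfolding l2_space_def by (auto simp: norm_mult power_mult_distrib)

lemma l2_norm_mult: "l2_norm Q (\<lambda>x. c * f x) = cmod c * l2_norm Q f"
  unfolding l2_norm_def by (simp add: norm_mult power_mult_distrib real_sqrt_mult)

lemma l2_integrable_mult:
  assumes f: "f \<in> l2_space Q" and g: "g \<in> l2_space Q"
  shows "integrable Q (\<lambda>x. cmod (f x) * cmod (g x))"
proof (rule Bochner_Integration.integrable_bound)
  show "integrable Q (\<lambda>x. (cmod (f x))\<^sup>2 + (cmod (g x))\<^sup>2)"
    by (intro Bochner_Integration.integrable_add l2_space_integrable f g)
  have "a * b \<le> a\<^sup>2 + b\<^sup>2" if "0 \<le> a" "0 \<le> b" for a b :: real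
    using sum_squares_bound[of a b] mult_nonneg_nonneg[OF that] by simp
  then show "AE x in Q. norm (cmod (f x) * cmod (g x)) \<le> norm ((cmod (f x))\<^sup>2 + (cmod (g x))\<^sup>2)"
    by (intro AE_I2) (simp add: abs_mult)
qed (use l2_space_measurable[OF f] l2_space_measurable[OF g] in measurable)

lemma l2_space_add:
  assumes f: "f \<in> l2_space Q" and g: "g \<in> l2_space Q"
  shows "(\<lambda>x. f x + g x) \<in> l2_space Q"
proof -
  have [measurable]: "f \<in> borel_measurable Q" "g \<in> borel_measurable Q" using f g by (auto dest: l2_space_measurable)
  have "integrable Q (\<lambda>x. (cmod (f x + g x))\<^sup>2)"
  proof (rule Bochner_Integration.integrable_bound)
    show "integrable Q (\<lambda>x. (cmod (f x))\<^sup>2 + 2 * (cmod (f x) * cmod (g x)) + (cmod (g x))\<^sup>2)"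
      by (intro Bochner_Integration.integrable_add integrable_mult_right l2_integrable_mult l2_space_integrable f g)
    have "(cmod (f x + g x))\<^sup>2 \<le> (cmod (f x))\<^sup>2 + 2 * (cmod (f x) * cmod (g x)) + (cmod (g x))\<^sup>2" for x
      using power_mono[OF norm_triangle_ineq[of "f x" "g x"], of 2] by (simp add: power2_sum algebra_simps)
    then show "AE x in Q. norm ((cmod (f x + g x))\<^sup>2) \<le> norm ((cmod (f x))\<^sup>2 + 2 * (cmod (f x) * cmod (g x)) + (cmod (g x))\<^sup>2)"
      by (intro AE_I2) simp
  qed measurable
  then show ?thesis unfolding l2_space_def by simp
qed

lemma l2_space_diff:
  assumes "f \<in> l2_space Q" "g \<in> l2_space Q"
  shows "(\<lambda>x. f x - g x) \<in> l2_space Q"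
  using l2_space_add[OF assms(1) l2_space_mult[OF assms(2), of "-1"]] by simp

lemma l2_space_zero: "(\<lambda>_. 0) \<in> l2_space Q"
  unfolding l2_space_def by simp

lemma l2_space_sum:
  assumes "\<And>i. i \<in> I \<Longrightarrow> f i \<in> l2_space Q"
  shows "(\<lambda>x. \<Sum>i\<in>I. f i x) \<in> l2_space Q"
  using assms by (induction I rule: infinite_finite_induct) (auto intro: l2_space_zero l2_space_add)

lemma l2_norm_Cauchy_Schwarz:
  assumes f: "f \<in> l2_space Q" and g: "g \<in> l2_space Q"
  shows "(\<integral>x. cmod (f x) * cmod (g x) \<partial>Q) \<le> l2_norm Q f * l2_norm Q g"
proof -
  have [measurable]: "f \<in> borel_measurable Q" "g \<in> borel_measurable Q" using f g by (auto dest: l2_space_measurable)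
  have "(\<integral>\<^sup>+x. ennreal (cmod (f x)) * ennreal (cmod (g x)) \<partial>Q)\<^sup>2
    \<le> (\<integral>\<^sup>+x. (ennreal (cmod (f x)))\<^sup>2 \<partial>Q) * (\<integral>\<^sup>+x. (ennreal (cmod (g x)))\<^sup>2 \<partial>Q)"
    by (rule Cauchy_Schwarz_nn_integral) measurable
  also have "(\<integral>\<^sup>+x. ennreal (cmod (f x)) * ennreal (cmod (g x)) \<partial>Q) = ennreal (\<integral>x. cmod (f x) * cmod (g x) \<partial>Q)"
    by (subst nn_integral_eq_integral[symmetric, OF l2_integrable_mult[OF f g]]) (auto simp: ennreal_mult)
  also have "(\<integral>\<^sup>+x. (ennreal (cmod (f x)))\<^sup>2 \<partial>Q) = ennreal ((l2_norm Q f)\<^sup>2)"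
    using nn_integral_l2_norm[OF f] by (simp add: ennreal_power)
  also have "(\<integral>\<^sup>+x. (ennreal (cmod (g x)))\<^sup>2 \<partial>Q) = ennreal ((l2_norm Q g)\<^sup>2)"
    using nn_integral_l2_norm[OF g] by (simp add: ennreal_power)
  also have "ennreal ((l2_norm Q f)\<^sup>2) * ennreal ((l2_norm Q g)\<^sup>2) = ennreal ((l2_norm Q f * l2_norm Q g)\<^sup>2)"
    by (simp add: ennreal_mult power_mult_distrib)
  finally have "(\<integral>x. cmod (f x) * cmod (g x) \<partial>Q)\<^sup>2 \<le> (l2_norm Q f * l2_norm Q g)\<^sup>2"
    by (simp add: ennreal_power ennreal_le_iff)
  then show ?thesis by (rule power2_le_imp_le) (simp add: l2_norm_nonneg)
qed

lemma l2_norm_triangle: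
  assumes f: "f \<in> l2_space Q" and g: "g \<in> l2_space Q"
  shows "l2_norm Q (\<lambda>x. f x + g x) \<le> l2_norm Q f + l2_norm Q g"
proof -
  have "(l2_norm Q (\<lambda>x. f x + g x))\<^sup>2 \<le> (\<integral>x. (cmod (f x))\<^sup>2 + 2 * (cmod (f x) * cmod (g x)) + (cmod (g x))\<^sup>2 \<partial>Q)"
    unfolding l2_norm_power2
  proof (rule integral_mono)
    show "(cmod (f x + g x))\<^sup>2 \<le> (cmod (f x))\<^sup>2 + 2 * (cmod (f x) * cmod (g x)) + (cmod (g x))\<^sup>2" for x
      using power_mono[OF norm_triangle_ineq[of "f x" "g x"], of 2] by (simp add: power2_sum algebra_simps)
  qed (intro Bochner_Integration.integrable_add integrable_mult_right l2_integrable_mult l2_space_integrable l2_space_add f g)+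
  also have "\<dots> = (l2_norm Q f)\<^sup>2 + 2 * (\<integral>x. cmod (f x) * cmod (g x) \<partial>Q) + (l2_norm Q g)\<^sup>2"
    unfolding l2_norm_power2 using l2_integrable_mult[OF f g] l2_space_integrable[OF f] l2_space_integrable[OF g] by simp
  also have "\<dots> \<le> (l2_norm Q f + l2_norm Q g)\<^sup>2"
    using l2_norm_Cauchy_Schwarz[OF f g] by (simp add: power2_sum)
  finally show ?thesis by (rule power2_le_imp_le) (simp add: l2_norm_nonneg)
qed

lemma l2_norm_triangle_diff:
  assumes f: "f \<in> l2_space Q" and g: "g \<in> l2_space Q"
  shows "l2_norm Q (\<lambda>x. f x - g x) \<le> l2_norm Q f + l2_norm Q g"
  using l2_norm_triangle[OF f l2_space_mult[OF g, of "-1"]] l2_norm_mult[of Q "-1" g] by simp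

lemma l2_norm_sum_le:
  assumes "\<And>i. i \<in> I \<Longrightarrow> f i \<in> l2_space Q"
  shows "l2_norm Q (\<lambda>x. \<Sum>i\<in>I. f i x) \<le> (\<Sum>i\<in>I. l2_norm Q (f i))"
  using assms
proof (induction I rule: infinite_finite_induct)
  case (insert i I)
  have "l2_norm Q (\<lambda>x. f i x + (\<Sum>i\<in>I. f i x)) \<le> l2_norm Q (f i) + l2_norm Q (\<lambda>x. \<Sum>i\<in>I. f i x)"
    using insert.prems by (intro l2_norm_triangle l2_space_sum) auto
  also have "\<dots> \<le> l2_norm Q (f i) + (\<Sum>i\<in>I. l2_norm Q (f i))"
    using insert.IH insert.prems by (intro add_left_mono) auto
  finally show ?case using insert.hyps by simp
qed (auto simp: l2_norm_def)

section \<open>The inner product\<close>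

lemma borel_measurable_cnj[measurable]: "cnj \<in> borel_measurable borel"
  by (intro borel_measurable_continuous_onI continuous_intros)

lemma l2_inner_integrable:
  assumes f: "f \<in> l2_space Q" and g: "g \<in> l2_space Q"
  shows "integrable Q (\<lambda>x. f x * cnj (g x))"
proof (rule Bochner_Integration.integrable_bound[OF l2_integrable_mult[OF f g]])
  show "(\<lambda>x. f x * cnj (g x)) \<in> borel_measurable Q"
    using l2_space_measurable[OF f] l2_space_measurable[OF g] by measurable
qed (simp add: norm_mult)

lemma l2_inner_Cauchy_Schwarz:
  assumes f: "f \<in> l2_space Q" and g: "g \<in> l2_space Q"
  shows "cmod (l2_inner Q f g) \<le> l2_norm Q f * l2_norm Q g"
proof -
  have "cmod (l2_inner Q f g) \<le> (\<integral>x. cmod (f x * cnj (g x)) \<partial>Q)"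
    unfolding l2_inner_def by (rule integral_norm_bound)
  also have "\<dots> = (\<integral>x. cmod (f x) * cmod (g x) \<partial>Q)" by (simp add: norm_mult)
  also have "\<dots> \<le> l2_norm Q f * l2_norm Q g" by (rule l2_norm_Cauchy_Schwarz[OF f g])
  finally show ?thesis .
qed

lemma l2_inner_self: "l2_inner Q f f = complex_of_real ((l2_norm Q f)\<^sup>2)"
  unfolding l2_inner_def l2_norm_power2 complex_norm_square[symmetric] by (rule integral_complex_of_real)

lemma l2_inner_cong_AE:
  assumes "f \<in> borel_measurable Q" "f' \<in> borel_measurable Q" "g \<in> borel_measurable Q" "g' \<in> borel_measurable Q"
    and "AE x in Q. f x = f' x" "AE x in Q. g x = g' x"
  shows "l2_inner Q f g = l2_inner Q f' g'"
  unfolding l2_inner_def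
proof (rule integral_cong_AE)
  show "(\<lambda>x. f x * cnj (g x)) \<in> borel_measurable Q" "(\<lambda>x. f' x * cnj (g' x)) \<in> borel_measurable Q"
    using assms(1-4) by measurable
qed (use assms(5,6) in auto)

lemma l2_inner_sum_left:
  assumes "\<And>i. i \<in> I \<Longrightarrow> f i \<in> l2_space Q" "g \<in> l2_space Q"
  shows "l2_inner Q (\<lambda>x. \<Sum>i\<in>I. c i * f i x) g = (\<Sum>i\<in>I. c i * l2_inner Q (f i) g)"
proof -
  have "l2_inner Q (\<lambda>x. \<Sum>i\<in>I. c i * f i x) g = (\<integral>x. (\<Sum>i\<in>I. c i * (f i x * cnj (g x))) \<partial>Q)"
    unfolding l2_inner_def by (simp add: sum_distrib_right mult.assoc)
  also have "\<dots> = (\<Sum>i\<in>I. \<integral>x. c i * (f i x * cnj (g x)) \<partial>Q)"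
    using assms by (intro Bochner_Integration.integral_sum integrable_mult_right l2_inner_integrable) auto
  also have "\<dots> = (\<Sum>i\<in>I. c i * l2_inner Q (f i) g)" unfolding l2_inner_def by simp
  finally show ?thesis .
qed

lemma l2_inner_commute: "l2_inner Q f g = cnj (l2_inner Q g f)"
proof -
  have "cnj (l2_inner Q g f) = (\<integral>x. cnj (g x * cnj (f x)) \<partial>Q)"
    unfolding l2_inner_def by (rule Bochner_Integration.integral_cnj[symmetric])
  also have "\<dots> = l2_inner Q f g" unfolding l2_inner_def by (simp add: mult.commute)
  finally show ?thesis by simp
qed

lemma l2_inner_sum_right:
  assumes "\<And>i. i \<in> I \<Longrightarrow> g i \<in> l2_space Q" "f \<in> l2_space Q"
  shows "l2_inner Q f (\<lambda>x. \<Sum>i\<in>I. c i * g i x) = (\<Sum>i\<in>I. cnj (c i) * l2_inner Q f (g i))"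
proof -
  have "l2_inner Q f (\<lambda>x. \<Sum>i\<in>I. c i * g i x) = (\<Sum>i\<in>I. cnj (c i) * cnj (l2_inner Q (g i) f))"
    unfolding l2_inner_commute[of Q f "\<lambda>x. \<Sum>i\<in>I. c i * g i x"] using l2_inner_sum_left[of I g Q f c] assms by simp
  then show ?thesis using l2_inner_commute[of Q f] by simp
qed

lemma l2_inner_add_left:
  assumes "f \<in> l2_space Q" "g \<in> l2_space Q" "h \<in> l2_space Q"
  shows "l2_inner Q (\<lambda>x. f x + g x) h = l2_inner Q f h + l2_inner Q g h"
  unfolding l2_inner_def using assms by (simp add: distrib_right l2_inner_integrable)

lemma l2_inner_diff_left:
  assumes "f \<in> l2_space Q" "g \<in> l2_space Q" "h \<in> l2_space Q"
  shows "l2_inner Q (\<lambda>x. f x - g x) h = l2_inner Q f h - l2_inner Q g h"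
  unfolding l2_inner_def using assms by (simp add: left_diff_distrib l2_inner_integrable)

lemma l2_inner_mult_left: "l2_inner Q (\<lambda>x. c * f x) h = c * l2_inner Q f h"
  unfolding l2_inner_def by (simp add: mult.assoc)

text \<open>Tested with h = f - g. It turns identities between inner products, through which an
  adjoint is given, into almost everywhere identities.\<close>

lemma AE_eq_of_l2_inner_eq:
  assumes f: "f \<in> l2_space Q" and g: "g \<in> l2_space Q"
    and eq: "\<And>h. h \<in> l2_space Q \<Longrightarrow> l2_inner Q f h = l2_inner Q g h"
  shows "AE x in Q. f x = g x"
proof -
  let ?d = "\<lambda>x. f x - g x"
  have d: "?d \<in> l2_space Q" by (rule l2_space_diff[OF f g])
  have "l2_inner Q ?d ?d = 0" using l2_inner_diff_left[OF f g d] eq[OF d] by simp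
  then have "l2_norm Q ?d = 0" unfolding l2_inner_self by simp
  then show ?thesis unfolding l2_norm_eq_0_iff[OF d] by simp
qed

section \<open>Series with geometrically decaying norms\<close>

lemma l2_series_summable:
  fixes f :: "nat \<Rightarrow> 'a \<Rightarrow> complex"
  assumes f: "\<And>n. f n \<in> l2_space Q" and le: "\<And>n. l2_norm Q (f n) \<le> C * q ^ n" and q: "0 < q" "q < 1"
  shows "AE x in Q. summable (\<lambda>n. cmod (f n x))"
proof -
  note [measurable] = l2_space_measurable[OF f]
  \<comment> \<open>With the weights 1/q^n the n-th term has integral at most C^2 q^n, so the
    weighted series of squares is finite almost everywhere. The inequality |f_n| <= q^n + |f_n|^2 /
    q^n then dominates the original series.\<close>
  have "(\<integral>\<^sup>+x. (\<Sum>n. ennreal ((cmod (f n x))\<^sup>2 / q ^ n)) \<partial>Q) = (\<Sum>n. \<integral>\<^sup>+x. ennreal ((cmod (f n x))\<^sup>2 / q ^ n) \<partial>Q)"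
    by (rule nn_integral_suminf) measurable
  also have "\<dots> \<le> (\<Sum>n. ennreal (C\<^sup>2 * q ^ n))"
  proof (rule suminf_le)
    fix n
    have "(\<integral>\<^sup>+x. ennreal ((cmod (f n x))\<^sup>2 / q ^ n) \<partial>Q) = (\<integral>\<^sup>+x. ennreal (1 / q ^ n) * ennreal ((cmod (f n x))\<^sup>2) \<partial>Q)"
      using q by (intro nn_integral_cong) (simp add: ennreal_mult[symmetric])
    also have "\<dots> = ennreal (1 / q ^ n) * ennreal ((l2_norm Q (f n))\<^sup>2)"
      by (subst nn_integral_cmult) (simp_all add: nn_integral_l2_norm[OF f])
    also have "\<dots> = ennreal ((l2_norm Q (f n))\<^sup>2 / q ^ n)" using q by (simp add: ennreal_mult[symmetric])
    also have "\<dots> \<le> ennreal ((C * q ^ n)\<^sup>2 / q ^ n)"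
      using q by (intro ennreal_leI divide_right_mono power_mono le l2_norm_nonneg) auto
    also have "(C * q ^ n)\<^sup>2 / q ^ n = C\<^sup>2 * q ^ n" using q by (simp add: power_mult_distrib power2_eq_square)
    finally show "(\<integral>\<^sup>+x. ennreal ((cmod (f n x))\<^sup>2 / q ^ n) \<partial>Q) \<le> ennreal (C\<^sup>2 * q ^ n)" .
  qed auto
  also have "\<dots> = ennreal (\<Sum>n. C\<^sup>2 * q ^ n)"
    using q by (intro suminf_ennreal2 summable_mult summable_geometric) auto
  finally have "(\<integral>\<^sup>+x. (\<Sum>n. ennreal ((cmod (f n x))\<^sup>2 / q ^ n)) \<partial>Q) \<noteq> \<infinity>"
    by (auto simp: top_unique)
  then have "AE x in Q. (\<Sum>n. ennreal ((cmod (f n x))\<^sup>2 / q ^ n)) \<noteq> \<infinity>"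
    by (intro nn_integral_PInf_AE) auto
  then show ?thesis
  proof eventually_elim
    case (elim x)
    have s: "summable (\<lambda>n. (cmod (f n x))\<^sup>2 / q ^ n)"
      using elim q by (intro summable_suminf_not_top) auto
    have "summable (\<lambda>n. q ^ n + (cmod (f n x))\<^sup>2 / q ^ n)"
      using s q by (intro summable_add summable_geometric) auto
    then show ?case
    proof (rule summable_comparison_test')
      fix n
      have "2 * (cmod (f n x) * q ^ n) \<le> (cmod (f n x))\<^sup>2 + (q ^ n)\<^sup>2"
        using sum_squares_bound[of "cmod (f n x)" "q ^ n"] by simp
      moreover have "0 \<le> cmod (f n x) * q ^ n" using q by simp
      ultimately have "cmod (f n x) * q ^ n \<le> (cmod (f n x))\<^sup>2 + (q ^ n)\<^sup>2" by linarith
      then show "norm (cmod (f n x)) \<le> q ^ n + (cmod (f n x))\<^sup>2 / q ^ n"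
        using q by (simp add: field_simps power2_eq_square)
    qed
  qed
qed

text \<open>Fatou's lemma stands in for the completeness of \<open>L\<^sup>2\<close>.\<close>

lemma l2_series_norm:
  fixes f :: "nat \<Rightarrow> 'a \<Rightarrow> complex"
  assumes f: "\<And>n. f n \<in> l2_space Q" and le: "\<And>n. l2_norm Q (f n) \<le> C * q ^ n" and q: "0 < q" "q < 1"
  shows "(\<lambda>x. \<Sum>n. f n x) \<in> l2_space Q" "l2_norm Q (\<lambda>x. \<Sum>n. f n x) \<le> C / (1 - q)"
proof -
  note [measurable] = l2_space_measurable[OF f]
  have C: "0 \<le> C" using le[of 0] l2_norm_nonneg[of Q "f 0"] by simp
  have part: "l2_norm Q (\<lambda>x. \<Sum>i<n. f i x) \<le> C / (1 - q)" for n
  proof -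
    have "l2_norm Q (\<lambda>x. \<Sum>i<n. f i x) \<le> (\<Sum>i<n. l2_norm Q (f i))" by (intro l2_norm_sum_le f)
    also have "\<dots> \<le> (\<Sum>i<n. C * q ^ i)" by (intro sum_mono le)
    also have "\<dots> = C * ((1 - q ^ n) / (1 - q))"
      using q sum_gp_strict[of q n] unfolding sum_distrib_left[symmetric] by simp
    also have "\<dots> \<le> C * (1 / (1 - q))" using q C by (intro mult_left_mono divide_right_mono) auto
    finally show ?thesis by simp
  qed
  \<comment> \<open>Where the series diverges, the value of \<open>suminf\<close> is meaningless;
    these points form a null set, which the integrals below ignore.\<close>
  have lim: "AE x in Q. (\<lambda>n. ennreal ((cmod (\<Sum>i<n. f i x))\<^sup>2)) \<longlonglongrightarrow> ennreal ((cmod (\<Sum>n. f n x))\<^sup>2)"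
    using l2_series_summable[OF f le q]
  proof eventually_elim
    case (elim x)
    then have "(\<lambda>n. \<Sum>i<n. f i x) \<longlonglongrightarrow> (\<Sum>n. f n x)"
      by (rule summable_LIMSEQ[OF summable_norm_cancel])
    from tendsto_power[OF tendsto_norm[OF this], of 2] show ?case by (rule tendsto_ennrealI)
  qed
  have "(\<integral>\<^sup>+x. ennreal ((cmod (\<Sum>n. f n x))\<^sup>2) \<partial>Q)
    = (\<integral>\<^sup>+x. liminf (\<lambda>n. ennreal ((cmod (\<Sum>i<n. f i x))\<^sup>2)) \<partial>Q)"
  proof (rule nn_integral_cong_AE)
    show "AE x in Q. ennreal ((cmod (\<Sum>n. f n x))\<^sup>2) = liminf (\<lambda>n. ennreal ((cmod (\<Sum>i<n. f i x))\<^sup>2))"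
      using lim by eventually_elim (rule lim_imp_Liminf[symmetric], simp_all)
  qed
  also have "\<dots> \<le> liminf (\<lambda>n. \<integral>\<^sup>+x. ennreal ((cmod (\<Sum>i<n. f i x))\<^sup>2) \<partial>Q)"
    by (rule nn_integral_liminf) measurable
  also have "\<dots> = liminf (\<lambda>n. ennreal ((l2_norm Q (\<lambda>x. \<Sum>i<n. f i x))\<^sup>2))"
    by (simp add: nn_integral_l2_norm[OF l2_space_sum] f)
  also have "\<dots> \<le> liminf (\<lambda>n::nat. ennreal ((C / (1 - q))\<^sup>2))"
    using part l2_norm_nonneg by (intro Liminf_mono always_eventually allI ennreal_leI power_mono)
  also have "\<dots> = ennreal ((C / (1 - q))\<^sup>2)" by (simp add: Liminf_const)
  finally have *: "(\<integral>\<^sup>+x. ennreal ((cmod (\<Sum>n. f n x))\<^sup>2) \<partial>Q) \<le> ennreal ((C / (1 - q))\<^sup>2)" .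
  have m: "(\<lambda>x. \<Sum>n. f n x) \<in> borel_measurable Q" by measurable
  show "(\<lambda>x. \<Sum>n. f n x) \<in> l2_space Q" "l2_norm Q (\<lambda>x. \<Sum>n. f n x) \<le> C / (1 - q)"
    using l2_norm_leI[OF m *] C q by auto
qed

text \<open>Almost everywhere the tail is a series of the same kind, with C q^k in place of
  C.\<close>

lemma l2_series_tail:
  fixes f :: "nat \<Rightarrow> 'a \<Rightarrow> complex"
  assumes f: "\<And>n. f n \<in> l2_space Q" and le: "\<And>n. l2_norm Q (f n) \<le> C * q ^ n" and q: "0 < q" "q < 1"
  shows "l2_norm Q (\<lambda>x. (\<Sum>n. f n x) - (\<Sum>i<k. f i x)) \<le> C * q ^ k / (1 - q)"
proof -
  note [measurable] = l2_space_measurable[OF f]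
  have le': "l2_norm Q (f (n + k)) \<le> C * q ^ k * q ^ n" for n
    using le[of "n + k"] by (simp add: power_add mult.assoc mult.commute mult.left_commute)
  have "AE x in Q. (\<Sum>n. f n x) - (\<Sum>i<k. f i x) = (\<Sum>n. f (n + k) x)"
    using l2_series_summable[OF f le q]
    by eventually_elim (use suminf_minus_initial_segment[of "\<lambda>n. f n _"] summable_norm_cancel in metis)
  then have "l2_norm Q (\<lambda>x. (\<Sum>n. f n x) - (\<Sum>i<k. f i x)) = l2_norm Q (\<lambda>x. \<Sum>n. f (n + k) x)"
    by (intro l2_norm_cong_AE) measurable
  also have "\<dots> \<le> C * q ^ k / (1 - q)" by (rule l2_series_norm(2)[OF f le' q])
  finally show ?thesis .
qed

section \<open>Contractions, resolvents and spectral gaps\<close>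

definition l2_contraction :: "'a measure \<Rightarrow> (('a \<Rightarrow> complex) \<Rightarrow> 'a \<Rightarrow> complex) \<Rightarrow> bool" where
  "l2_contraction Q T \<longleftrightarrow> l2_operator Q T \<and> (\<forall>f\<in>l2_space Q. l2_norm Q (T f) \<le> l2_norm Q f)"

lemma l2_operatorD:
  assumes "l2_operator Q T"
  shows "f \<in> l2_space Q \<Longrightarrow> T f \<in> l2_space Q"
    and "f \<in> l2_space Q \<Longrightarrow> g \<in> l2_space Q \<Longrightarrow> AE x in Q. T (\<lambda>x. f x + g x) x = T f x + T g x"
    and "f \<in> l2_space Q \<Longrightarrow> AE x in Q. T (\<lambda>x. c * f x) x = c * T f x"
  using assms unfolding l2_operator_def by blast+

lemma l2_operator_diff:
  assumes T: "l2_operator Q T" and f: "f \<in> l2_space Q" and g: "g \<in> l2_space Q"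
  shows "AE x in Q. T (\<lambda>x. f x - g x) x = T f x - T g x"
proof -
  have "AE x in Q. T (\<lambda>x. f x + (- 1) * g x) x = T f x + T (\<lambda>x. (- 1) * g x) x"
    by (rule l2_operatorD(2)[OF T f l2_space_mult[OF g]])
  moreover have "AE x in Q. T (\<lambda>x. (- 1) * g x) x = (- 1) * T g x" by (rule l2_operatorD(3)[OF T g])
  ultimately show ?thesis by eventually_elim simp
qed

lemma l2_operator_zero:
  assumes T: "l2_operator Q T"
  shows "AE x in Q. T (\<lambda>x. 0) x = 0"
  using l2_operatorD(3)[OF T l2_space_zero, of 0] by simp

text \<open>Operators act on representatives, so that they respect null sets has to be derived: f -
  g has norm 0, the norm bound sends it to norm 0, and linearity separates the two images.\<close>

lemma l2_operator_cong_AE: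
  assumes T: "l2_operator Q T" and f: "f \<in> l2_space Q" and g: "g \<in> l2_space Q" and eq: "AE x in Q. f x = g x"
  shows "AE x in Q. T f x = T g x"
proof -
  obtain B where B: "\<And>f. f \<in> l2_space Q \<Longrightarrow> l2_norm Q (T f) \<le> B * l2_norm Q f"
    using T unfolding l2_operator_def by blast
  let ?d = "\<lambda>x. f x - g x"
  have d: "?d \<in> l2_space Q" by (rule l2_space_diff[OF f g])
  have "l2_norm Q ?d = 0" unfolding l2_norm_eq_0_iff[OF d] using eq by eventually_elim simp
  then have "l2_norm Q (T ?d) = 0" using B[OF d] l2_norm_nonneg[of Q "T ?d"] by simp
  then have "AE x in Q. T ?d x = 0" using l2_norm_eq_0_iff[OF l2_operatorD(1)[OF T d]] by simp
  then show ?thesis using l2_operator_diff[OF T f g] by eventually_elim simp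
qed

lemma l2_operator_comp:
  assumes S: "l2_operator Q S" and T: "l2_operator Q T"
  shows "l2_operator Q (S \<circ> T)"
  unfolding l2_operator_def o_def
proof (intro conjI ballI allI)
  note S1 = l2_operatorD(1)[OF S] and T1 = l2_operatorD(1)[OF T]
  fix f assume f: "f \<in> l2_space Q"
  show "S (T f) \<in> l2_space Q" by (intro S1 T1 f)
  fix c
  have "AE x in Q. S (T (\<lambda>x. c * f x)) x = S (\<lambda>x. c * T f x) x"
    by (intro l2_operator_cong_AE[OF S] T1 l2_space_mult f l2_operatorD(3)[OF T])
  then show "AE x in Q. S (T (\<lambda>x. c * f x)) x = c * S (T f) x"
    using l2_operatorD(3)[OF S T1[OF f], of c] by eventually_elim simp
  fix g assume g: "g \<in> l2_space Q"
  have "AE x in Q. S (T (\<lambda>x. f x + g x)) x = S (\<lambda>x. T f x + T g x) x"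
    by (intro l2_operator_cong_AE[OF S] T1 l2_space_add f g l2_operatorD(2)[OF T])
  then show "AE x in Q. S (T (\<lambda>x. f x + g x)) x = S (T f) x + S (T g) x"
    using l2_operatorD(2)[OF S T1[OF f] T1[OF g]] by eventually_elim simp
next
  obtain B where B: "\<And>f. f \<in> l2_space Q \<Longrightarrow> l2_norm Q (S f) \<le> B * l2_norm Q f"
    using S unfolding l2_operator_def by blast
  obtain B' where B': "\<And>f. f \<in> l2_space Q \<Longrightarrow> l2_norm Q (T f) \<le> B' * l2_norm Q f"
    using T unfolding l2_operator_def by blast
  \<comment> \<open>\<open>B\<close> may be negative, hence the absolute value before the second
    bound is inserted.\<close>
  have "l2_norm Q (S (T f)) \<le> \<bar>B\<bar> * B' * l2_norm Q f" if f: "f \<in> l2_space Q" for f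
  proof -
    have "l2_norm Q (S (T f)) \<le> B * l2_norm Q (T f)" by (rule B[OF l2_operatorD(1)[OF T f]])
    also have "\<dots> \<le> \<bar>B\<bar> * l2_norm Q (T f)" by (intro mult_right_mono l2_norm_nonneg) simp
    also have "\<dots> \<le> \<bar>B\<bar> * (B' * l2_norm Q f)" by (intro mult_left_mono B' f) simp
    finally show ?thesis by (simp add: mult.assoc)
  qed
  then show "\<exists>B. \<forall>f\<in>l2_space Q. l2_norm Q (S (T f)) \<le> B * l2_norm Q f" by blast
qed

lemma l2_contraction_comp:
  assumes S: "l2_contraction Q S" and T: "l2_contraction Q T"
  shows "l2_contraction Q (S \<circ> T)"
  using S T l2_operator_comp[of Q S T] l2_operatorD(1)[of Q T] unfolding l2_contraction_def
  by (auto intro: order_trans)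

lemma l2_contraction_funpow:
  assumes T: "l2_contraction Q T"
  shows "l2_contraction Q (T ^^ k)"
proof (induction k)
  case 0
  have "l2_operator Q id"
    unfolding l2_operator_def by (auto intro: exI[of _ 1])
  then show ?case by (simp add: l2_contraction_def id_def)
next
  case (Suc k)
  then show ?case using l2_contraction_comp[OF T] by (simp add: o_def)
qed

text \<open>The resolvent is the Neumann series \<open>\<Sum>n. T\<^sup>n / c\<^sup>n\<^sup>+\<^sup>1\<close>.\<close>

lemma l2_contraction_not_in_spectrum:
  assumes T: "l2_contraction Q T" and c: "cmod c > 1"
  shows "c \<notin> l2_spectrum Q T"
proof -
  define q where "q = 1 / cmod c"
  have q: "0 < q" "q < 1" using c by (auto simp: q_def divide_less_eq)
  have c0: "c \<noteq> 0" using c by auto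
  have Top: "l2_operator Q T" using T unfolding l2_contraction_def by blast
  have Tn: "l2_contraction Q (T ^^ n)" for n by (rule l2_contraction_funpow[OF T])
  have Tnop: "l2_operator Q (T ^^ n)" for n using Tn unfolding l2_contraction_def by blast
  define a where "a f n x = (T ^^ n) f x / c ^ Suc n" for f n x
  have a_alt: "a f n = (\<lambda>x. (1 / c ^ Suc n) * (T ^^ n) f x)" for f n unfolding a_def by auto
  have a_l2: "a f n \<in> l2_space Q" if "f \<in> l2_space Q" for f n
    unfolding a_alt by (intro l2_space_mult l2_operatorD(1)[OF Tnop] that)
  have a_norm: "l2_norm Q (a f n) \<le> l2_norm Q f * q * q ^ n" if f: "f \<in> l2_space Q" for f n
  proof -
    have "l2_norm Q (a f n) = q ^ Suc n * l2_norm Q ((T ^^ n) f)"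
      unfolding a_alt l2_norm_mult q_def by (simp add: norm_divide norm_power norm_mult power_one_over)
    also have "\<dots> \<le> q ^ Suc n * l2_norm Q f"
      using Tn[of n] f q unfolding l2_contraction_def by (intro mult_left_mono) auto
    finally show ?thesis by (simp add: mult_ac)
  qed
  define R where "R f x = (\<Sum>n. a f n x)" for f x
  have R_l2: "R f \<in> l2_space Q" and R_norm: "l2_norm Q (R f) \<le> l2_norm Q f * q / (1 - q)"
    if f: "f \<in> l2_space Q" for f
    using l2_series_norm[of "a f" Q, OF a_l2[OF f] a_norm[OF f] q] unfolding R_def by auto
  have summ: "AE x in Q. summable (\<lambda>n. a f n x)" if f: "f \<in> l2_space Q" for f
    using l2_series_summable[of "a f" Q, OF a_l2[OF f] a_norm[OF f] q]
    by eventually_elim (rule summable_norm_cancel)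
  have R_op: "l2_operator Q R"
    unfolding l2_operator_def
  proof (intro conjI ballI allI)
    fix f assume f: "f \<in> l2_space Q"
    show "R f \<in> l2_space Q" by (rule R_l2[OF f])
    fix d
    have "AE x in Q. \<forall>n. (T ^^ n) (\<lambda>x. d * f x) x = d * (T ^^ n) f x"
      unfolding AE_all_countable by (intro allI l2_operatorD(3)[OF Tnop f])
    then show "AE x in Q. R (\<lambda>x. d * f x) x = d * R f x"
      using summ[OF f]
    proof eventually_elim
      case (elim x)
      have "R (\<lambda>x. d * f x) x = (\<Sum>n. d * a f n x)" using elim(1) unfolding R_def a_def by simp
      also have "\<dots> = d * R f x" unfolding R_def by (rule suminf_mult[OF elim(2)])
      finally show ?case .
    qed
    fix g assume g: "g \<in> l2_space Q"
    have "AE x in Q. \<forall>n. (T ^^ n) (\<lambda>x. f x + g x) x = (T ^^ n) f x + (T ^^ n) g x"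
      unfolding AE_all_countable by (intro allI l2_operatorD(2)[OF Tnop f g])
    then show "AE x in Q. R (\<lambda>x. f x + g x) x = R f x + R g x"
      using summ[OF f] summ[OF g]
    proof eventually_elim
      case (elim x)
      have "R (\<lambda>x. f x + g x) x = (\<Sum>n. a f n x + a g n x)"
        using elim(1) unfolding R_def a_def by (simp add: add_divide_distrib)
      also have "\<dots> = R f x + R g x" unfolding R_def by (rule suminf_add[OF elim(2,3), symmetric])
      finally show ?case .
    qed
  next
    show "\<exists>B. \<forall>f\<in>l2_space Q. l2_norm Q (R f) \<le> B * l2_norm Q f"
      using R_norm by (intro exI[of _ "q / (1 - q)"]) (simp add: mult.commute)
  qed
  \<comment> \<open>Almost everywhere, and for all n at once, the terms of the series for c f - T f
    are differences of consecutive terms c a_n. The sum telescopes, and the remainder vanishes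
    because the terms of a convergent series tend to 0.\<close>
  have left: "AE x in Q. R (\<lambda>x. c * f x - T f x) x = f x" if f: "f \<in> l2_space Q" for f
  proof -
    have Tf: "T f \<in> l2_space Q" by (rule l2_operatorD(1)[OF Top f])
    have "AE x in Q. \<forall>n. (T ^^ n) (\<lambda>x. c * f x - T f x) x = c * (T ^^ n) f x - (T ^^ Suc n) f x"
      unfolding AE_all_countable
    proof
      fix n
      show "AE x in Q. (T ^^ n) (\<lambda>x. c * f x - T f x) x = c * (T ^^ n) f x - (T ^^ Suc n) f x"
        using l2_operator_diff[OF Tnop[of n] l2_space_mult[OF f] Tf, of c] l2_operatorD(3)[OF Tnop[of n] f, of c]
        by eventually_elim (simp add: funpow_swap1)
    qed
    then show ?thesis
      using summ[OF f]
    proof eventually_elim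
      case (elim x)
      have "(\<lambda>n. c * a f n x) \<longlonglongrightarrow> c * 0"
        using summable_LIMSEQ_zero[OF elim(2)] by (rule tendsto_mult_left)
      then have "(\<lambda>n. c * a f n x - c * a f (Suc n) x) sums (c * a f 0 x - 0)"
        by (intro telescope_sums') simp
      moreover have "c * a f n x - c * a f (Suc n) x = a (\<lambda>x. c * f x - T f x) n x" for n
        using elim(1) c0 unfolding a_def by (simp add: field_simps)
      moreover have "c * a f 0 x = f x" using c0 unfolding a_def by simp
      ultimately show ?case unfolding R_def by (simp add: sums_iff)
    qed
  qed
  have right: "AE x in Q. c * R f x - T (R f) x = f x" if f: "f \<in> l2_space Q" for f
  proof -
    \<comment> \<open>Here T is applied to the infinite sum itself, and it cannot be moved inside
      pointwise. For the partial sums, T P_n = c P_(n+1) - f almost everywhere, so the defect d of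
      the resolvent identity is expressed by the tails R f - P_n, whose norms tend to 0.\<close>
    define P where "P n x = (\<Sum>i<n. a f i x)" for n x
    have P_l2: "P n \<in> l2_space Q" for n unfolding P_def by (intro l2_space_sum a_l2 f)
    have P_Suc: "P (Suc n) x = P n x + a f n x" for n x unfolding P_def by simp
    have T_a: "AE x in Q. T (a f i) x = c * a f (Suc i) x" for i
      using l2_operatorD(3)[OF Top l2_operatorD(1)[OF Tnop[of i] f], of "1 / c ^ Suc i"]
      unfolding a_alt by eventually_elim (use c0 in simp)
    have T_P: "AE x in Q. T (P n) x = c * P (Suc n) x - f x" for n
    proof (induction n)
      case 0
      have P0: "P 0 = (\<lambda>x. 0)" unfolding P_def by auto
      have P1: "c * P (Suc 0) x = f x" for x using c0 by (simp add: P_def a_def)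
      show ?case using l2_operator_zero[OF Top] unfolding P0 P1 by simp
    next
      case (Suc n)
      have "P (Suc n) = (\<lambda>x. P n x + a f n x)" by (rule ext) (rule P_Suc)
      then have "AE x in Q. T (P (Suc n)) x = T (P n) x + T (a f n) x"
        using l2_operatorD(2)[OF Top P_l2 a_l2[OF f]] by (simp only:)
      then show ?case using Suc T_a[of n]
      proof eventually_elim
        case (elim x)
        show ?case
          unfolding elim P_Suc[of "Suc n" x] by (simp add: algebra_simps)
      qed
    qed
    define d where "d x = (c * R f x - T (R f) x) - f x" for x
    have cR: "(\<lambda>x. c * R f x - T (R f) x) \<in> l2_space Q"
      by (intro l2_space_diff l2_space_mult R_l2[OF f] l2_operatorD(1)[OF Top])
    have d_l2: "d \<in> l2_space Q" unfolding d_def by (rule l2_space_diff[OF cR f])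
    have tail: "l2_norm Q (\<lambda>x. R f x - P n x) \<le> l2_norm Q f * q * q ^ n / (1 - q)" for n
      unfolding R_def P_def by (rule l2_series_tail[OF a_l2[OF f] a_norm[OF f] q])
    have bound: "l2_norm Q d \<le> cmod c * (l2_norm Q f * q * q ^ Suc n / (1 - q)) + l2_norm Q f * q * q ^ n / (1 - q)" for n
    proof -
      let ?u = "\<lambda>x. c * (R f x - P (Suc n) x)" and ?v = "T (\<lambda>x. R f x - P n x)"
      have RP: "(\<lambda>x. R f x - P n x) \<in> l2_space Q" for n by (intro l2_space_diff R_l2 P_l2 f)
      have u: "?u \<in> l2_space Q" by (intro l2_space_mult RP)
      have v: "?v \<in> l2_space Q" by (intro l2_operatorD(1)[OF Top] RP)
      have "AE x in Q. d x = ?u x - ?v x"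
        using l2_operator_diff[OF Top R_l2[OF f] P_l2, of n] T_P[of n]
        by eventually_elim (simp add: d_def algebra_simps)
      then have "l2_norm Q d = l2_norm Q (\<lambda>x. ?u x - ?v x)"
        by (intro l2_norm_cong_AE l2_space_measurable d_l2 l2_space_diff u v)
      also have "\<dots> \<le> l2_norm Q ?u + l2_norm Q ?v" by (rule l2_norm_triangle_diff[OF u v])
      also have "l2_norm Q ?u = cmod c * l2_norm Q (\<lambda>x. R f x - P (Suc n) x)" by (rule l2_norm_mult)
      also have "l2_norm Q ?v \<le> l2_norm Q (\<lambda>x. R f x - P n x)"
        using T RP unfolding l2_contraction_def by blast
      finally show ?thesis
        using tail[of n] mult_left_mono[OF tail[of "Suc n"], of "cmod c"] by simp
    qed
    have "(\<lambda>n. cmod c * (l2_norm Q f * q * q ^ Suc n / (1 - q)) + l2_norm Q f * q * q ^ n / (1 - q))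
      \<longlonglongrightarrow> cmod c * (l2_norm Q f * q * 0 / (1 - q)) + l2_norm Q f * q * 0 / (1 - q)"
      using q by (intro tendsto_intros LIMSEQ_realpow_zero LIMSEQ_Suc[OF LIMSEQ_realpow_zero]) auto
    then have "l2_norm Q d \<le> 0"
      using bound by (intro LIMSEQ_le_const) auto
    then have "l2_norm Q d = 0" using l2_norm_nonneg[of Q d] by simp
    then have "AE x in Q. d x = 0" unfolding l2_norm_eq_0_iff[OF d_l2] .
    then show ?thesis by eventually_elim (simp add: d_def)
  qed
  show ?thesis unfolding l2_spectrum_def using R_op left right by blast
qed

text \<open>The real spectrum lies in [-1, 1], so its supremum off 1 is at most 1; the conventions
  give gap 1 for an empty set and 0 if the eigenvalue 1 is not simple. The upper bound 2 = 1 - (-1)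
  keeps the family over k bounded.\<close>

lemma spectral_gap_l2_contraction:
  assumes T: "l2_contraction Q T"
  shows "0 \<le> spectral_gap Q T" "spectral_gap Q T \<le> 2"
proof -
  define A where "A = {r::real. complex_of_real r \<in> l2_spectrum Q T \<and> r \<noteq> 1}"
  have A: "- 1 \<le> r" "r \<le> 1" if "r \<in> A" for r
    using l2_contraction_not_in_spectrum[OF T, of "complex_of_real r"] that unfolding A_def
    by (cases "\<bar>r\<bar> > 1"; simp; linarith)+
  have "A \<noteq> {} \<Longrightarrow> Sup A \<le> 1" using A by (intro cSup_least) auto
  moreover have "A \<noteq> {} \<Longrightarrow> - 1 \<le> Sup A"
    using A by (metis bdd_above.I cSup_upper2 ex_in_conv)
  ultimately show "0 \<le> spectral_gap Q T" "spectral_gap Q T \<le> 2"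
    unfolding spectral_gap_def A_def[symmetric] Let_def by auto
qed

section \<open>The adjoint of a kernel and the pseudo spectral gap\<close>

locale invariant_kernel = prob_space Q for Q :: "'a measure" +
  fixes K :: "'a \<Rightarrow> 'a measure"
  assumes kernel_Q[measurable]: "K \<in> Q \<rightarrow>\<^sub>M prob_algebra Q" and invariant: "Q \<bind> K = Q"
begin

lemma kernel_Q_subprob[measurable]: "K \<in> Q \<rightarrow>\<^sub>M subprob_algebra Q"
  by (rule measurable_prob_algebraD[OF kernel_Q])

lemma kernel_Q_at:
  assumes "x \<in> space Q"
  shows "prob_space (K x)" "sets (K x) = sets Q" "space (K x) = space Q"
proof -
  have "K x \<in> space (prob_algebra Q)" by (rule measurable_space[OF kernel_Q assms])
  then show "prob_space (K x)" "sets (K x) = sets Q" by (auto simp: space_prob_algebra)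
  then show "space (K x) = space Q" by (intro sets_eq_imp_space_eq)
qed

lemma measurable_kernel_Q:
  assumes "x \<in> space Q" "f \<in> Q \<rightarrow>\<^sub>M N"
  shows "f \<in> K x \<rightarrow>\<^sub>M N"
  using assms(2) measurable_cong_sets[OF kernel_Q_at(2)[OF assms(1)] refl] by blast

lemma nn_integral_kernel_measurable[measurable]:
  assumes "f \<in> borel_measurable Q"
  shows "(\<lambda>x. \<integral>\<^sup>+y. f y \<partial>K x) \<in> borel_measurable Q"
  by (rule measurable_compose[OF kernel_Q_subprob nn_integral_measurable_subprob_algebra[OF assms]])

lemma nn_integral_kernel_invariant:
  assumes "f \<in> borel_measurable Q"
  shows "(\<integral>\<^sup>+x. (\<integral>\<^sup>+y. f y \<partial>K x) \<partial>Q) = (\<integral>\<^sup>+x. f x \<partial>Q)"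
  using nn_integral_bind[OF assms kernel_Q_subprob] invariant by simp

lemma kernel_op_measurable[measurable]:
  assumes "f \<in> borel_measurable Q"
  shows "kernel_op K f \<in> borel_measurable Q"
  unfolding kernel_op_def[abs_def]
  by (rule measurable_compose[OF kernel_Q_subprob integral_measurable_subprob_algebra[OF assms]])

text \<open>Jensen's inequality for the square: Cauchy-Schwarz against the constant 1 under the
  probability \<open>K x\<close>.\<close>

lemma nn_integral_kernel_square:
  fixes v :: "'a \<Rightarrow> ennreal"
  assumes x: "x \<in> space Q" and v: "v \<in> borel_measurable Q"
  shows "(\<integral>\<^sup>+y. v y \<partial>K x)\<^sup>2 \<le> (\<integral>\<^sup>+y. (v y)\<^sup>2 \<partial>K x)"
proof -
  interpret Kx: prob_space "K x" by (rule kernel_Q_at[OF x])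
  have "(\<integral>\<^sup>+y. v y * 1 \<partial>K x)\<^sup>2 \<le> (\<integral>\<^sup>+y. (v y)\<^sup>2 \<partial>K x) * (\<integral>\<^sup>+y. 1\<^sup>2 \<partial>K x)"
    by (rule Cauchy_Schwarz_nn_integral[OF measurable_kernel_Q[OF x v]]) simp
  then show ?thesis by (simp add: Kx.emeasure_space_1)
qed

lemma nn_integral_kernel_square_invariant:
  fixes v :: "'a \<Rightarrow> ennreal"
  assumes v[measurable]: "v \<in> borel_measurable Q"
  shows "(\<integral>\<^sup>+x. (\<integral>\<^sup>+y. v y \<partial>K x)\<^sup>2 \<partial>Q) \<le> (\<integral>\<^sup>+x. (v x)\<^sup>2 \<partial>Q)"
proof -
  have "(\<integral>\<^sup>+x. (\<integral>\<^sup>+y. v y \<partial>K x)\<^sup>2 \<partial>Q) \<le> (\<integral>\<^sup>+x. (\<integral>\<^sup>+y. (v y)\<^sup>2 \<partial>K x) \<partial>Q)"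
    by (intro nn_integral_mono nn_integral_kernel_square v)
  also have "\<dots> = (\<integral>\<^sup>+x. (v x)\<^sup>2 \<partial>Q)" by (rule nn_integral_kernel_invariant) measurable
  finally show ?thesis .
qed

lemma norm_kernel_op_le:
  assumes x: "x \<in> space Q" and f: "f \<in> borel_measurable Q"
  shows "ennreal (cmod (kernel_op K f x)) \<le> (\<integral>\<^sup>+y. ennreal (cmod (f y)) \<partial>K x)"
proof (cases "integrable (K x) f")
  case True
  then show ?thesis unfolding kernel_op_def by (rule integral_norm_bound_ennreal)
next
  case False
  \<comment> \<open>A function that is not integrable has Bochner integral 0, so the bound
    persists.\<close>
  then show ?thesis unfolding kernel_op_def by (simp add: not_integrable_integral_eq)
qed

lemma kernel_op_l2:
  assumes f: "f \<in> l2_space Q"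
  shows "kernel_op K f \<in> l2_space Q" "l2_norm Q (kernel_op K f) \<le> l2_norm Q f"
proof -
  have [measurable]: "f \<in> borel_measurable Q" by (rule l2_space_measurable[OF f])
  have "(\<integral>\<^sup>+x. ennreal ((cmod (kernel_op K f x))\<^sup>2) \<partial>Q) \<le> (\<integral>\<^sup>+x. (\<integral>\<^sup>+y. ennreal (cmod (f y)) \<partial>K x)\<^sup>2 \<partial>Q)"
  proof (rule nn_integral_mono)
    fix x assume x: "x \<in> space Q"
    have "ennreal ((cmod (kernel_op K f x))\<^sup>2) = (ennreal (cmod (kernel_op K f x)))\<^sup>2" by (simp add: ennreal_power)
    also have "\<dots> \<le> (\<integral>\<^sup>+y. ennreal (cmod (f y)) \<partial>K x)\<^sup>2"
      by (rule power_mono[OF norm_kernel_op_le[OF x]]) auto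
    finally show "ennreal ((cmod (kernel_op K f x))\<^sup>2) \<le> (\<integral>\<^sup>+y. ennreal (cmod (f y)) \<partial>K x)\<^sup>2" .
  qed
  also have "\<dots> \<le> (\<integral>\<^sup>+x. (ennreal (cmod (f x)))\<^sup>2 \<partial>Q)"
    by (rule nn_integral_kernel_square_invariant) measurable
  also have "\<dots> = ennreal ((l2_norm Q f)\<^sup>2)" using nn_integral_l2_norm[OF f] by (simp add: ennreal_power)
  finally have *: "(\<integral>\<^sup>+x. ennreal ((cmod (kernel_op K f x))\<^sup>2) \<partial>Q) \<le> ennreal ((l2_norm Q f)\<^sup>2)" .
  show "kernel_op K f \<in> l2_space Q" "l2_norm Q (kernel_op K f) \<le> l2_norm Q f"
    using l2_norm_leI[OF kernel_op_measurable * l2_norm_nonneg] by simp_all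
qed

text \<open>Because the Bochner integral defaults to 0, additivity of \<open>kernel_op\<close> is
  safe only where the functions are integrable. By Jensen and invariance this covers almost every
  x.\<close>

lemma AE_integrable_kernel:
  assumes f: "f \<in> l2_space Q"
  shows "AE x in Q. integrable (K x) f"
proof -
  have [measurable]: "f \<in> borel_measurable Q" by (rule l2_space_measurable[OF f])
  have "(\<integral>\<^sup>+x. (\<integral>\<^sup>+y. ennreal (cmod (f y)) \<partial>K x)\<^sup>2 \<partial>Q) \<le> (\<integral>\<^sup>+x. (ennreal (cmod (f x)))\<^sup>2 \<partial>Q)"
    by (rule nn_integral_kernel_square_invariant) measurable
  also have "\<dots> = ennreal ((l2_norm Q f)\<^sup>2)" using nn_integral_l2_norm[OF f] by (simp add: ennreal_power)
  finally have "(\<integral>\<^sup>+x. (\<integral>\<^sup>+y. ennreal (cmod (f y)) \<partial>K x)\<^sup>2 \<partial>Q) \<noteq> \<infinity>" by (auto simp: top_unique)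
  then have "AE x in Q. (\<integral>\<^sup>+y. ennreal (cmod (f y)) \<partial>K x)\<^sup>2 \<noteq> \<infinity>"
    by (intro nn_integral_PInf_AE) auto
  then show ?thesis
    using AE_space
  proof eventually_elim
    case (elim x)
    have m: "f \<in> borel_measurable (K x)" by (rule measurable_kernel_Q[OF elim(2)]) measurable
    have "(\<integral>\<^sup>+y. ennreal (cmod (f y)) \<partial>K x) \<noteq> top"
      using elim(1) unfolding power_eq_top_ennreal infinity_ennreal_def by simp
    then have "(\<integral>\<^sup>+y. ennreal (cmod (f y)) \<partial>K x) < \<infinity>"
      by (simp only: top.not_eq_extremum infinity_ennreal_def)
    then show ?case by (rule integrableI_bounded[OF m])
  qed
qed

lemma kernel_op_contraction: "l2_contraction Q (kernel_op K)"
  unfolding l2_contraction_def l2_operator_def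
proof (intro conjI ballI allI)
  fix f assume f: "f \<in> l2_space Q"
  show "kernel_op K f \<in> l2_space Q" "l2_norm Q (kernel_op K f) \<le> l2_norm Q f" by (fact kernel_op_l2[OF f])+
  show "AE x in Q. kernel_op K (\<lambda>x. c * f x) x = c * kernel_op K f x" for c
    unfolding kernel_op_def by simp
  fix g assume g: "g \<in> l2_space Q"
  show "AE x in Q. kernel_op K (\<lambda>x. f x + g x) x = kernel_op K f x + kernel_op K g x"
    using AE_integrable_kernel[OF f] AE_integrable_kernel[OF g]
    by eventually_elim (simp add: kernel_op_def)
next
  show "\<exists>B. \<forall>f\<in>l2_space Q. l2_norm Q (kernel_op K f) \<le> B * l2_norm Q f"
    using kernel_op_l2(2) by (intro exI[of _ 1]) simp
qed

lemma kernel_op_sum: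
  assumes "finite I" "\<And>i. i \<in> I \<Longrightarrow> g i \<in> l2_space Q"
  shows "AE x in Q. kernel_op K (\<lambda>x. \<Sum>i\<in>I. c i * g i x) x = (\<Sum>i\<in>I. c i * kernel_op K (g i) x)"
proof -
  have "AE x in Q. \<forall>i\<in>I. integrable (K x) (g i)"
    using assms AE_integrable_kernel by (intro AE_finite_allI) auto
  then show ?thesis by eventually_elim (simp add: kernel_op_def)
qed

text \<open>For nonnegative \<open>u\<close> the adjoint is the density of the measure
  \<open>A \<mapsto> \<integral> u(x) K(x, A) Q(dx)\<close> with respect to \<open>Q\<close>.\<close>

lemma adjoint_nonneg_exists:
  fixes u :: "'a \<Rightarrow> ennreal"
  assumes u[measurable]: "u \<in> borel_measurable Q"
  obtains d where "d \<in> borel_measurable Q"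
    "\<And>v. v \<in> borel_measurable Q \<Longrightarrow> (\<integral>\<^sup>+x. d x * v x \<partial>Q) = (\<integral>\<^sup>+x. u x * (\<integral>\<^sup>+y. v y \<partial>K x) \<partial>Q)"
    "(\<integral>\<^sup>+x. (d x)\<^sup>2 \<partial>Q) \<le> (\<integral>\<^sup>+x. (u x)\<^sup>2 \<partial>Q)"
proof -
  define \<nu> where "\<nu> = density Q u \<bind> K"
  have K': "K \<in> density Q u \<rightarrow>\<^sub>M subprob_algebra Q" by simp
  have sets_\<nu>: "sets \<nu> = sets Q"
    unfolding \<nu>_def using K' not_empty by (intro sets_bind[where N = Q]) (auto dest: kernel_Q_at(2))
  have nn_\<nu>: "(\<integral>\<^sup>+x. v x \<partial>\<nu>) = (\<integral>\<^sup>+x. u x * (\<integral>\<^sup>+y. v y \<partial>K x) \<partial>Q)" if v[measurable]: "v \<in> borel_measurable Q" for v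
    unfolding \<nu>_def nn_integral_bind[OF v K'] by (rule nn_integral_density) measurable
  \<comment> \<open>Invariance enters here: a Q-null set is null under \<open>K x\<close> for almost
    every x.\<close>
  have ac: "absolutely_continuous Q \<nu>"
    unfolding absolutely_continuous_def
  proof
    fix A assume A: "A \<in> null_sets Q"
    then have [measurable]: "A \<in> sets Q" by auto
    have "(\<integral>\<^sup>+x. (\<integral>\<^sup>+y. indicator A y \<partial>K x) \<partial>Q) = 0"
      using nn_integral_kernel_invariant[of "indicator A"] A by (simp add: null_setsD1)
    then have "AE x in Q. (\<integral>\<^sup>+y. indicator A y \<partial>K x) = 0"
      by (subst (asm) nn_integral_0_iff_AE) auto
    then have "(\<integral>\<^sup>+x. u x * (\<integral>\<^sup>+y. indicator A y \<partial>K x) \<partial>Q) = (\<integral>\<^sup>+x. 0 \<partial>Q)"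
      by (intro nn_integral_cong_AE) auto
    then have "emeasure \<nu> A = 0" using nn_\<nu>[of "indicator A"] sets_\<nu> by simp
    then show "A \<in> null_sets \<nu>" using sets_\<nu> by auto
  qed
  define d where "d = RN_deriv Q \<nu>"
  have d[measurable]: "d \<in> borel_measurable Q" unfolding d_def by simp
  have dv: "(\<integral>\<^sup>+x. d x * v x \<partial>Q) = (\<integral>\<^sup>+x. u x * (\<integral>\<^sup>+y. v y \<partial>K x) \<partial>Q)" if v: "v \<in> borel_measurable Q" for v
    using RN_deriv_nn_integral[OF ac sets_\<nu> v] nn_\<nu>[OF v] unfolding d_def by simp
  define U where "U = (\<integral>\<^sup>+x. (u x)\<^sup>2 \<partial>Q)"
  \<comment> \<open>With b the integral of v^2, duality gives b^2 <= U b, and cancelling b needs b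
    finite; square integrability of d is not yet known. Hence the truncation at n, removed
    afterwards by Fatou's lemma.\<close>
  have trunc: "(\<integral>\<^sup>+x. (min (d x) (of_nat n))\<^sup>2 \<partial>Q) \<le> U" for n :: nat
  proof -
    define v where "v x = min (d x) (of_nat n)" for x
    have [measurable]: "v \<in> borel_measurable Q" unfolding v_def by measurable
    define b where "b = (\<integral>\<^sup>+x. (v x)\<^sup>2 \<partial>Q)"
    have "b \<le> (\<integral>\<^sup>+x. (of_nat n)\<^sup>2 \<partial>Q)" unfolding b_def v_def by (intro nn_integral_mono power_mono) auto
    also have "\<dots> < \<infinity>" by (simp add: emeasure_space_1 power_less_top_ennreal of_nat_less_top)
    finally have b: "b < \<infinity>" .
    have "b \<le> (\<integral>\<^sup>+x. d x * v x \<partial>Q)"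
      unfolding b_def by (intro nn_integral_mono) (auto simp: v_def power2_eq_square intro!: mult_right_mono)
    also have "\<dots> = (\<integral>\<^sup>+x. u x * (\<integral>\<^sup>+y. v y \<partial>K x) \<partial>Q)" by (rule dv) measurable
    finally have "b\<^sup>2 \<le> (\<integral>\<^sup>+x. u x * (\<integral>\<^sup>+y. v y \<partial>K x) \<partial>Q)\<^sup>2" by (intro power_mono) auto
    also have "\<dots> \<le> U * (\<integral>\<^sup>+x. (\<integral>\<^sup>+y. v y \<partial>K x)\<^sup>2 \<partial>Q)"
      unfolding U_def by (rule Cauchy_Schwarz_nn_integral) measurable
    also have "\<dots> \<le> U * b"
      unfolding b_def by (intro mult_left_mono nn_integral_kernel_square_invariant) auto
    finally have "b * b \<le> b * U" by (simp add: power2_eq_square mult.commute)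
    then have "b = 0 \<or> b \<le> U" using b ennreal_mult_le_mult_iff[of b b U] by (cases "b = 0") auto
    then show ?thesis unfolding b_def v_def by auto
  qed
  have "(\<integral>\<^sup>+x. (d x)\<^sup>2 \<partial>Q) = (\<integral>\<^sup>+x. liminf (\<lambda>n. (min (d x) (of_nat n))\<^sup>2) \<partial>Q)"
  proof (rule nn_integral_cong)
    fix x
    have "(\<lambda>n::nat. min (d x) (of_nat n)) \<longlonglongrightarrow> min (d x) top"
      by (intro tendsto_min tendsto_const of_nat_tendsto_top_ennreal)
    then have "(\<lambda>n::nat. min (d x) (of_nat n) * min (d x) (of_nat n)) \<longlonglongrightarrow> d x * d x"
      by (intro tendsto_mult_ennreal) auto
    then show "(d x)\<^sup>2 = liminf (\<lambda>n. (min (d x) (of_nat n))\<^sup>2)"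
      unfolding power2_eq_square by (intro lim_imp_Liminf[symmetric]) auto
  qed
  also have "\<dots> \<le> liminf (\<lambda>n. \<integral>\<^sup>+x. (min (d x) (of_nat n))\<^sup>2 \<partial>Q)"
    by (rule nn_integral_liminf) measurable
  also have "\<dots> \<le> liminf (\<lambda>n::nat. U)"
    using trunc by (intro Liminf_mono always_eventually allI)
  also have "\<dots> = U" by (simp add: Liminf_const)
  finally show ?thesis using that[OF d dv] unfolding U_def by blast
qed

text \<open>Carries the extended real density over to L^2. Nonnegative functions appear as complex
  functions equal to their own modulus, so that \<open>l2_inner\<close> applies to them.\<close>

lemma adjoint_nonneg_l2:
  assumes u: "u \<in> l2_space Q" and u_nonneg: "\<And>x. u x = complex_of_real (cmod (u x))"
  obtains e where "e \<in> l2_space Q"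
    "\<And>g. g \<in> l2_space Q \<Longrightarrow> (\<And>x. g x = complex_of_real (cmod (g x))) \<Longrightarrow>
      l2_inner Q e g = l2_inner Q u (kernel_op K g)"
proof -
  have [measurable]: "u \<in> borel_measurable Q" by (rule l2_space_measurable[OF u])
  have um: "(\<lambda>x. ennreal (cmod (u x))) \<in> borel_measurable Q" by measurable
  obtain d where d[measurable]: "d \<in> borel_measurable Q"
    and dv: "\<And>v. v \<in> borel_measurable Q \<Longrightarrow>
      (\<integral>\<^sup>+x. d x * v x \<partial>Q) = (\<integral>\<^sup>+x. ennreal (cmod (u x)) * (\<integral>\<^sup>+y. v y \<partial>K x) \<partial>Q)"
    and d2: "(\<integral>\<^sup>+x. (d x)\<^sup>2 \<partial>Q) \<le> (\<integral>\<^sup>+x. (ennreal (cmod (u x)))\<^sup>2 \<partial>Q)"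
    by (rule adjoint_nonneg_exists[OF um]) (rule that, assumption+)
  \<comment> \<open>\<open>enn2real\<close> replaces infinite values by 0; since d^2 has finite
    integral, this changes d only on a null set.\<close>
  define e where "e x = complex_of_real (enn2real (d x))" for x
  have [measurable]: "e \<in> borel_measurable Q" unfolding e_def by measurable
  have fin: "(\<integral>\<^sup>+x. (d x)\<^sup>2 \<partial>Q) < \<infinity>"
  proof -
    have "(\<integral>\<^sup>+x. (ennreal (cmod (u x)))\<^sup>2 \<partial>Q) < \<infinity>"
      using nn_integral_l2_norm[OF u] by (simp add: ennreal_power)
    with d2 show ?thesis by (rule le_less_trans)
  qed
  have "(\<lambda>x. (d x)\<^sup>2) \<in> borel_measurable Q" by measurable
  then have "AE x in Q. (d x)\<^sup>2 \<noteq> \<infinity>"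
    by (rule nn_integral_PInf_AE[OF _ less_imp_neq[OF fin]])
  then have e_d: "AE x in Q. ennreal (cmod (e x)) = d x"
  proof eventually_elim
    case (elim x)
    then have "d x \<noteq> top" by (simp add: power_eq_top_ennreal)
    then have "d x < top" by (simp only: top.not_eq_extremum)
    then show ?case unfolding e_def by (simp only: norm_of_real abs_of_nonneg enn2real_nonneg ennreal_enn2real)
  qed
  have e: "e \<in> l2_space Q"
  proof (rule l2_spaceI_nn_integral)
    have "(\<integral>\<^sup>+x. ennreal ((cmod (e x))\<^sup>2) \<partial>Q) = (\<integral>\<^sup>+x. (d x)\<^sup>2 \<partial>Q)"
    proof (rule nn_integral_cong_AE)
      show "AE x in Q. ennreal ((cmod (e x))\<^sup>2) = (d x)\<^sup>2"
        using e_d by eventually_elim (simp only: ennreal_power[symmetric] norm_ge_zero)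
    qed
    then show "(\<integral>\<^sup>+x. ennreal ((cmod (e x))\<^sup>2) \<partial>Q) < \<infinity>" using fin by simp
  qed simp
  have "l2_inner Q e g = l2_inner Q u (kernel_op K g)"
    if g: "g \<in> l2_space Q" and g_nonneg: "\<And>x. g x = complex_of_real (cmod (g x))" for g
  proof -
    have [measurable]: "g \<in> borel_measurable Q" by (rule l2_space_measurable[OF g])
    have Kg: "kernel_op K g \<in> l2_space Q" by (rule kernel_op_l2[OF g])
    have Kg_real: "kernel_op K g x = complex_of_real (\<integral>y. cmod (g y) \<partial>K x)" for x
    proof -
      have "kernel_op K g x = (\<integral>y. complex_of_real (cmod (g y)) \<partial>K x)"
        unfolding kernel_op_def by (rule Bochner_Integration.integral_cong[OF refl g_nonneg])
      then show ?thesis unfolding integral_complex_of_real .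
    qed
    have Kg_nonneg: "cmod (kernel_op K g x) = (\<integral>y. cmod (g y) \<partial>K x)" for x
      unfolding Kg_real norm_of_real by (rule abs_of_nonneg) (rule Bochner_Integration.integral_nonneg, simp)
    have "AE x in Q. (\<integral>\<^sup>+y. ennreal (cmod (g y)) \<partial>K x) = ennreal (cmod (kernel_op K g x))"
      using AE_integrable_kernel[OF g]
    proof eventually_elim
      case (elim x)
      then show ?case unfolding Kg_nonneg by (intro nn_integral_eq_integral) auto
    qed
    then have *: "(\<integral>\<^sup>+x. ennreal (cmod (u x)) * (\<integral>\<^sup>+y. ennreal (cmod (g y)) \<partial>K x) \<partial>Q)
      = (\<integral>\<^sup>+x. ennreal (cmod (u x)) * ennreal (cmod (kernel_op K g x)) \<partial>Q)"
      by (intro nn_integral_cong_AE) auto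
    have "ennreal (\<integral>x. cmod (e x) * cmod (g x) \<partial>Q) = (\<integral>\<^sup>+x. ennreal (cmod (e x)) * ennreal (cmod (g x)) \<partial>Q)"
      by (subst nn_integral_eq_integral[symmetric, OF l2_integrable_mult[OF e g]]) (auto simp: ennreal_mult)
    also have "\<dots> = (\<integral>\<^sup>+x. d x * ennreal (cmod (g x)) \<partial>Q)"
      using e_d by (intro nn_integral_cong_AE) auto
    also have "\<dots> = (\<integral>\<^sup>+x. ennreal (cmod (u x)) * ennreal (cmod (kernel_op K g x)) \<partial>Q)"
      unfolding *[symmetric] by (rule dv) measurable
    also have "\<dots> = ennreal (\<integral>x. cmod (u x) * cmod (kernel_op K g x) \<partial>Q)"
      by (subst nn_integral_eq_integral[symmetric, OF l2_integrable_mult[OF u Kg]]) (auto simp: ennreal_mult)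
    finally have eq: "(\<integral>x. cmod (e x) * cmod (g x) \<partial>Q) = (\<integral>x. cmod (u x) * cmod (kernel_op K g x) \<partial>Q)"
      by (subst (asm) ennreal_inj) (auto intro!: Bochner_Integration.integral_nonneg)
    have "l2_inner Q e g = (\<integral>x. complex_of_real (cmod (e x) * cmod (g x)) \<partial>Q)"
      unfolding l2_inner_def
    proof (rule Bochner_Integration.integral_cong[OF refl])
      fix x
      show "e x * cnj (g x) = complex_of_real (cmod (e x) * cmod (g x))"
      proof -
        have "e x = complex_of_real (cmod (e x))" by (simp add: e_def)
        then have "e x * cnj (g x) = complex_of_real (cmod (e x)) * cnj (complex_of_real (cmod (g x)))"
          using g_nonneg[of x] by metis
        then show ?thesis by (simp only: complex_cnj_complex_of_real of_real_mult)
      qed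
    qed
    also have "\<dots> = (\<integral>x. complex_of_real (cmod (u x) * cmod (kernel_op K g x)) \<partial>Q)"
      unfolding integral_complex_of_real eq ..
    also have "\<dots> = l2_inner Q u (kernel_op K g)"
      unfolding l2_inner_def
    proof (rule Bochner_Integration.integral_cong[OF refl])
      fix x
      show "complex_of_real (cmod (u x) * cmod (kernel_op K g x)) = u x * cnj (kernel_op K g x)"
        unfolding of_real_mult u_nonneg[of x, symmetric]
        unfolding Kg_nonneg unfolding Kg_real complex_cnj_complex_of_real ..
    qed
    finally show ?thesis .
  qed
  with e show ?thesis by (rule that)
qed

text \<open>\<open>f = \<Sum>c\<in>{1, -1, i, -i}. c f\<^sub>c\<close> with nonnegative \<open>f\<^sub>c = max 0 (Re (cnj c f))\<close>.\<close>

definition complex_units :: "complex set" where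
  "complex_units = {1, - 1, \<i>, - \<i>}"

definition nonneg_part :: "complex \<Rightarrow> ('a \<Rightarrow> complex) \<Rightarrow> 'a \<Rightarrow> complex" where
  "nonneg_part c f x = complex_of_real (max 0 (Re (cnj c * f x)))"

lemma finite_complex_units: "finite complex_units"
  unfolding complex_units_def by simp

lemma sum_nonneg_part: "(\<Sum>c\<in>complex_units. c * nonneg_part c f x) = f x"
proof -
  \<comment> \<open>If two units coincided, the sum over the set would omit a summand of the
    list.\<close>
  have "distinct [1, - 1, \<i>, - \<i>]" by (auto simp: complex_eq_iff)
  then have "(\<Sum>c\<in>complex_units. c * nonneg_part c f x) = (\<Sum>c\<leftarrow>[1, - 1, \<i>, - \<i>]. c * nonneg_part c f x)"
    unfolding complex_units_def by (subst sum_list_distinct_conv_sum_set) (auto simp: insert_commute)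
  also have "\<dots> = f x" by (auto simp: nonneg_part_def complex_eq_iff max_def)
  finally show ?thesis .
qed

lemma nonneg_part_nonneg: "nonneg_part c f x = complex_of_real (cmod (nonneg_part c f x))"
  unfolding nonneg_part_def by simp

lemma nonneg_part_l2:
  assumes f: "f \<in> l2_space Q" and c: "c \<in> complex_units"
  shows "nonneg_part c f \<in> l2_space Q"
proof (rule l2_spaceI_nn_integral)
  have [measurable]: "f \<in> borel_measurable Q" by (rule l2_space_measurable[OF f])
  show "nonneg_part c f \<in> borel_measurable Q" unfolding nonneg_part_def[abs_def] by measurable
  have le: "cmod (nonneg_part c f x) \<le> cmod (f x)" for x
  proof -
    have "Re (cnj c * f x) \<le> cmod (cnj c * f x)" by (rule complex_Re_le_cmod)
    moreover have "cmod c = 1" using c unfolding complex_units_def by auto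
    ultimately show ?thesis unfolding nonneg_part_def norm_of_real norm_mult complex_mod_cnj by simp
  qed
  have "(\<integral>\<^sup>+x. ennreal ((cmod (nonneg_part c f x))\<^sup>2) \<partial>Q) \<le> (\<integral>\<^sup>+x. ennreal ((cmod (f x))\<^sup>2) \<partial>Q)"
    by (intro nn_integral_mono ennreal_leI power_mono le norm_ge_zero)
  also have "\<dots> < \<infinity>" unfolding nn_integral_l2_norm[OF f] by simp
  finally show "(\<integral>\<^sup>+x. ennreal ((cmod (nonneg_part c f x))\<^sup>2) \<partial>Q) < \<infinity>" .
qed

text \<open>The vector that Riesz representation would supply, assembled from four nonnegative
  densities by linearity in f and conjugate linearity in g.\<close>

lemma adjoint_at_exists:
  assumes f: "f \<in> l2_space Q"
  shows "\<exists>e\<in>l2_space Q. \<forall>g\<in>l2_space Q. l2_inner Q e g = l2_inner Q f (kernel_op K g)"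
proof -
  have "\<exists>e. \<forall>c\<in>complex_units. e c \<in> l2_space Q \<and>
    (\<forall>g\<in>l2_space Q. (\<forall>x. g x = complex_of_real (cmod (g x))) \<longrightarrow>
      l2_inner Q (e c) g = l2_inner Q (nonneg_part c f) (kernel_op K g))"
  proof (rule bchoice, rule ballI)
    fix c assume c: "c \<in> complex_units"
    show "\<exists>e. e \<in> l2_space Q \<and>
      (\<forall>g\<in>l2_space Q. (\<forall>x. g x = complex_of_real (cmod (g x))) \<longrightarrow>
        l2_inner Q e g = l2_inner Q (nonneg_part c f) (kernel_op K g))"
      by (rule adjoint_nonneg_l2[OF nonneg_part_l2[OF f c] nonneg_part_nonneg]) blast
  qed
  then obtain e where e: "\<And>c. c \<in> complex_units \<Longrightarrow> e c \<in> l2_space Q"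
    and e_inner: "\<And>c g. c \<in> complex_units \<Longrightarrow> g \<in> l2_space Q \<Longrightarrow> (\<And>x. g x = complex_of_real (cmod (g x))) \<Longrightarrow>
      l2_inner Q (e c) g = l2_inner Q (nonneg_part c f) (kernel_op K g)"
    by blast
  define E where "E x = (\<Sum>c\<in>complex_units. c * e c x)" for x
  have E: "E \<in> l2_space Q" unfolding E_def by (intro l2_space_sum l2_space_mult e)
  have "l2_inner Q E g = l2_inner Q f (kernel_op K g)" if g: "g \<in> l2_space Q" for g
  proof -
    \<comment> \<open>The identity is extended from nonnegative to arbitrary g while f is still a
      single nonnegative part; the sum over the parts of f comes afterwards.\<close>
    have part: "l2_inner Q (e c) g = l2_inner Q (nonneg_part c f) (kernel_op K g)" if c: "c \<in> complex_units" for c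
    proof -
      have "l2_inner Q (e c) g = l2_inner Q (e c) (\<lambda>x. \<Sum>b\<in>complex_units. b * nonneg_part b g x)"
        by (simp add: sum_nonneg_part)
      also have "\<dots> = (\<Sum>b\<in>complex_units. cnj b * l2_inner Q (e c) (nonneg_part b g))"
        by (intro l2_inner_sum_right nonneg_part_l2 g e c)
      also have "\<dots> = (\<Sum>b\<in>complex_units. cnj b * l2_inner Q (nonneg_part c f) (kernel_op K (nonneg_part b g)))"
        using e_inner[OF c nonneg_part_l2[OF g] nonneg_part_nonneg] by (intro sum.cong) auto
      also have "\<dots> = l2_inner Q (nonneg_part c f) (\<lambda>x. \<Sum>b\<in>complex_units. b * kernel_op K (nonneg_part b g) x)"
        by (intro l2_inner_sum_right[symmetric] kernel_op_l2 nonneg_part_l2 f g c)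
      also have "\<dots> = l2_inner Q (nonneg_part c f) (kernel_op K g)"
      proof (rule l2_inner_cong_AE)
        have "AE x in Q. kernel_op K (\<lambda>x. \<Sum>b\<in>complex_units. b * nonneg_part b g x) x
            = (\<Sum>b\<in>complex_units. b * kernel_op K (nonneg_part b g) x)"
          by (intro kernel_op_sum finite_complex_units nonneg_part_l2 g)
        then show "AE x in Q. (\<Sum>b\<in>complex_units. b * kernel_op K (nonneg_part b g) x) = kernel_op K g x"
          by (simp add: sum_nonneg_part eq_commute)
      qed (use l2_space_measurable[OF nonneg_part_l2[OF f c]] in
            \<open>auto intro!: l2_space_measurable l2_space_sum l2_space_mult kernel_op_l2 nonneg_part_l2 g\<close>)
      finally show ?thesis .
    qed
    have "l2_inner Q E g = (\<Sum>c\<in>complex_units. c * l2_inner Q (e c) g)"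
      unfolding E_def by (intro l2_inner_sum_left e g)
    also have "\<dots> = (\<Sum>c\<in>complex_units. c * l2_inner Q (nonneg_part c f) (kernel_op K g))"
      using part by (intro sum.cong) auto
    also have "\<dots> = l2_inner Q (\<lambda>x. \<Sum>c\<in>complex_units. c * nonneg_part c f x) (kernel_op K g)"
      by (intro l2_inner_sum_left[symmetric] nonneg_part_l2 f kernel_op_l2 g)
    finally show ?thesis by (simp add: sum_nonneg_part)
  qed
  then show ?thesis using E by blast
qed

text \<open>Duality alone forces linearity and boundedness: inner products determine values almost
  everywhere, and the squared norm of T' f equals the inner product of f with K T' f, at most the
  norm of f times that of T' f because K is a contraction.\<close>

lemma formal_adjoint_contraction:
  assumes T': "\<And>f. f \<in> l2_space Q \<Longrightarrow> T' f \<in> l2_space Q"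
    and adj: "\<And>f g. f \<in> l2_space Q \<Longrightarrow> g \<in> l2_space Q \<Longrightarrow> l2_inner Q (T' f) g = l2_inner Q f (kernel_op K g)"
  shows "l2_contraction Q T'"
proof -
  have norm: "l2_norm Q (T' f) \<le> l2_norm Q f" if f: "f \<in> l2_space Q" for f
  proof -
    have "complex_of_real ((l2_norm Q (T' f))\<^sup>2) = l2_inner Q f (kernel_op K (T' f))"
      using adj[OF f T'[OF f]] by (simp add: l2_inner_self)
    then have "(l2_norm Q (T' f))\<^sup>2 = cmod (l2_inner Q f (kernel_op K (T' f)))"
      by (metis norm_of_real abs_of_nonneg zero_le_power2)
    also have "\<dots> \<le> l2_norm Q f * l2_norm Q (kernel_op K (T' f))"
      by (intro l2_inner_Cauchy_Schwarz f kernel_op_l2 T')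
    also have "\<dots> \<le> l2_norm Q f * l2_norm Q (T' f)"
      by (intro mult_left_mono kernel_op_l2 T' f l2_norm_nonneg)
    finally show ?thesis
      using l2_norm_nonneg[of Q "T' f"] l2_norm_nonneg[of Q f]
      by (cases "l2_norm Q (T' f) = 0") (auto simp: power2_eq_square)
  qed
  have "AE x in Q. T' (\<lambda>x. f x + g x) x = T' f x + T' g x" if f: "f \<in> l2_space Q" and g: "g \<in> l2_space Q" for f g
    by (rule AE_eq_of_l2_inner_eq)
       (simp_all add: T' f g l2_space_add adj l2_inner_add_left kernel_op_l2)
  moreover have "AE x in Q. T' (\<lambda>x. c * f x) x = c * T' f x" if f: "f \<in> l2_space Q" for f c
    by (rule AE_eq_of_l2_inner_eq)
       (simp_all add: T' f l2_space_mult adj l2_inner_mult_left kernel_op_l2)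
  ultimately have "l2_operator Q T'"
    unfolding l2_operator_def using T' norm by (auto intro!: exI[of _ 1])
  then show ?thesis using norm unfolding l2_contraction_def by blast
qed

text \<open>\<open>SOME\<close> has the adjoint property only if some operator has it. Choosing a
  representing vector for each f gives a map that duality makes an operator; the duality argument
  then applies again to the adjoint picked by \<open>SOME\<close>.\<close>

lemma l2_adjoint_contraction: "l2_contraction Q (l2_adjoint Q (kernel_op K))"
proof -
  obtain T' where T': "\<And>f. f \<in> l2_space Q \<Longrightarrow> T' f \<in> l2_space Q"
    "\<And>f g. f \<in> l2_space Q \<Longrightarrow> g \<in> l2_space Q \<Longrightarrow> l2_inner Q (T' f) g = l2_inner Q f (kernel_op K g)"
    using bchoice[of "l2_space Q"] adjoint_at_exists by metis
  then have "l2_operator Q T'" using formal_adjoint_contraction unfolding l2_contraction_def by blast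
  then have "\<exists>T'. l2_operator Q T' \<and>
     (\<forall>f\<in>l2_space Q. \<forall>g\<in>l2_space Q. l2_inner Q (T' f) g = l2_inner Q f (kernel_op K g))"
    using T' by blast
  from someI_ex[OF this] show ?thesis
    unfolding l2_adjoint_def[symmetric]
    by (intro formal_adjoint_contraction) (auto dest: l2_operatorD(1))
qed

text \<open>The member k = 1 is nonnegative, and the uniform bound 2 guarantees that the supremum
  dominates it.\<close>

lemma pseudo_spectral_gap_nonneg: "0 \<le> pseudo_spectral_gap Q K"
proof -
  define G where "G k = spectral_gap Q ((l2_adjoint Q (kernel_op K) ^^ k) \<circ> (kernel_op K ^^ k)) / real k" for k
  have G: "0 \<le> G k" "G k \<le> 2" if k: "k \<in> {1..}" for k
  proof -
    have c: "l2_contraction Q ((l2_adjoint Q (kernel_op K) ^^ k) \<circ> (kernel_op K ^^ k))"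
      by (intro l2_contraction_comp l2_contraction_funpow l2_adjoint_contraction kernel_op_contraction)
    note gap = spectral_gap_l2_contraction[OF c]
    show "0 \<le> G k" unfolding G_def using gap by simp
    have "G k \<le> 2 / real k" unfolding G_def using gap by (intro divide_right_mono) auto
    also have "\<dots> \<le> 2" using k by (simp add: field_simps)
    finally show "G k \<le> 2" .
  qed
  have "0 \<le> G 1" using G by simp
  also have "\<dots> \<le> (SUP k\<in>{1..}. G k)"
    by (rule cSUP_upper) (use G(2) in \<open>auto intro!: bdd_aboveI[of _ 2]\<close>)
  finally show ?thesis unfolding pseudo_spectral_gap_def G_def .
qed

end

section \<open>The stationary law of the window chain\<close>

lemma measurable_window_shift:
  "(\<lambda>(x, y). \<lambda>i\<in>{..<Suc p}. case i of 0 \<Rightarrow> y | Suc j \<Rightarrow> x j)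
    \<in> window_space (Suc p) \<Otimes>\<^sub>M (borel :: 'y::polish_space measure) \<rightarrow>\<^sub>M window_space (Suc p)"
  unfolding window_space_def split_beta'
proof (rule measurable_restrict)
  fix i assume i: "i \<in> {..<Suc p}"
  show "(\<lambda>z. case i of 0 \<Rightarrow> snd z | Suc j \<Rightarrow> fst z j)
      \<in> PiM {..<Suc p} (\<lambda>_. borel) \<Otimes>\<^sub>M (borel :: 'y measure) \<rightarrow>\<^sub>M borel"
  proof (cases i)
    case (Suc j)
    then have "(\<lambda>z. fst z j) \<in> PiM {..<Suc p} (\<lambda>_. borel) \<Otimes>\<^sub>M (borel :: 'y measure) \<rightarrow>\<^sub>M borel"
      using i by (intro measurable_compose[OF measurable_fst measurable_component_singleton]) auto
    then show ?thesis using Suc by simp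
  qed simp
qed

lemma window_kernel_measurable:
  fixes \<kappa> :: "(nat \<Rightarrow> 'y) \<Rightarrow> 'y::polish_space measure"
  assumes \<kappa>: "\<kappa> \<in> window_space k \<rightarrow>\<^sub>M prob_algebra borel" and k: "k \<le> p"
  shows "window_kernel p k \<kappa> \<in> window_space (Suc p) \<rightarrow>\<^sub>M prob_algebra (window_space (Suc p))"
proof -
  have "(\<lambda>x. restrict x {..<k}) \<in> window_space (Suc p) \<rightarrow>\<^sub>M (window_space k :: (nat \<Rightarrow> 'y) measure)"
    unfolding window_space_def using k by (intro measurable_restrict_subset) auto
  from measurable_distr_prob_space2[OF measurable_compose[OF this \<kappa>] measurable_window_shift]
  show ?thesis unfolding window_kernel_def[abs_def] .
qed

lemma measurable_window:
  assumes "\<And>i. i < q \<Longrightarrow> Y (t - int i) \<in> borel_measurable N"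
  shows "(\<lambda>w. window q (\<lambda>s. Y s w) t) \<in> N \<rightarrow>\<^sub>M window_space q"
  unfolding window_def window_space_def by (rule measurable_restrict) (use assms in simp)

lemma measurable_past_algebra:
  assumes "s < t"
  shows "Y s \<in> borel_measurable (past_algebra M Y t)"
proof -
  have "(\<lambda>w. \<lambda>s\<in>{..<t}. Y s w) \<in> past_algebra M Y t \<rightarrow>\<^sub>M PiM {..<t} (\<lambda>_. borel)"
    unfolding past_algebra_def by (rule measurable_vimage_algebra1) (auto simp: space_PiM)
  from measurable_compose[OF this measurable_component_singleton[of s]] show ?thesis using assms by simp
qed

lemma subalgebra_past_algebra:
  assumes Y: "\<And>t. Y t \<in> borel_measurable M"
  shows "subalgebra M (past_algebra M Y t)"
  unfolding subalgebra_def
proof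
  show "space (past_algebra M Y t) = space M" unfolding past_algebra_def by simp
  have "(\<lambda>w. \<lambda>s\<in>{..<t}. Y s w) \<in> M \<rightarrow>\<^sub>M PiM {..<t} (\<lambda>_. borel)"
    by (rule measurable_restrict) (rule Y)
  then show "sets (past_algebra M Y t) \<subseteq> sets M"
    unfolding past_algebra_def by (subst sets_vimage_algebra2) (auto simp: space_PiM measurable_def)
qed

locale markov_window =
  fixes M :: "'w measure" and Y :: "int \<Rightarrow> 'w \<Rightarrow> 'y::polish_space"
    and \<kappa> :: "(nat \<Rightarrow> 'y) \<Rightarrow> 'y measure" and k p :: nat
  assumes markov: "homogeneous_markov M Y k \<kappa>" and stationary: "stationary_process M Y"
    and order: "k \<le> p"
begin

lemma Y_measurable[measurable]: "Y t \<in> borel_measurable M"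
  and \<kappa>_measurable: "\<kappa> \<in> window_space k \<rightarrow>\<^sub>M prob_algebra borel"
  and prob_M: "prob_space M"
  and cond_exp: "A \<in> sets borel \<Longrightarrow> AE w in M.
        real_cond_exp M (past_algebra M Y t) (\<lambda>v. indicator A (Y t v)) w =
        measure (\<kappa> (window k (\<lambda>s. Y s w) (t - 1))) A"
  using markov unfolding homogeneous_markov_def by blast+

definition X :: "int \<Rightarrow> 'w \<Rightarrow> nat \<Rightarrow> 'y" where
  "X t w = window (Suc p) (\<lambda>s. Y s w) t"

lemma X_measurable[measurable]: "X t \<in> M \<rightarrow>\<^sub>M window_space (Suc p)"
  unfolding X_def[abs_def] by (rule measurable_window) (rule Y_measurable)

text \<open>\<open>stationary_law\<close> is the law at time 0, whereas the invariance argument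
  reads it at time -1 before the transition and at time 0 after it.\<close>

lemma stationary_law_eq: "stationary_law M Y p = distr M (window_space (Suc p)) (X t)"
proof -
  let ?W = "window_space (Suc p) :: (nat \<Rightarrow> 'y) measure" and ?P = "PiM UNIV (\<lambda>_. borel) :: (int \<Rightarrow> 'y) measure"
  have win: "(\<lambda>y. window (Suc p) y 0) \<in> ?P \<rightarrow>\<^sub>M ?W"
    using measurable_window[of "Suc p" "\<lambda>s y. y s" 0 ?P] by simp
  have path: "(\<lambda>w t. Y (t + h) w) \<in> M \<rightarrow>\<^sub>M ?P" for h
    using measurable_restrict[of UNIV "\<lambda>t. Y (t + h)" M "\<lambda>_. borel"] Y_measurable by (simp only: restrict_UNIV UNIV_I)
  have "distr M ?W (X t) = distr (distr M ?P (\<lambda>w s. Y (s + t) w)) ?W (\<lambda>y. window (Suc p) y 0)"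
    by (subst distr_distr[OF win path]) (simp add: X_def[abs_def] window_def o_def add.commute)
  also have "\<dots> = distr (distr M ?P (\<lambda>w s. Y s w)) ?W (\<lambda>y. window (Suc p) y 0)"
    using stationary unfolding stationary_process_def by metis
  also have "\<dots> = stationary_law M Y p"
    using path[of 0] unfolding stationary_law_def by (subst distr_distr[OF win]) (simp_all add: o_def)
  finally show ?thesis ..
qed

lemma prob_space_stationary_law: "prob_space (stationary_law M Y p)"
  unfolding stationary_law_eq[of 0] by (rule prob_space.prob_space_distr[OF prob_M X_measurable])

lemma sets_stationary_law: "sets (stationary_law M Y p) = sets (window_space (Suc p))"
  unfolding stationary_law_def by simp

text \<open>One transition takes the law of X at time -1 to its law at time 0. It suffices to
  compare boxes: there the condition on the new coordinate separates from an event of the past, and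
  the defining property of conditional expectation applies.\<close>

lemma window_kernel_invariant:
  "stationary_law M Y p \<bind> window_kernel p k \<kappa> = stationary_law M Y p"
proof -
  let ?W = "window_space (Suc p) :: (nat \<Rightarrow> 'y) measure"
  let ?Q = "stationary_law M Y p" and ?K = "window_kernel p k \<kappa>"
  interpret M: prob_space M by (rule prob_M)
  interpret Q: prob_space ?Q by (rule prob_space_stationary_law)
  let ?F = "past_algebra M Y 0"
  have sub: "subalgebra M ?F" by (rule subalgebra_past_algebra) (rule Y_measurable)
  interpret F: finite_measure_subalgebra M ?F by unfold_locales (rule sub)
  have K: "?K \<in> ?W \<rightarrow>\<^sub>M prob_algebra ?W" by (rule window_kernel_measurable[OF \<kappa>_measurable order])
  have K': "?K \<in> ?Q \<rightarrow>\<^sub>M subprob_algebra ?W"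
    using measurable_prob_algebraD[OF K] measurable_cong_sets[OF sets_stationary_law refl] by blast
  have Q_pa: "?Q \<in> space (prob_algebra ?W)"
    using Q.prob_space_axioms sets_stationary_law by (simp add: space_prob_algebra)
  show ?thesis
  proof (rule measure_eqI_PiM_finite[where I = "{..<Suc p}" and M = "\<lambda>_. borel" and A = "\<lambda>_. Pi\<^sub>E {..<Suc p} (\<lambda>_. UNIV)"])
    interpret QK: prob_space "?Q \<bind> ?K" by (rule prob_space_bind'[OF Q_pa K])
    show "emeasure (?Q \<bind> ?K) (Pi\<^sub>E {..<Suc p} (\<lambda>_. UNIV)) \<noteq> \<infinity>" by simp
    show "range (\<lambda>_::nat. Pi\<^sub>E {..<Suc p} (\<lambda>_. UNIV)) \<subseteq> prod_algebra {..<Suc p} (\<lambda>_. borel :: 'y measure)"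
      by (auto intro!: prod_algebraI_finite)
    show "sets (?Q \<bind> ?K) = sets (PiM {..<Suc p} (\<lambda>_. borel))"
      using sets_bind'[OF Q_pa K] by (simp add: window_space_def)
    show "sets ?Q = sets (PiM {..<Suc p} (\<lambda>_. borel))"
      using sets_stationary_law by (simp add: window_space_def)
    fix A :: "nat \<Rightarrow> 'y set" assume A: "\<And>i. i \<in> {..<Suc p} \<Longrightarrow> A i \<in> sets borel"
    \<comment> \<open>The box conditions on coordinates 1, ..., p, read one step earlier at
      positions 0, ..., p - 1. The oldest coordinate of the earlier window is unconstrained because
      the shift drops it.\<close>
    define D where "D = {x \<in> space ?W. \<forall>i<p. x i \<in> A (Suc i)}"
    have A0: "A 0 \<in> sets borel" using A by simp
    have box: "Pi\<^sub>E {..<Suc p} A \<in> sets ?W"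
      unfolding window_space_def using A by (intro sets_PiM_I_finite) auto
    have D: "D \<in> sets ?W"
    proof -
      have "{x \<in> space ?W. \<forall>i\<in>{..<p}. x i \<in> A (Suc i)} \<in> sets ?W"
      proof (rule sets.sets_Collect_finite_All)
        fix i assume i: "i \<in> {..<p}"
        have "(\<lambda>x. x i) \<in> ?W \<rightarrow>\<^sub>M borel"
          unfolding window_space_def using i by (intro measurable_component_singleton) auto
        then have "(\<lambda>x. x i) -` A (Suc i) \<inter> space ?W \<in> sets ?W"
          by (rule measurable_sets) (use A i in simp)
        also have "(\<lambda>x. x i) -` A (Suc i) \<inter> space ?W = {x \<in> space ?W. x i \<in> A (Suc i)}" by blast
        finally show "{x \<in> space ?W. x i \<in> A (Suc i)} \<in> sets ?W" .
      qed simp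
      also have "{x \<in> space ?W. \<forall>i\<in>{..<p}. x i \<in> A (Suc i)} = D" unfolding D_def by auto
      finally show ?thesis .
    qed
    \<comment> \<open>The order enters here: for k <= p the argument of the conditional law is an
      initial part of the window.\<close>
    have V: "restrict (X (- 1) w) {..<k} = window k (\<lambda>s. Y s w) (- 1)" for w
      unfolding X_def window_def using order by (auto simp: fun_eq_iff)
    have \<kappa>V: "prob_space (\<kappa> (restrict x {..<k}))" "sets (\<kappa> (restrict x {..<k})) = sets borel" if "x \<in> space ?W" for x
    proof -
      have "restrict x {..<k} \<in> space (window_space k)" by (auto simp: window_space_def space_PiM)
      from measurable_space[OF \<kappa>_measurable this]
      show "prob_space (\<kappa> (restrict x {..<k}))" "sets (\<kappa> (restrict x {..<k})) = sets borel"
        by (auto simp: space_prob_algebra)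
    qed
    have K_box: "emeasure (?K x) (Pi\<^sub>E {..<Suc p} A) = indicator D x * ennreal (measure (\<kappa> (restrict x {..<k})) (A 0))"
      if x: "x \<in> space ?W" for x
    proof -
      interpret \<kappa>x: prob_space "\<kappa> (restrict x {..<k})" by (rule \<kappa>V[OF x])
      have "(\<lambda>y. \<lambda>i\<in>{..<Suc p}. case i of 0 \<Rightarrow> y | Suc j \<Rightarrow> x j) \<in> borel \<rightarrow>\<^sub>M ?W"
        using measurable_compose[OF measurable_Pair1'[OF x] measurable_window_shift] by simp
      then have sh: "(\<lambda>y. \<lambda>i\<in>{..<Suc p}. case i of 0 \<Rightarrow> y | Suc j \<Rightarrow> x j) \<in> \<kappa> (restrict x {..<k}) \<rightarrow>\<^sub>M ?W"
        using measurable_cong_sets[OF \<kappa>V(2)[OF x] refl] by blast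
      have sp: "space (\<kappa> (restrict x {..<k})) = UNIV"
        using sets_eq_imp_space_eq[OF \<kappa>V(2)[OF x]] by simp
      have iff: "(\<lambda>i\<in>{..<Suc p}. case i of 0 \<Rightarrow> y | Suc j \<Rightarrow> x j) \<in> Pi\<^sub>E {..<Suc p} A \<longleftrightarrow> y \<in> A 0 \<and> x \<in> D" for y
      proof -
        have "(\<lambda>i\<in>{..<Suc p}. case i of 0 \<Rightarrow> y | Suc j \<Rightarrow> x j) \<in> Pi\<^sub>E {..<Suc p} A
          \<longleftrightarrow> (\<forall>i<Suc p. (case i of 0 \<Rightarrow> y | Suc j \<Rightarrow> x j) \<in> A i)"
          by (auto simp: PiE_iff)
        also have "\<dots> \<longleftrightarrow> y \<in> A 0 \<and> (\<forall>i<p. x i \<in> A (Suc i))"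
          by (subst All_less_Suc2) simp
        finally show ?thesis using x unfolding D_def by simp
      qed
      have "emeasure (?K x) (Pi\<^sub>E {..<Suc p} A)
        = emeasure (\<kappa> (restrict x {..<k})) ((\<lambda>y. \<lambda>i\<in>{..<Suc p}. case i of 0 \<Rightarrow> y | Suc j \<Rightarrow> x j) -` Pi\<^sub>E {..<Suc p} A \<inter> space (\<kappa> (restrict x {..<k})))"
        unfolding window_kernel_def by (rule emeasure_distr[OF sh box])
      also have "(\<lambda>y. \<lambda>i\<in>{..<Suc p}. case i of 0 \<Rightarrow> y | Suc j \<Rightarrow> x j) -` Pi\<^sub>E {..<Suc p} A \<inter> space (\<kappa> (restrict x {..<k}))
        = (if x \<in> D then A 0 else {})"
        unfolding sp vimage_def iff by auto
      also have "emeasure (\<kappa> (restrict x {..<k})) (if x \<in> D then A 0 else {})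
        = indicator D x * emeasure (\<kappa> (restrict x {..<k})) (A 0)"
        by simp
      finally show ?thesis unfolding \<kappa>x.emeasure_eq_measure .
    qed
    \<comment> \<open>C involves Y only before time 0, so it belongs to the algebra on which the
      conditional expectation is taken.\<close>
    define C where "C = {w \<in> space M. X (- 1) w \<in> D}"
    have "(\<lambda>w. X (- 1) w) \<in> ?F \<rightarrow>\<^sub>M ?W"
      unfolding X_def by (rule measurable_window) (rule measurable_past_algebra, simp)
    from measurable_sets[OF this D] have "(\<lambda>w. X (- 1) w) -` D \<inter> space M \<in> sets ?F"
      using sub unfolding subalgebra_def by simp
    also have "(\<lambda>w. X (- 1) w) -` D \<inter> space M = C" unfolding C_def by blast
    finally have C: "C \<in> sets ?F" .
    then have C_M: "C \<in> sets M" using sub unfolding subalgebra_def by auto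
    have ind: "(\<lambda>w. indicator (A 0) (Y 0 w) :: real) \<in> borel_measurable M"
      using A0 by measurable
    have int: "integrable M (\<lambda>w. indicator (A 0) (Y 0 w) :: real)"
      by (rule M.integrable_const_bound[of _ 1]) (use ind in auto)
    have "emeasure (?Q \<bind> ?K) (Pi\<^sub>E {..<Suc p} A) = (\<integral>\<^sup>+x. emeasure (?K x) (Pi\<^sub>E {..<Suc p} A) \<partial>?Q)"
      by (rule emeasure_bind_prob_algebra[OF Q_pa K box])
    also have "\<dots> = (\<integral>\<^sup>+w. emeasure (?K (X (- 1) w)) (Pi\<^sub>E {..<Suc p} A) \<partial>M)"
      unfolding stationary_law_eq[of "- 1"]
    proof (rule nn_integral_distr[OF X_measurable])
      show "(\<lambda>x. emeasure (?K x) (Pi\<^sub>E {..<Suc p} A)) \<in> borel_measurable (distr M ?W (X (- 1)))"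
        using measurable_emeasure_kernel[OF measurable_prob_algebraD[OF K] box] by simp
    qed
    also have "\<dots> = (\<integral>\<^sup>+w. ennreal (indicator C w * measure (\<kappa> (window k (\<lambda>s. Y s w) (- 1))) (A 0)) \<partial>M)"
    proof (rule nn_integral_cong)
      fix w assume w: "w \<in> space M"
      have "X (- 1) w \<in> space ?W" using measurable_space[OF X_measurable w] .
      from K_box[OF this] show "emeasure (?K (X (- 1) w)) (Pi\<^sub>E {..<Suc p} A)
        = ennreal (indicator C w * measure (\<kappa> (window k (\<lambda>s. Y s w) (- 1))) (A 0))"
        unfolding V using w by (auto simp: C_def indicator_def)
    qed
    also have "\<dots> = (\<integral>\<^sup>+w. ennreal (indicator C w * real_cond_exp M ?F (\<lambda>v. indicator (A 0) (Y 0 v)) w) \<partial>M)"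
    proof (rule nn_integral_cong_AE)
      show "AE w in M. ennreal (indicator C w * measure (\<kappa> (window k (\<lambda>s. Y s w) (- 1))) (A 0))
        = ennreal (indicator C w * real_cond_exp M ?F (\<lambda>v. indicator (A 0) (Y 0 v)) w)"
        using cond_exp[OF A0, of 0] by eventually_elim simp
    qed
    also have "\<dots> = ennreal (\<integral>w\<in>C. real_cond_exp M ?F (\<lambda>v. indicator (A 0) (Y 0 v)) w \<partial>M)"
      unfolding set_lebesgue_integral_def real_scaleR_def
    proof (rule nn_integral_eq_integral)
      show "integrable M (\<lambda>w. indicator C w * real_cond_exp M ?F (\<lambda>v. indicator (A 0) (Y 0 v)) w)"
        using integrable_mult_indicator[OF C_M F.real_cond_exp_int(1)[OF int]] by simp
      show "AE w in M. 0 \<le> indicator C w * real_cond_exp M ?F (\<lambda>v. indicator (A 0) (Y 0 v)) w"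
        using cond_exp[OF A0, of 0] by eventually_elim simp
    qed
    also have "\<dots> = ennreal (\<integral>w\<in>C. indicator (A 0) (Y 0 w) \<partial>M)"
      using F.real_cond_exp_intA[OF int C] by simp
    also have "(\<integral>w\<in>C. (indicator (A 0) (Y 0 w) :: real) \<partial>M) = (\<integral>w. indicator {w \<in> space M. X 0 w \<in> Pi\<^sub>E {..<Suc p} A} w \<partial>M)"
      unfolding set_lebesgue_integral_def
    proof (rule Bochner_Integration.integral_cong[OF refl])
      fix w assume w: "w \<in> space M"
      have XW: "X (- 1) w \<in> space ?W" using measurable_space[OF X_measurable w] .
      have "X 0 w \<in> Pi\<^sub>E {..<Suc p} A \<longleftrightarrow> (\<forall>i<Suc p. Y (- int i) w \<in> A i)"
        unfolding X_def window_def by (auto simp: PiE_iff)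
      also have "\<dots> \<longleftrightarrow> Y 0 w \<in> A 0 \<and> (\<forall>i<p. Y (- 1 - int i) w \<in> A (Suc i))"
        by (subst All_less_Suc2) (simp add: algebra_simps)
      also have "\<dots> \<longleftrightarrow> Y 0 w \<in> A 0 \<and> X (- 1) w \<in> D"
        using XW unfolding D_def by (auto simp: X_def window_def)
      finally show "indicator C w *\<^sub>R indicator (A 0) (Y 0 w) = (indicator {w \<in> space M. X 0 w \<in> Pi\<^sub>E {..<Suc p} A} w :: real)"
        using w by (auto simp: C_def indicator_def)
    qed
    also have "ennreal \<dots> = emeasure M {w \<in> space M. X 0 w \<in> Pi\<^sub>E {..<Suc p} A}"
    proof -
      have "{w \<in> space M. X 0 w \<in> Pi\<^sub>E {..<Suc p} A} \<inter> space M = {w \<in> space M. X 0 w \<in> Pi\<^sub>E {..<Suc p} A}"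
        by blast
      then show ?thesis by (simp add: M.emeasure_eq_measure)
    qed
    also have "{w \<in> space M. X 0 w \<in> Pi\<^sub>E {..<Suc p} A} = X 0 -` Pi\<^sub>E {..<Suc p} A \<inter> space M" by auto
    also have "emeasure M \<dots> = emeasure ?Q (Pi\<^sub>E {..<Suc p} A)"
      unfolding stationary_law_eq[of 0] by (rule emeasure_distr[OF X_measurable box, symmetric])
    finally show "emeasure (?Q \<bind> ?K) (Pi\<^sub>E {..<Suc p} A) = emeasure ?Q (Pi\<^sub>E {..<Suc p} A)" .
  qed (auto simp: space_PiM)
qed

end

section \<open>Selection by validation\<close>

lemma loss_measurable:
  assumes L: "loss_function L" and g: "g \<in> prediction_functions p"
  shows "loss p L g \<in> borel_measurable (window_space (Suc p))"
proof -
  have past: "(\<lambda>x. \<lambda>i\<in>{..<p}. x (Suc i)) \<in> window_space (Suc p) \<rightarrow>\<^sub>M (window_space p :: (nat \<Rightarrow> 'a) measure)"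
    unfolding window_space_def by (intro measurable_restrict measurable_component_singleton) auto
  have present: "(\<lambda>x. x 0) \<in> window_space (Suc p) \<rightarrow>\<^sub>M (borel :: 'a measure)"
    unfolding window_space_def by (intro measurable_component_singleton) auto
  have g': "g \<in> window_space p \<rightarrow>\<^sub>M borel" using g unfolding prediction_functions_def .
  have "(\<lambda>x. (g (\<lambda>i\<in>{..<p}. x (Suc i)), x 0)) \<in> window_space (Suc p) \<rightarrow>\<^sub>M borel \<Otimes>\<^sub>M borel"
    by (rule measurable_Pair[OF measurable_compose[OF past g'] present])
  from measurable_compose[OF this] L show ?thesis
    unfolding loss_function_def loss_def[abs_def] by blast
qed

lemma loss_bounds:
  assumes "loss_function L"
  shows "loss p L g x \<in> {0..1}"
  using assms rangeI[of L] unfolding loss_function_def loss_def by (metis subsetD)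

text \<open>Any \<open>b\<close> with \<open>(1 + b)\<^sup>2 \<le> 1 + 2a/(1 - a\<^sup>2)\<close> would do, and the remainder terms have room to
  spare. For \<open>\<gamma> = 0\<close> the term \<open>1 / \<gamma>\<close> is \<open>0\<close>.\<close>

lemma selection_constants:
  fixes a t \<gamma> \<mu> :: real and N m :: nat
  assumes a: "0 < a" "a < 1" and t: "1 \<le> t" and \<gamma>: "0 \<le> \<gamma>" and \<mu>: "0 \<le> \<mu>" and N: "1 \<le> N" and m: "1 \<le> m"
  defines "B \<equiv> 4 * t * (8 * (1 + 1 / \<gamma>) + 20) * ln (exp 1 * real N * (2 * exp (ln 2 / t) + 1))"
    and "b \<equiv> a / 2"
  shows "(1 + b)\<^sup>2 * \<mu> + (1 + b) * (2 * t) / (b * real m) * (ln (real N * (1 + b)) + (1 + b) * ln (1 + b))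
    \<le> \<mu> + B / (a * (1 - a) * real m) + B / (a * (1 + a) * real m) + 2 * a / (1 - a\<^sup>2) * \<mu>"
proof -
  have b: "0 < b" "b < 1 / 2" using a by (auto simp: b_def)
  have a2: "0 < 1 - a\<^sup>2" "1 - a\<^sup>2 \<le> 1" using a by (auto simp: power_less_one_iff)
  have lnN: "0 \<le> ln (real N)" using N by simp
  have "2 * a \<le> 2 * a / (1 - a\<^sup>2)" using a a2 by (simp add: pos_le_divide_eq mult_left_le)
  \<comment> \<open>With b = a/2 the left side is 1 + a + a^2/4, and a^2 <= a.\<close>
  moreover have "(1 + b)\<^sup>2 \<le> 1 + 2 * a"
  proof -
    have "a * a \<le> a" using a by (simp add: mult_left_le)
    then show ?thesis using a unfolding b_def by (simp add: power2_eq_square field_simps)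
  qed
  ultimately have 1: "(1 + b)\<^sup>2 * \<mu> \<le> \<mu> + 2 * a / (1 - a\<^sup>2) * \<mu>"
    using mult_right_mono[of "(1 + b)\<^sup>2" "1 + 2 * a / (1 - a\<^sup>2)" \<mu>] \<mu> by (simp add: distrib_right)
  have ln1b: "0 \<le> ln (1 + b)" "ln (1 + b) \<le> b" using b ln_add_one_self_le_self[of b] by auto
  \<comment> \<open>As b < 1/2, this term is at most 3/4 and ln (1 + b) at most 1/2, together
    5/4.\<close>
  have "(1 + b) * ln (1 + b) \<le> (3 / 2) * (1 / 2)" using ln1b b by (intro mult_mono) auto
  then have "ln (real N * (1 + b)) + (1 + b) * ln (1 + b) \<le> ln (real N) + 5 / 4"
    using N b ln1b by (simp add: ln_mult)
  also have "\<dots> \<le> 2 * (1 + ln (real N))" using lnN by simp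
  finally have l: "ln (real N * (1 + b)) + (1 + b) * ln (1 + b) \<le> 2 * (1 + ln (real N))" .
  \<comment> \<open>112 = 4 * 28, and 28 = 8 + 20 is what remains of the bracket when 1 / \<gamma>
    >= 0 is dropped; the logarithm is bounded below by ln (e N).\<close>
  have B: "112 * t * (1 + ln (real N)) \<le> B"
  proof -
    have "0 \<le> ln 2 / t" using t by simp
    then have "1 \<le> exp (ln 2 / t)" by simp
    then have "exp 1 * real N * 1 \<le> exp 1 * real N * (2 * exp (ln 2 / t) + 1)" by (intro mult_left_mono) auto
    then have "ln (exp 1 * real N) \<le> ln (exp 1 * real N * (2 * exp (ln 2 / t) + 1))" using N by (intro ln_mono) auto
    then have "1 + ln (real N) \<le> ln (exp 1 * real N * (2 * exp (ln 2 / t) + 1))" using N by (simp add: ln_mult)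
    note ln_le = this
    have c: "112 * t \<le> 4 * t * (8 * (1 + 1 / \<gamma>) + 20)"
    proof -
      have "28 \<le> 8 * (1 + 1 / \<gamma>) + 20" using \<gamma> by simp
      then have "4 * t * 28 \<le> 4 * t * (8 * (1 + 1 / \<gamma>) + 20)" by (rule mult_left_mono) (use t in simp)
      then show ?thesis by simp
    qed
    show ?thesis unfolding B_def by (rule mult_mono[OF c ln_le]) (use c t lnN in linarith)+
  qed
  then have B0: "0 \<le> B" using t lnN by (smt (verit) mult_nonneg_nonneg)
  have "(1 + b) * (2 * t) / (b * real m) * (ln (real N * (1 + b)) + (1 + b) * ln (1 + b))
    \<le> (1 + b) * (2 * t) / (b * real m) * (2 * (1 + ln (real N)))"
    using b t by (intro mult_left_mono l) auto
  \<comment> \<open>Dividing by b = a/2 produces the constant 8, and 8 (1 + b) <= 12 is well below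
    112.\<close>
  also have "\<dots> = (8 * (1 + b)) * (t * (1 + ln (real N))) / (a * real m)"
    using a m unfolding b_def by (simp add: field_simps)
  also have "\<dots> \<le> B / (a * real m)"
  proof (rule divide_right_mono)
    have "(8 * (1 + b)) * (t * (1 + ln (real N))) \<le> 112 * (t * (1 + ln (real N)))"
      using b t lnN by (intro mult_right_mono) auto
    then show "(8 * (1 + b)) * (t * (1 + ln (real N))) \<le> B" using B by simp
  qed (use a in simp)
  also have "\<dots> \<le> B / (a * (1 - a) * real m)"
    using a m B0 by (intro divide_left_mono mult_right_mono) (auto simp: mult_left_le)
  also have "\<dots> \<le> B / (a * (1 - a) * real m) + B / (a * (1 + a) * real m)"
    using B0 a by simp
  finally show ?thesis using 1 by linarith
qed

theorem theorem4p3: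
  fixes M :: "'w measure"
    and Y :: "int \<Rightarrow> 'w \<Rightarrow> 'y::polish_space"
    and \<kappa> :: "(nat \<Rightarrow> 'y) \<Rightarrow> 'y measure"
    and k0 p n m N ktilde :: nat
    and L Ltilde :: "'y \<times> 'y \<Rightarrow> real"
    and G :: "nat \<Rightarrow> ((nat \<Rightarrow> 'y) \<Rightarrow> 'y) set"
    and y :: "int \<Rightarrow> 'y"
    and x :: "nat \<Rightarrow> nat \<Rightarrow> 'y"
    and ghat :: "nat \<Rightarrow> (nat \<Rightarrow> 'y) \<Rightarrow> 'y"
    and khat :: "(nat \<Rightarrow> nat \<Rightarrow> 'y) \<Rightarrow> nat"
    and a :: real
  defines "S \<equiv> window_space (Suc p)"
    and "K \<equiv> window_kernel p k0 \<kappa>"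
    and "Q \<equiv> stationary_law M Y p"
  defines "EL \<equiv> expected_loss p L Q"
    and "tmix \<equiv> real (mixing_time S K Q)"
    and "\<gamma> \<equiv> pseudo_spectral_gap Q K"
  defines "B \<equiv> 4 * tmix * (8 * (1 + 1 / \<gamma>) + 20) * ln (exp 1 * real N * (2 * exp (ln 2 / tmix) + 1))"
  assumes markov: "homogeneous_markov M Y k0 \<kappa>"
    and stationary: "stationary_process M Y"
    and order: "k0 \<le> p"
    and ergodic: "uniformly_ergodic S K Q"
    and L: "loss_function L"
    and Ltilde: "loss_function Ltilde"
    and N: "1 \<le> N"
    and G: "\<And>k. k \<in> {1..N} \<Longrightarrow> G k \<subseteq> prediction_functions p"
    and n: "1 \<le> n"
    and x: "\<And>t. t \<in> {1..n} \<Longrightarrow> x t = window (Suc p) y (int t)"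
    and ghat: "\<And>k. k \<in> {1..N} \<Longrightarrow>
      is_arg_min (training_loss p Ltilde n x) (\<lambda>g. g \<in> G k) (ghat k)"
    and ktilde: "is_arg_min (\<lambda>k. EL (ghat k)) (\<lambda>k. k \<in> {1..N}) ktilde"
    and m: "1 \<le> m"
    and khat_measurable: "khat \<in> PiM {n+1..n+m} (\<lambda>_. S) \<rightarrow>\<^sub>M count_space UNIV"
    and khat: "\<And>v. v \<in> space (PiM {n+1..n+m} (\<lambda>_. S)) \<Longrightarrow>
      is_arg_min (\<lambda>k. validation_loss p L n m v (ghat k)) (\<lambda>k. k \<in> {1..N}) (khat v)"
    and a: "0 < a" "a < 1"
  shows "(\<integral>w. (EL (ghat (khat (restrict w {n+1..n+m}))) - EL (ghat ktilde)) \<partial>path_law S K n (x n) m)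
           \<le> B / (a * (1 - a) * real m) + B / (a * (1 + a) * real m)
             + 2 * a / (1 - a\<^sup>2) * EL (ghat ktilde) \<and>
         (\<forall>gstar. is_arg_min EL (\<lambda>g. g \<in> prediction_functions p) gstar \<longrightarrow>
           (\<integral>w. (EL (ghat (khat (restrict w {n+1..n+m}))) - EL gstar) \<partial>path_law S K n (x n) m)
           \<le> (1 + 2 * a / (1 - a\<^sup>2)) * (EL (ghat ktilde) - EL gstar)
             + B / (a * (1 - a) * real m) + B / (a * (1 + a) * real m)
             + 2 * a / (1 - a\<^sup>2) * EL gstar)"
proof -
  interpret markov_window M Y \<kappa> k0 p by standard (fact markov stationary order)+
  have sets_Q: "sets Q = sets S" unfolding Q_def S_def by (rule sets_stationary_law)
  have prob_Q: "prob_space Q" unfolding Q_def by (rule prob_space_stationary_law)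
  have K: "K \<in> S \<rightarrow>\<^sub>M prob_algebra S"
    unfolding K_def S_def by (rule window_kernel_measurable[OF \<kappa>_measurable order])
  interpret E: ergodic_kernel S K Q
    by (intro ergodic_kernel.intro markov_kernel.intro ergodic_kernel_axioms.intro K prob_Q sets_Q ergodic)
  \<comment> \<open>Q and S share their measurable sets, hence their space of probability measures;
    so K, built as a kernel on S, is also one on Q.\<close>
  have "prob_algebra Q = prob_algebra S"
    unfolding prob_algebra_def using subprob_algebra_cong[OF sets_Q] by simp
  then have K_Q: "K \<in> Q \<rightarrow>\<^sub>M prob_algebra Q"
    unfolding measurable_cong_sets[OF sets_Q refl] by (simp only: K)
  interpret invariant_kernel Q K
    unfolding invariant_kernel_def invariant_kernel_axioms_def
    using prob_Q K_Q window_kernel_invariant unfolding Q_def K_def by blast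
  have \<gamma>: "0 \<le> \<gamma>" unfolding \<gamma>_def by (rule pseudo_spectral_gap_nonneg)
  have t: "1 \<le> tmix" unfolding tmix_def using E.mixing_time_pos by simp
  have xS: "x n \<in> space S" using x[of n] n by (simp add: S_def window_space_def window_def space_PiM)
  \<comment> \<open>Outside 1..N nothing is known of \<open>ghat\<close>; the value 0 there keeps
    every \<open>f k\<close> measurable with values in the unit interval.\<close>
  define f where "f k = (if k \<in> {1..N} then loss p L (ghat k) else (\<lambda>_. 0))" for k
  have ghat_pred: "ghat k \<in> prediction_functions p" if "k \<in> {1..N}" for k
    using ghat[OF that] G[OF that] unfolding is_arg_min_def by blast
  have f_meas: "f k \<in> borel_measurable S" for k
    unfolding f_def S_def using loss_measurable[OF L ghat_pred] by simp
  have f01: "f k \<in> space S \<rightarrow> {0..1}" for k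
    unfolding f_def using loss_bounds[OF L] by auto
  have kt: "ktilde \<in> {1..N}" using ktilde unfolding is_arg_min_def by blast
  have kh: "khat v \<in> {1..N}" if "v \<in> space (PiM {n+1..n+m} (\<lambda>_. S))" for v
    using khat[OF that] unfolding is_arg_min_def by blast
  have kh_le: "(\<Sum>j=n+1..n+m. f (khat v) (v j)) \<le> (\<Sum>j=n+1..n+m. f ktilde (v j))"
    if v: "v \<in> space (PiM {n+1..n+m} (\<lambda>_. S))" for v
  proof -
    have "validation_loss p L n m v (ghat (khat v)) \<le> validation_loss p L n m v (ghat ktilde)"
      using khat[OF v] kt unfolding is_arg_min_linorder by blast
    then show ?thesis
      using kh[OF v] kt m unfolding validation_loss_def f_def by (simp add: divide_le_cancel)
  qed
  have EL_f: "EL (ghat k) = (\<integral>x. f k x \<partial>Q)" if "k \<in> {1..N}" for k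
    using that unfolding EL_def expected_loss_def f_def by simp
  let ?P = "path_law S K n (x n) m"
  interpret P: prob_space ?P by (rule E.prob_space_path_law[OF xS])
  have "restrict w {n+1..n+m} \<in> space (PiM {n+1..n+m} (\<lambda>_. S))" if "w \<in> space ?P" for w
    using that sets_eq_imp_space_eq[OF E.sets_path_law[OF xS, of n m]] by (auto simp: space_PiM)
  then have EL_khat: "EL (ghat (khat (restrict w {n+1..n+m}))) = (\<integral>x. f (khat (restrict w {n+1..n+m})) x \<partial>Q)"
    if "w \<in> space ?P" for w
    using that by (intro EL_f kh)
  have b: "a / 2 > 0" using a by simp
  have m': "m > 0" using m by simp
  note sel = E.selection_risk_bound[OF xS f_meas f01 m' b kt khat_measurable kh kh_le]
  \<comment> \<open>Integrability is what allows subtracting a constant under the integral in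
    \<open>shift\<close>.\<close>
  have int: "integrable ?P (\<lambda>w. EL (ghat (khat (restrict w {n+1..n+m}))))"
    using sel(2) by (subst Bochner_Integration.integrable_cong[OF refl EL_khat])
  have "(\<integral>w. EL (ghat (khat (restrict w {n+1..n+m}))) \<partial>?P) = (\<integral>w. (\<integral>x. f (khat (restrict w {n+1..n+m})) x \<partial>Q) \<partial>?P)"
    by (rule Bochner_Integration.integral_cong[OF refl EL_khat])
  also have "\<dots> \<le> (1 + a / 2)\<^sup>2 * EL (ghat ktilde)
      + (1 + a / 2) * (2 * tmix) / (a / 2 * real m) * (ln (real N * (1 + a / 2)) + (1 + a / 2) * ln (1 + a / 2))"
    using sel(1) unfolding EL_f[OF kt] tmix_def .
  also have "\<dots> \<le> EL (ghat ktilde) + B / (a * (1 - a) * real m) + B / (a * (1 + a) * real m)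
      + 2 * a / (1 - a\<^sup>2) * EL (ghat ktilde)"
    unfolding B_def
  proof (rule selection_constants[OF a t \<gamma> _ N m])
    show "0 \<le> EL (ghat ktilde)"
      unfolding EL_def expected_loss_def using loss_bounds[OF L] by (intro Bochner_Integration.integral_nonneg) auto
  qed
  finally have main: "(\<integral>w. EL (ghat (khat (restrict w {n+1..n+m}))) \<partial>?P)
    \<le> EL (ghat ktilde) + B / (a * (1 - a) * real m) + B / (a * (1 + a) * real m)
      + 2 * a / (1 - a\<^sup>2) * EL (ghat ktilde)" .
  have shift: "(\<integral>w. EL (ghat (khat (restrict w {n+1..n+m}))) - c \<partial>?P)
    = (\<integral>w. EL (ghat (khat (restrict w {n+1..n+m}))) \<partial>?P) - c" for c
    using int by (simp add: P.prob_space)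
  show ?thesis
  proof (intro conjI allI impI)
    show "(\<integral>w. (EL (ghat (khat (restrict w {n+1..n+m}))) - EL (ghat ktilde)) \<partial>?P)
      \<le> B / (a * (1 - a) * real m) + B / (a * (1 + a) * real m) + 2 * a / (1 - a\<^sup>2) * EL (ghat ktilde)"
      unfolding shift using main by linarith
    fix gstar
    \<comment> \<open>Adding e - c to both sides of the first inequality, with e the loss of the
      best candidate and c that of \<open>gstar\<close>, gives the second one; its right side is
      only rearranged.\<close>
    have regroup: "(1 + q) * (e - c) + u + v + q * c = (e - c) + u + v + q * e" for q e c u v :: real
      by (simp add: algebra_simps)
    show "(\<integral>w. (EL (ghat (khat (restrict w {n+1..n+m}))) - EL gstar) \<partial>?P)
      \<le> (1 + 2 * a / (1 - a\<^sup>2)) * (EL (ghat ktilde) - EL gstar)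
        + B / (a * (1 - a) * real m) + B / (a * (1 + a) * real m) + 2 * a / (1 - a\<^sup>2) * EL gstar"
      unfolding shift regroup using main by linarith
  qed
qed

end
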